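(* Let $r_t$, $P_t^0$, $Q_t^0$ satisfy (R0), (S1), (S2), (H0)–(H4) as stated in the context, and let $P_t$, $P_{t,\varepsilon}$ be the operators defined there. Suppose that (L0), (L1) and (H5) hold. Then: (CoJ1) for all $t\in(0,1]$ and $f\in C_0(\mathbb R^d)$, $f\ge0$ implies $P_tf\ge0$; (CoJ3) for all $t,s>0$ with $t+s\le1$ and $f\in C_0(\mathbb R^d)$, $P_tP_sf=P_{t+s}f$. If additionally (L2) holds, then also: (CoJ2) for all $t\in(0,1]$ and $f\in C_0(\mathbb R^d)$, $f\le1$ implies $P_tf\le1$.
   Context: $B_b(\mathbb R^d)$ is the space of bounded Borel functions and $C_0(\mathbb R^d)$ the space of continuous functions vanishing at infinity, both with the supremum norm $\|\cdot\|_\infty$. Standing assumptions: (R0) $t\mapsto r_t$ is a non-negative, non-decreasing function such that $r_{\lambda t}\le\sqrt\lambda\,r_t$ for all $t\in(0,1]$, $0<\lambda\le1$. (S1) For $t\in(0,1]$, $P_t^0,Q_t^0:B_b(\mathbb R^d)\to B_b(\mathbb R^d)$ are linear operators. (S2) For $t\in(0,1]$, $P_t^0$ and $Q_t^0$ map $C_0(\mathbb R^d)$ into $C_0(\mathbb R^d)$. (H0) $\lim_{t\to0^+}\|P_t^0f-f\|_\infty=0$ for all $f\in C_0(\mathbb R^d)$. (H1) There is $C_1>0$ with $\|P_t^0f\|_\infty\le C_1\|f\|_\infty$ for all $t\in(0,1]$, $f\in B_b(\mathbb R^d)$. (H2) $\lim_{s\to t}\|P_s^0f-P_t^0f\|_\infty=0$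 for all $t\in(0,1]$, $f\in B_b(\mathbb R^d)$. (H3) There are $C_3,\varepsilon_0>0$ with $\|Q_t^0f\|_\infty\le C_3t^{-1}r_t^{\varepsilon_0}\|f\|_\infty$ for all $t\in(0,1]$, $f\in B_b(\mathbb R^d)$. (H4) $\lim_{s\to t}\|Q_s^0f-Q_t^0f\|_\infty=0$ for all $t\in(0,1]$, $f\in B_b(\mathbb R^d)$. Under these assumptions the following are well defined (Bochner integrals, absolutely convergent series) for $t\in(0,1]$: $$Q_t^nf=\int_{0<s_1<\dots<s_n<t}Q_{t-s_n}^0Q^0_{s_n-s_{n-1}}\cdots Q_{s_2-s_1}^0Q_{s_1}^0f\,ds_1\cdots ds_n,\quad Q_tf=Q_t^0f+\sum_{n=1}^\infty Q_t^nf,\quad P_tf=P_t^0f+\int_0^tP_{t-s}^0Q_sf\,ds,$$ and for $t,\varepsilon\ge0$, $0<t+\varepsilon\le1$, $f\in C_0(\mathbb R^d)$, $P_{t,\varepsilon}f=P_{t+\varepsilon}^0f+\int_0^tP_{t-s+\varepsilon}^0Q_sf\,ds$. Further hypotheses: (L0) $L$ is a linear operator defined on a linear subspace $D(L)$ of the space of real-valued functions on $\mathbb R^d$, with values in real-valued functions on $\mathbb R^d$. (L1) Positive maximum principle: if $f\in D(L)$ satisfies $f(x_0)=\sup_{x\in\mathbb R^d}f(x)\ge0$, then $Lf(x_0)\le0$. (L2) A non-zero constant function on $\mathbb R^d$ belongs to $D(L)$. (H5) For all $t,\varepsilon>0$ with $t+\varepsilon\le1$, $x\in\mathbb R^d$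 and $f\in C_0(\mathbb R^d)$: $t\mapsto P_{t,\varepsilon}f(x)$ is differentiable, $P_{t,\varepsilon}f\in D(L)$, and $$(\partial_t-L_x)P_{t,\varepsilon}f(x)=P_\varepsilon^0Q_tf(x)-Q_{t+\varepsilon}^0f(x)-\int_0^tQ_{t-s+\varepsilon}^0Q_sf(x)\,ds,$$ where $L_x$ means $L$ acting in the variable $x$. *)

theory Defs
  imports "HOL-Analysis.Analysis"
begin

section \<open>The Banach space of bounded Borel functions\<close>

definition bborel_set :: "('a::topological_space \<Rightarrow> real) set" where
  "bborel_set = {f. f \<in> borel_measurable borel \<and> bounded (range f)}"

typedef (overloaded) 'a bborel = "bborel_set :: ('a::topological_space \<Rightarrow> real) set"
  morphisms apply_bborel Bborel
  by (rule exI[of _ "\<lambda>_. 0"]) (auto simp: bborel_set_def)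

declare [[coercion "apply_bborel :: 'a::topological_space bborel \<Rightarrow> 'a \<Rightarrow> real"]]

setup_lifting type_definition_bborel

lemma bborel_eqI: "(\<And>x. apply_bborel f x = apply_bborel g x) \<Longrightarrow> f = g"
  by transfer auto

lemma measurable_apply_bborel [measurable, simp]: "apply_bborel f \<in> borel_measurable borel"
  and bounded_apply_bborel [simp]: "bounded (range (apply_bborel f))"
  using apply_bborel[of f] by (auto simp: bborel_set_def)

instantiation bborel :: (topological_space) real_vector
begin

lift_definition zero_bborel :: "'a bborel" is "\<lambda>_. 0"
  by (auto simp: bborel_set_def)

lift_definition plus_bborel :: "'a bborel \<Rightarrow> 'a bborel \<Rightarrow> 'a bborel" is "\<lambda>f g x. f x + g x"
  by (auto simp: bborel_set_def intro: bounded_plus_comp)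

lift_definition minus_bborel :: "'a bborel \<Rightarrow> 'a bborel \<Rightarrow> 'a bborel" is "\<lambda>f g x. f x - g x"
  by (auto simp: bborel_set_def intro: bounded_minus_comp)

lift_definition uminus_bborel :: "'a bborel \<Rightarrow> 'a bborel" is "\<lambda>f x. - f x"
  by (auto simp: bborel_set_def)

lift_definition scaleR_bborel :: "real \<Rightarrow> 'a bborel \<Rightarrow> 'a bborel" is "\<lambda>r f x. r *\<^sub>R f x"
  proof -
  fix r :: real and f :: "'a \<Rightarrow> real"
  assume "f \<in> bborel_set"
  then show "(\<lambda>x. r *\<^sub>R f x) \<in> bborel_set"
    using bounded_scaleR_comp[of f UNIV r] by (auto simp: bborel_set_def)
qed

instance
  by standard (transfer; simp add: fun_eq_iff algebra_simps)+

end

lemmas [simp] = zero_bborel.rep_eq plus_bborel.rep_eq minus_bborel.rep_eq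
  uminus_bborel.rep_eq scaleR_bborel.rep_eq

instantiation bborel :: (topological_space) real_normed_vector
begin

definition norm_bborel :: "'a bborel \<Rightarrow> real" where
  "norm_bborel f = (SUP x. \<bar>apply_bborel f x\<bar>)"

definition sgn_bborel :: "'a bborel \<Rightarrow> 'a bborel" where
  "sgn_bborel f = f /\<^sub>R norm f"

definition dist_bborel :: "'a bborel \<Rightarrow> 'a bborel \<Rightarrow> real" where
  "dist_bborel f g = norm (f - g)"

definition uniformity_bborel :: "('a bborel \<times> 'a bborel) filter" where
  "uniformity_bborel = (INF e\<in>{0 <..}. principal {(x, y). dist x y < e})"

definition open_bborel :: "'a bborel set \<Rightarrow> bool" where
  "open_bborel S = (\<forall>x\<in>S. \<forall>\<^sub>F (x', y) in uniformity. x' = x \<longrightarrow> y \<in> S)"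

lemma abs_le_norm_bborel: "\<bar>apply_bborel f x\<bar> \<le> norm f" for f :: "'a bborel"
  unfolding norm_bborel_def
proof (rule cSUP_upper)
  obtain B where "\<forall>y\<in>range (apply_bborel f). norm y \<le> B"
    using bounded_apply_bborel[of f] unfolding bounded_iff by blast
  then show "bdd_above (range (\<lambda>x. \<bar>apply_bborel f x\<bar>))"
    by (auto intro!: bdd_aboveI[of _ B])
qed simp

lemma norm_bborel_le: "(\<And>x. \<bar>apply_bborel f x\<bar> \<le> b) \<Longrightarrow> norm f \<le> b" for f :: "'a bborel"
  unfolding norm_bborel_def by (rule cSUP_least) auto

instance
proof
  fix f g :: "'a bborel" and a :: real
  show "dist f g = norm (f - g)" "sgn f = f /\<^sub>R norm f"
    "uniformity = (INF e\<in>{0<..}. principal {(x, y::'a bborel). dist x y < e})"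
    by (rule dist_bborel_def sgn_bborel_def uniformity_bborel_def)+
  show "open U = (\<forall>x\<in>U. \<forall>\<^sub>F (x', y) in uniformity. x' = x \<longrightarrow> y \<in> U)" for U :: "'a bborel set"
    by (rule open_bborel_def)
  show "norm f = 0 \<longleftrightarrow> f = 0"
  proof
    assume "norm f = 0"
    then have "apply_bborel f x = 0" for x
      using abs_le_norm_bborel[of f x] by simp
    then show "f = 0"
      by (intro bborel_eqI) (simp add: zero_bborel.rep_eq)
  qed (simp add: norm_bborel_def zero_bborel.rep_eq)
  show "norm (f + g) \<le> norm f + norm g"
  proof (rule norm_bborel_le)
    fix x
    show "\<bar>apply_bborel (f + g) x\<bar> \<le> norm f + norm g"
      using abs_le_norm_bborel[of f x] abs_le_norm_bborel[of g x]
      by (simp add: plus_bborel.rep_eq)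
  qed
  have le: "norm (c *\<^sub>R k) \<le> \<bar>c\<bar> * norm k" for c and k :: "'a bborel"
    by (rule norm_bborel_le)
      (simp add: scaleR_bborel.rep_eq abs_mult mult_left_mono abs_le_norm_bborel)
  show "norm (a *\<^sub>R f) = \<bar>a\<bar> * norm f"
  proof (cases "a = 0")
    case True
    then have "a *\<^sub>R f = 0"
      by transfer simp
    with True show ?thesis
      by (simp add: norm_bborel_def zero_bborel.rep_eq)
  next
    case False
    then have "inverse a *\<^sub>R (a *\<^sub>R f) = f"
      by transfer (simp add: fun_eq_iff)
    then have "norm f \<le> \<bar>inverse a\<bar> * norm (a *\<^sub>R f)"
      using le[of "inverse a" "a *\<^sub>R f"] by simp
    with False have "\<bar>a\<bar> * norm f \<le> norm (a *\<^sub>R f)"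
      by (simp add: field_simps)
    with le[of a f] show ?thesis by simp
  qed
qed

end

instance bborel :: (topological_space) banach
proof
  fix X :: "nat \<Rightarrow> 'a bborel"
  assume X: "Cauchy X"
  have pt: "\<bar>X m x - X n x\<bar> \<le> dist (X m) (X n)" for m n x
    using abs_le_norm_bborel[of "X m - X n" x] by (simp add: dist_norm)
  have "Cauchy (\<lambda>n. X n x)" for x
  proof (rule metric_CauchyI)
    fix e :: real assume "e > 0"
    then obtain M where "\<forall>m\<ge>M. \<forall>n\<ge>M. dist (X m) (X n) < e"
      using metric_CauchyD[OF X] by blast
    then show "\<exists>M. \<forall>m\<ge>M. \<forall>n\<ge>M. dist (X m x) (X n x) < e"
      using pt by (metis dist_real_def le_less_trans)
  qed
  then have lim: "(\<lambda>n. X n x) \<longlonglongrightarrow> lim (\<lambda>n. X n x)" for x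
    using Cauchy_convergent convergent_LIMSEQ_iff by blast
  define g where "g = (\<lambda>x. lim (\<lambda>n. X n x))"
  have unif: "\<exists>M. \<forall>n\<ge>M. \<forall>x. \<bar>X n x - g x\<bar> \<le> e" if "e > 0" for e
  proof -
    from that obtain M where M: "\<And>m n. m \<ge> M \<Longrightarrow> n \<ge> M \<Longrightarrow> dist (X m) (X n) < e"
      using metric_CauchyD[OF X] by blast
    have "\<bar>X n x - g x\<bar> \<le> e" if "n \<ge> M" for n x
    proof (rule LIMSEQ_le_const2)
      show "(\<lambda>m. \<bar>X n x - X m x\<bar>) \<longlonglongrightarrow> \<bar>X n x - g x\<bar>"
        unfolding g_def by (intro tendsto_intros lim)
      show "\<exists>N. \<forall>m\<ge>N. \<bar>X n x - X m x\<bar> \<le> e"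
        using M[OF that] pt by (meson less_imp_le order_trans)
    qed
    then show ?thesis by blast
  qed
  have "g \<in> borel_measurable borel"
    unfolding g_def by (rule borel_measurable_LIMSEQ_real[OF lim[unfolded g_def]]) simp
  moreover have "bounded (range g)"
  proof -
    obtain M where "\<forall>n\<ge>M. \<forall>x. \<bar>X n x - g x\<bar> \<le> 1"
      using unif[of 1] by auto
    then have "\<bar>g x\<bar> \<le> norm (X M) + 1" for x
      using abs_le_norm_bborel[of "X M" x] by (smt (verit) order_refl)
    then show ?thesis by (auto intro!: boundedI)
  qed
  ultimately obtain G where G: "g = apply_bborel G"
    by (metis (mono_tags, lifting) Bborel_inverse bborel_set_def mem_Collect_eq)
  have "X \<longlonglongrightarrow> G"
  proof (rule metric_LIMSEQ_I)
    fix e :: real assume "e > 0"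
    then obtain M where M: "\<forall>n\<ge>M. \<forall>x. \<bar>X n x - g x\<bar> \<le> e / 2"
      using unif[of "e / 2"] by auto
    have "dist (X n) G < e" if "n \<ge> M" for n
    proof -
      have "norm (X n - G) \<le> e / 2"
        using M that by (intro norm_bborel_le) (simp add: G)
      with \<open>e > 0\<close> show ?thesis by (simp add: dist_norm)
    qed
    then show "\<exists>no. \<forall>n\<ge>no. dist (X n) G < e" by blast
  qed
  then show "convergent X" by (rule convergentI)
qed

definition C0 :: "'a::real_normed_vector bborel set" where
  "C0 = {f. continuous_on UNIV (apply_bborel f) \<and> (apply_bborel f \<longlongrightarrow> 0) at_infinity}"

text \<open>Every continuous function vanishing at infinity is bounded and Borel, so \<open>C0\<close> is all of
  $C_0(\mathbb{R}^d)$.\<close>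

lemma apply_bborel_C0:
  "apply_bborel ` C0 = {f :: 'a::euclidean_space \<Rightarrow> real. continuous_on UNIV f \<and> (f \<longlongrightarrow> 0) at_infinity}"
proof (intro subset_antisym subsetI)
  fix f :: "'a \<Rightarrow> real"
  assume f: "f \<in> {f. continuous_on UNIV f \<and> (f \<longlongrightarrow> 0) at_infinity}"
  then have c: "continuous_on UNIV f" and l: "(f \<longlongrightarrow> 0) at_infinity" by auto
  obtain b where b: "\<And>x. b \<le> norm x \<Longrightarrow> \<bar>f x\<bar> < 1"
    using tendstoD[OF l, of 1] by (auto simp: eventually_at_infinity)
  have "compact (f ` cball 0 b)"
    using c by (intro compact_continuous_image) (auto intro: continuous_on_subset)
  then obtain B where B: "\<And>x. norm x \<le> b \<Longrightarrow> \<bar>f x\<bar> \<le> B"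
    by (force dest!: compact_imp_bounded simp: bounded_iff)
  have "\<bar>f x\<bar> \<le> max B 1" for x
    using b[of x] B[of x] by (cases "norm x \<le> b") auto
  then have "f \<in> bborel_set"
    using c by (auto simp: bborel_set_def intro!: borel_measurable_continuous_onI boundedI)
  then have "f = apply_bborel (Bborel f)" by (simp add: Bborel_inverse)
  with c l show "f \<in> apply_bborel ` C0" by (auto simp: C0_def intro!: image_eqI[of _ _ "Bborel f"])
qed (auto simp: C0_def)


section \<open>Bochner integral\<close>

text \<open>This is the library's definition of \<^term>\<open>has_bochner_integral\<close> with the restriction to
  second countable value spaces removed: \<^typ>\<open>'a bborel\<close> is not separable. Measurability
  of the integrand together with the existence of the approximating simple functions
  implies that the integrand is almost everywhere separably valued.\<close>

definition has_gen_bochner_integral :: "'a measure \<Rightarrow> ('a \<Rightarrow> 'b::real_normed_vector) \<Rightarrow> 'b \<Rightarrow> bool" where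
  "has_gen_bochner_integral M f y \<longleftrightarrow>
     f \<in> borel_measurable M \<and>
     (\<exists>s. (\<forall>i. Bochner_Integration.simple_bochner_integrable M (s i)) \<and>
          (\<lambda>i. \<integral>\<^sup>+x. norm (f x - s i x) \<partial>M) \<longlonglongrightarrow> 0 \<and>
          (\<lambda>i::nat. Bochner_Integration.simple_bochner_integral M (s i)) \<longlonglongrightarrow> y)"

definition gen_bochner_integral :: "'a measure \<Rightarrow> ('a \<Rightarrow> 'b::real_normed_vector) \<Rightarrow> 'b" where
  "gen_bochner_integral M f =
     (if \<exists>y. has_gen_bochner_integral M f y then THE y. has_gen_bochner_integral M f y else 0)"

definition set_gen_bochner_integral ::
    "'a measure \<Rightarrow> 'a set \<Rightarrow> ('a \<Rightarrow> 'b::real_normed_vector) \<Rightarrow> 'b" where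
  "set_gen_bochner_integral M A f = gen_bochner_integral M (\<lambda>x. indicator A x *\<^sub>R f x)"


section \<open>The perturbation series\<close>

text \<open>\<open>iter_Q Q0 \<sigma> m f\<close> is $Q^0_{\sigma_m-\sigma_{m-1}} \cdots Q^0_{\sigma_1-\sigma_0} f$.\<close>

primrec iter_Q :: "(real \<Rightarrow> 'b \<Rightarrow> 'b) \<Rightarrow> (nat \<Rightarrow> real) \<Rightarrow> nat \<Rightarrow> 'b \<Rightarrow> 'b" where
  "iter_Q Q0 \<sigma> 0 f = f"
| "iter_Q Q0 \<sigma> (Suc m) f = Q0 (\<sigma> (Suc m) - \<sigma> m) (iter_Q Q0 \<sigma> m f)"

text \<open>\<open>nodes n t s\<close> extends $(s_1,\dots,s_n)$ by $s_0 = 0$ and $s_{n+1} = t$.\<close>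

definition nodes :: "nat \<Rightarrow> real \<Rightarrow> (nat \<Rightarrow> real) \<Rightarrow> nat \<Rightarrow> real" where
  "nodes n t s = s(0 := 0, Suc n := t)"

definition open_simplex :: "nat \<Rightarrow> real \<Rightarrow> (nat \<Rightarrow> real) set" where
  "open_simplex n t =
     {s \<in> space (\<Pi>\<^sub>M i\<in>{1..n}. lborel). \<forall>i\<le>n. nodes n t s i < nodes n t s (Suc i)}"

definition Q_term :: "(real \<Rightarrow> 'b \<Rightarrow> 'b) \<Rightarrow> nat \<Rightarrow> real \<Rightarrow> 'b \<Rightarrow> 'b::real_normed_vector" where
  "Q_term Q0 n t f =
     set_gen_bochner_integral (\<Pi>\<^sub>M i\<in>{1..n}. lborel) (open_simplex n t)
       (\<lambda>s. iter_Q Q0 (nodes n t s) (Suc n) f)"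

definition Q_op :: "(real \<Rightarrow> 'b \<Rightarrow> 'b) \<Rightarrow> real \<Rightarrow> 'b \<Rightarrow> 'b::real_normed_vector" where
  "Q_op Q0 t f = Q0 t f + (\<Sum>n. Q_term Q0 (Suc n) t f)"

definition P_op ::
    "(real \<Rightarrow> 'b \<Rightarrow> 'b) \<Rightarrow> (real \<Rightarrow> 'b \<Rightarrow> 'b) \<Rightarrow> real \<Rightarrow> 'b \<Rightarrow> 'b::real_normed_vector" where
  "P_op P0 Q0 t f =
     P0 t f + set_gen_bochner_integral lborel {0<..<t} (\<lambda>s. P0 (t - s) (Q_op Q0 s f))"

definition P_eps ::
    "(real \<Rightarrow> 'b \<Rightarrow> 'b) \<Rightarrow> (real \<Rightarrow> 'b \<Rightarrow> 'b) \<Rightarrow> real \<Rightarrow> real \<Rightarrow> 'b \<Rightarrow> 'b::real_normed_vector" where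
  "P_eps P0 Q0 t \<epsilon> f =
     P0 (t + \<epsilon>) f + set_gen_bochner_integral lborel {0<..<t} (\<lambda>s. P0 (t - s + \<epsilon>) (Q_op Q0 s f))"


section \<open>The operator \<open>L\<close>\<close>

text \<open>\<open>L\<close> is only meaningful on its domain \<open>D\<close>; no condition is imposed outside \<open>D\<close>.\<close>

definition linear_operator_on ::
    "('x \<Rightarrow> real) set \<Rightarrow> (('x \<Rightarrow> real) \<Rightarrow> ('x \<Rightarrow> real)) \<Rightarrow> bool" where
  "linear_operator_on D L \<longleftrightarrow>
     (\<lambda>_. 0) \<in> D \<and>
     (\<forall>f\<in>D. \<forall>g\<in>D. (\<lambda>x. f x + g x) \<in> D \<and> L (\<lambda>x. f x + g x) = (\<lambda>x. L f x + L g x)) \<and>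
     (\<forall>f\<in>D. \<forall>c. (\<lambda>x. c * f x) \<in> D \<and> L (\<lambda>x. c * f x) = (\<lambda>x. c * L f x))"

text \<open>The supremum is taken in the extended reals, since \<open>f\<close> need not be bounded.\<close>

definition positive_maximum_principle ::
    "('x \<Rightarrow> real) set \<Rightarrow> (('x \<Rightarrow> real) \<Rightarrow> ('x \<Rightarrow> real)) \<Rightarrow> bool" where
  "positive_maximum_principle D L \<longleftrightarrow>
     (\<forall>f\<in>D. \<forall>x0. ereal (f x0) = (SUP x. ereal (f x)) \<and> f x0 \<ge> 0 \<longrightarrow> L f x0 \<le> 0)"

end

theory Submission
  imports Defs
begin

text \<open>
  Fix \<open>f \<in> C0\<close> and write \<open>u \<epsilon> t\<close> for $P_{t,\varepsilon}f$, with \<open>u 0 t\<close> equal to $P_tf$ and \<open>u 0 0 = f\<close>. The function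
  \<open>u \<epsilon>\<close> solves the evolution equation of \<open>L\<close> up to the residual
  $P^0_\varepsilon Q_tf - Q^0_{t+\varepsilon}f - \int_0^t Q^0_{t-s+\varepsilon}Q_sf\,ds$. At \<open>\<epsilon> = 0\<close> the residual is
  $Q_tf - Q^0_tf - \int_0^t Q^0_{t-s}Q_sf\,ds$, and this is zero because the perturbation series solves the Volterra
  equation (\<open>Q_op_volterra\<close>). Both \<open>u\<close> and the residual are jointly norm continuous in \<open>\<epsilon>\<close> and \<open>t\<close>, the former
  on a closed rectangle and the latter away from \<open>t = 0\<close>; by compactness the residual is uniformly small for small \<open>\<epsilon>\<close>
  once a neighbourhood of \<open>t = 0\<close> is removed, and on that neighbourhood \<open>u\<close> itself is close to \<open>f\<close>.

  Suppose that \<open>u \<epsilon> t x - \<theta> * t\<close> exceeds a level \<open>c \<ge> 0\<close> that it does not exceed for small \<open>t\<close>. Its maximum over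
  space-time is attained, because \<open>u \<epsilon> t\<close> vanishes at infinity, and there the time derivative of \<open>u\<close> is at least
  \<open>\<theta>\<close>, while \<open>L u \<le> 0\<close> by the positive maximum principle. So the residual is at least \<open>\<theta>\<close>, which is false for
  small \<open>\<epsilon>\<close>. Hence \<open>f \<le> c\<close> implies $P_tf \le c$ (\<open>approximate_maximum_principle\<close>).

  The three claims are instances of this principle. The level \<open>c = 1\<close> is the sub-Markov property. Since \<open>D\<close> is a linear
  space, differences of approximate solutions are approximate solutions: applied to \<open>0 - u\<close> with \<open>c = 0\<close> the principle
  gives positivity, and applied with \<open>c = 0\<close> to both differences of $P_{t,\varepsilon}(P_sf)$ and $P_{t+s,\varepsilon}f$,
  which agree at \<open>\<epsilon> = t = 0\<close>, it gives the semigroup law. Times at the end of the unit interval are reached by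
  continuity, as room for a positive \<open>\<epsilon>\<close> is needed.

  The analytic work is in showing that the objects behave as expected. The space of bounded Borel functions is not separable,
  so Bochner integrals are constructed for pointwise limits of simple functions with values in the closed subspace \<open>C0\<close>;
  once the integral exists, it can be evaluated at points, and Fubini's theorem, substitution and uniqueness are
  only needed for real-valued functions. All singular time integrals are controlled by the kernel \<open>u powr (\<eta> - 1)\<close>, which becomes a
  contraction under convolution after an exponential change of weight; this gives the geometric convergence of the series.
\<close>

section \<open>Bochner integrals in a non-separable Banach space\<close>

text \<open>
  Borel measurability alone does not provide simple approximations when the range is not separable, so they are part of
  the notion. Recording a set \<open>W\<close> in which the approximations take their values lets integrals of \<open>C0\<close>-valued functions
  be seen to lie in \<open>C0\<close>.
\<close>

definition strongly_measurable_in :: "'b::real_normed_vector set \<Rightarrow> 'a measure \<Rightarrow> ('a \<Rightarrow> 'b) \<Rightarrow> bool" where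
  "strongly_measurable_in W M F \<longleftrightarrow>
     (\<exists>s. (\<forall>i. simple_function M (s i)) \<and> (\<forall>i. \<forall>x\<in>space M. s i x \<in> W) \<and>
          (\<forall>x\<in>space M. (\<lambda>i::nat. s i x) \<longlonglongrightarrow> F x))"

lemma strongly_measurable_in_imp_borel:
  assumes "strongly_measurable_in W M F"
  shows "F \<in> borel_measurable M"
proof -
  from assms obtain s where "\<And>i::nat. simple_function M (s i)"
    "\<And>x. x \<in> space M \<Longrightarrow> (\<lambda>i. s i x) \<longlonglongrightarrow> F x"
    unfolding strongly_measurable_in_def by blast
  then show ?thesis
    by (intro borel_measurable_LIMSEQ_metric[of s M F] borel_measurable_simple_function)
qed

lemma strongly_measurable_in_cong:
  assumes "strongly_measurable_in W M F" "\<And>x. x \<in> space M \<Longrightarrow> F x = G x"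
  shows "strongly_measurable_in W M G"
  using assms unfolding strongly_measurable_in_def by metis

lemma strongly_measurable_in_const:
  assumes "w \<in> W"
  shows "strongly_measurable_in W M (\<lambda>_. w)"
  unfolding strongly_measurable_in_def
  by (rule exI[of _ "\<lambda>_ _. w"]) (use assms in auto)

lemma strongly_measurable_in_diff:
  assumes W: "subspace W" and F: "strongly_measurable_in W M F" and G: "strongly_measurable_in W M G"
  shows "strongly_measurable_in W M (\<lambda>x. F x - G x)"
proof -
  from F obtain s where s: "\<And>i. simple_function M (s i)" "\<And>i x. x \<in> space M \<Longrightarrow> s i x \<in> W"
    "\<And>x. x \<in> space M \<Longrightarrow> (\<lambda>i::nat. s i x) \<longlonglongrightarrow> F x"
    unfolding strongly_measurable_in_def by blast
  from G obtain t where t: "\<And>i. simple_function M (t i)" "\<And>i x. x \<in> space M \<Longrightarrow> t i x \<in> W"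
    "\<And>x. x \<in> space M \<Longrightarrow> (\<lambda>i::nat. t i x) \<longlonglongrightarrow> G x"
    unfolding strongly_measurable_in_def by blast
  show ?thesis
    unfolding strongly_measurable_in_def
    by (rule exI[of _ "\<lambda>i x. s i x - t i x"]) (auto intro!: tendsto_diff s t subspace_diff W)
qed

text \<open>
  Differences of Borel functions need not be Borel in a non-separable space; when one of them is simple, the difference is
  glued from countably many translates of the other.
\<close>

lemma measurable_diff_simple:
  fixes F :: "'a \<Rightarrow> 'b::real_normed_vector"
  assumes F: "F \<in> borel_measurable M" and s: "simple_function M s"
  shows "(\<lambda>x. F x - s x) \<in> borel_measurable M"
proof (rule measurable_compose_countable'[where f = "\<lambda>v x. F x - v" and g = s and I = "s ` space M"])
  show "(\<lambda>x. F x - v) \<in> borel_measurable M" for v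
    using F by (rule measurable_compose) (intro borel_measurable_continuous_onI continuous_intros)
  have "finite (s ` space M)"
    using s by (simp add: simple_function_def)
  then show "countable (s ` space M)"
    by (rule countable_finite)
  show "s \<in> measurable M (count_space (s ` space M))"
    using s by (simp add: simple_function_def measurable_count_space_eq2)
qed

lemma simple_bochner_integral_in_subspace:
  assumes "subspace W" "Bochner_Integration.simple_bochner_integrable M s" "\<And>x. x \<in> space M \<Longrightarrow> s x \<in> W"
  shows "Bochner_Integration.simple_bochner_integral M s \<in> W"
  unfolding simple_bochner_integral_def using assms
  by (auto intro!: subspace_sum subspace_scale)

lemma simple_bochner_integral_dist_le:
  fixes F :: "'a \<Rightarrow> 'b::real_normed_vector"
  assumes F: "F \<in> borel_measurable M"
    and s: "Bochner_Integration.simple_bochner_integrable M s" and t: "Bochner_Integration.simple_bochner_integrable M t"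
  shows "ennreal (dist (Bochner_Integration.simple_bochner_integral M s) (Bochner_Integration.simple_bochner_integral M t)) \<le>
    (\<integral>\<^sup>+ x. norm (F x - s x) \<partial>M) + (\<integral>\<^sup>+ x. norm (F x - t x) \<partial>M)"
proof -
  have s': "simple_function M s" and t': "simple_function M t"
    using s t by (auto elim: simple_bochner_integrable.cases)
  note [measurable] = measurable_diff_simple[OF F s'] measurable_diff_simple[OF F t']
  have "ennreal (dist (Bochner_Integration.simple_bochner_integral M s) (Bochner_Integration.simple_bochner_integral M t)) =
      norm (Bochner_Integration.simple_bochner_integral M (\<lambda>x. s x - t x))"
    using s t by (subst simple_bochner_integral_diff) (auto simp: dist_norm)
  also have "\<dots> \<le> Bochner_Integration.simple_bochner_integral M (\<lambda>x. norm (s x - t x))"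
    using simple_bochner_integrable_compose2[of "(-)" M "s" "t"] s t
    by (auto intro!: simple_bochner_integral_norm_bound)
  also have "\<dots> = (\<integral>\<^sup>+x. norm (s x - t x) \<partial>M)"
    using simple_bochner_integrable_compose2[of "\<lambda>x y. norm (x - y)" M "s" "t"] s t
    by (auto intro!: simple_bochner_integral_eq_nn_integral)
  also have "\<dots> \<le> (\<integral>\<^sup>+x. ennreal (norm (F x - s x)) + ennreal (norm (F x - t x)) \<partial>M)"
  proof (rule nn_integral_mono)
    fix x
    have "norm (s x - t x) \<le> norm (F x - s x) + norm (F x - t x)"
      by (metis dual_order.refl norm_diff_triangle_le norm_minus_commute)
    then show "ennreal (norm (s x - t x)) \<le> ennreal (norm (F x - s x)) + ennreal (norm (F x - t x))"
      by (metis ennreal_leI ennreal_plus norm_ge_zero)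
  qed
  also have "\<dots> = (\<integral>\<^sup>+x. norm (F x - s x) \<partial>M) + (\<integral>\<^sup>+x. norm (F x - t x) \<partial>M)"
    by (rule nn_integral_add) auto
  finally show ?thesis .
qed

text \<open>
  The approximations are cut off where their norm exceeds twice that of \<open>F\<close>; this keeps their values in the subspace, and
  makes \<open>3 * norm (F x)\<close> a dominating function for the errors. The integrals of the approximations are then a Cauchy
  sequence, and its limit stays in the closed set \<open>W\<close>.
\<close>

lemma has_gen_bochner_integral_exists:
  fixes F :: "'a \<Rightarrow> 'b::banach"
  assumes sm: "strongly_measurable_in W M F" and W: "subspace W" "closed W"
    and fin: "(\<integral>\<^sup>+x. norm (F x) \<partial>M) < \<infinity>"
  obtains y where "y \<in> W" "has_gen_bochner_integral M F y"
proof -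
  have F[measurable]: "F \<in> borel_measurable M"
    using sm by (rule strongly_measurable_in_imp_borel)
  from sm obtain s where s: "\<And>i. simple_function M (s i)"
    and sW: "\<And>i x. x \<in> space M \<Longrightarrow> s i x \<in> W"
    and lim: "\<And>x. x \<in> space M \<Longrightarrow> (\<lambda>i::nat. s i x) \<longlonglongrightarrow> F x"
    unfolding strongly_measurable_in_def by blast
  have [measurable]: "s i \<in> borel_measurable M" for i
    using s by (rule borel_measurable_simple_function)
  \<comment> \<open>Where \<open>F\<close> vanishes this is zero, so the cut-off does not destroy convergence there.\<close>
  define u where "u i x = (if norm (s i x) \<le> 2 * norm (F x) then s i x else 0)" for i x
  have u: "simple_function M (u i)" for i
    unfolding u_def by (rule simple_function_If) (use s in \<open>simp_all, measurable\<close>)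
  have [measurable]: "u i \<in> borel_measurable M" for i
    using u by (rule borel_measurable_simple_function)
  have uW: "u i x \<in> W" if "x \<in> space M" for i x
    using sW that W by (auto simp: u_def subspace_0)
  have ule: "norm (u i x) \<le> 2 * norm (F x)" for i x
    by (auto simp: u_def)
  have ulim: "(\<lambda>i. u i x) \<longlonglongrightarrow> F x" if x: "x \<in> space M" for x
  proof (cases "F x = 0")
    case True
    then have "u i x = 0" for i by (simp add: u_def)
    with True show ?thesis by simp
  next
    case False
    then have "norm (F x) < 2 * norm (F x)" by simp
    then have "\<forall>\<^sub>F i in sequentially. norm (s i x) < 2 * norm (F x)"
      using tendsto_norm[OF lim[OF x]] by (rule order_tendstoD(2)[rotated])
    then have "\<forall>\<^sub>F i in sequentially. s i x = u i x"
      by eventually_elim (simp add: u_def)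
    then show ?thesis
      using lim[OF x] by (rule Lim_transform_eventually[rotated])
  qed
  have usi: "Bochner_Integration.simple_bochner_integrable M (u i)" for i
  proof (rule simple_bochner_integrableI_bounded[OF u])
    have "(\<integral>\<^sup>+x. norm (u i x) \<partial>M) \<le> (\<integral>\<^sup>+x. 2 * ennreal (norm (F x)) \<partial>M)"
      using ule by (intro nn_integral_mono) (metis ennreal_leI ennreal_mult' ennreal_numeral zero_le_numeral)
    also have "\<dots> = 2 * (\<integral>\<^sup>+x. norm (F x) \<partial>M)"
      by (rule nn_integral_cmult) measurable
    also have "\<dots> < \<infinity>"
      using fin by (simp add: ennreal_mult_less_top)
    finally show "(\<integral>\<^sup>+x. norm (u i x) \<partial>M) < \<infinity>" .
  qed
  have [measurable]: "(\<lambda>x. F x - u i x) \<in> borel_measurable M" for i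
    using F u by (rule measurable_diff_simple)
  have "(\<lambda>i. \<integral>\<^sup>+x. ennreal (norm (F x - u i x)) \<partial>M) \<longlonglongrightarrow> (\<integral>\<^sup>+x. 0 \<partial>M)"
  proof (rule nn_integral_dominated_convergence[where w = "\<lambda>x. 3 * ennreal (norm (F x))"])
    show "AE x in M. ennreal (norm (F x - u i x)) \<le> 3 * ennreal (norm (F x))" for i
    proof (rule AE_I2)
      fix x
      have "norm (F x - u i x) \<le> 3 * norm (F x)"
        using norm_triangle_ineq4[of "F x" "u i x"] ule[of i x] by simp
      then show "ennreal (norm (F x - u i x)) \<le> 3 * ennreal (norm (F x))"
        by (metis ennreal_leI ennreal_mult' ennreal_numeral zero_le_numeral)
    qed
    have "(\<integral>\<^sup>+x. 3 * ennreal (norm (F x)) \<partial>M) = 3 * (\<integral>\<^sup>+x. norm (F x) \<partial>M)"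
      by (rule nn_integral_cmult) measurable
    then show "(\<integral>\<^sup>+x. 3 * ennreal (norm (F x)) \<partial>M) < \<infinity>"
      using fin by (simp add: ennreal_mult_less_top)
    show "AE x in M. (\<lambda>i. ennreal (norm (F x - u i x))) \<longlonglongrightarrow> 0"
    proof (rule AE_I2)
      fix x assume "x \<in> space M"
      then have "(\<lambda>i. norm (F x - u i x)) \<longlonglongrightarrow> norm (F x - F x)"
        by (intro tendsto_intros ulim)
      then show "(\<lambda>i. ennreal (norm (F x - u i x))) \<longlonglongrightarrow> 0"
        using tendsto_ennrealI by fastforce
    qed
  qed measurable
  then have L1: "(\<lambda>i. \<integral>\<^sup>+x. ennreal (norm (F x - u i x)) \<partial>M) \<longlonglongrightarrow> 0"
    by simp
  have "Cauchy (\<lambda>i. Bochner_Integration.simple_bochner_integral M (u i))"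
  proof (rule metric_CauchyI)
    fix e :: real assume e: "0 < e"
    then have "0 < ennreal (e / 2)" by simp
    then have "\<forall>\<^sub>F i in sequentially. (\<integral>\<^sup>+x. ennreal (norm (F x - u i x)) \<partial>M) < ennreal (e / 2)"
      using L1 by (rule order_tendstoD(2)[rotated])
    then obtain N where N: "\<And>i. i \<ge> N \<Longrightarrow> (\<integral>\<^sup>+x. ennreal (norm (F x - u i x)) \<partial>M) < ennreal (e / 2)"
      by (auto simp: eventually_sequentially)
    have "dist (Bochner_Integration.simple_bochner_integral M (u i)) (Bochner_Integration.simple_bochner_integral M (u j)) < e"
      if "i \<ge> N" "j \<ge> N" for i j
    proof -
      have "ennreal (dist (Bochner_Integration.simple_bochner_integral M (u i)) (Bochner_Integration.simple_bochner_integral M (u j)))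
         < ennreal (e / 2) + ennreal (e / 2)"
        using simple_bochner_integral_dist_le[OF F usi usi] add_strict_mono[OF N N] that
        by (meson le_less_trans)
      also have "\<dots> = ennreal e"
        using e by (simp flip: ennreal_plus)
      finally show ?thesis
        by (simp add: ennreal_less_iff)
    qed
    then show "\<exists>N. \<forall>i\<ge>N. \<forall>j\<ge>N.
        dist (Bochner_Integration.simple_bochner_integral M (u i)) (Bochner_Integration.simple_bochner_integral M (u j)) < e"
      by blast
  qed
  then obtain y where y: "(\<lambda>i. Bochner_Integration.simple_bochner_integral M (u i)) \<longlonglongrightarrow> y"
    by (meson Cauchy_convergent convergent_def)
  have "y \<in> W"
    using W(2) _ y
    by (rule closed_sequentially)
       (use simple_bochner_integral_in_subspace[OF W(1) usi] uW in auto)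
  moreover have "has_gen_bochner_integral M F y"
    unfolding has_gen_bochner_integral_def using F usi L1 y by blast
  ultimately show thesis by (rule that)
qed

text \<open>
  The image under \<open>T\<close> of an approximating sequence is an approximating sequence.
\<close>

lemma has_gen_bochner_integral_linear:
  assumes T: "bounded_linear T" and F: "has_gen_bochner_integral M F y"
  shows "has_gen_bochner_integral M (\<lambda>x. T (F x)) (T y)"
proof -
  interpret T: bounded_linear T by fact
  from F obtain s where F_meas: "F \<in> borel_measurable M"
    and s: "\<And>i. Bochner_Integration.simple_bochner_integrable M (s i)"
    and L1: "(\<lambda>i. \<integral>\<^sup>+x. norm (F x - s i x) \<partial>M) \<longlonglongrightarrow> 0"
    and y: "(\<lambda>i::nat. Bochner_Integration.simple_bochner_integral M (s i)) \<longlonglongrightarrow> y"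
    unfolding has_gen_bochner_integral_def by blast
  have s': "simple_function M (s i)" for i
    using s by (auto elim: simple_bochner_integrable.cases)
  note [measurable] = measurable_diff_simple[OF F_meas s']
  obtain K where K: "K > 0" "\<And>v. norm (T v) \<le> norm v * K"
    using T.pos_bounded by blast
  have "(\<lambda>x. T (F x)) \<in> borel_measurable M"
    by (rule measurable_compose[OF F_meas borel_measurable_continuous_onI[OF T.continuous_on[OF continuous_on_id]]])
  moreover have "Bochner_Integration.simple_bochner_integrable M (\<lambda>x. T (s i x))" for i
    using simple_bochner_integrable_compose2[of "\<lambda>v _. T v" M "s i" "s i"] s by (simp add: T.zero)
  moreover have "(\<lambda>i. \<integral>\<^sup>+x. norm (T (F x) - T (s i x)) \<partial>M) \<longlonglongrightarrow> 0"
  proof (rule tendsto_sandwich[OF _ _ tendsto_const])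
    show "\<forall>\<^sub>F i in sequentially. (\<integral>\<^sup>+x. norm (T (F x) - T (s i x)) \<partial>M) \<le>
        ennreal K * (\<integral>\<^sup>+x. norm (F x - s i x) \<partial>M)"
    proof (rule always_eventually, rule allI)
      fix i
      have "(\<integral>\<^sup>+x. norm (T (F x) - T (s i x)) \<partial>M) \<le> (\<integral>\<^sup>+x. ennreal K * norm (F x - s i x) \<partial>M)"
        using K(1) K(2)[of "F _ - s i _"]
        by (intro nn_integral_mono) (simp add: T.diff mult.commute flip: ennreal_mult)
      also have "\<dots> = ennreal K * (\<integral>\<^sup>+x. norm (F x - s i x) \<partial>M)"
        by (rule nn_integral_cmult) measurable
      finally show "(\<integral>\<^sup>+x. norm (T (F x) - T (s i x)) \<partial>M) \<le>
        ennreal K * (\<integral>\<^sup>+x. norm (F x - s i x) \<partial>M)" .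
    qed
    show "(\<lambda>i. ennreal K * (\<integral>\<^sup>+x. norm (F x - s i x) \<partial>M)) \<longlonglongrightarrow> 0"
      using ennreal_tendsto_cmult[OF _ L1, of "ennreal K"] by simp
  qed auto
  moreover have "(\<lambda>i. Bochner_Integration.simple_bochner_integral M (\<lambda>x. T (s i x))) \<longlonglongrightarrow> T y"
    using T.tendsto[OF y] s by (simp add: simple_bochner_integral_linear T.linear_axioms)
  ultimately show ?thesis
    unfolding has_gen_bochner_integral_def
    by (intro conjI exI[of _ "\<lambda>i x. T (s i x)"] allI)
qed

lemma has_gen_bochner_integral_imp_bochner:
  fixes y :: "'b::{real_normed_vector, second_countable_topology}"
  assumes "has_gen_bochner_integral M F y"
  shows "has_bochner_integral M F y"
  using assms unfolding has_gen_bochner_integral_def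
  by (auto intro: has_bochner_integral.intros)

lemma bounded_linear_apply_bborel: "bounded_linear (\<lambda>f. apply_bborel f x)"
  by (rule bounded_linear_intro[where K = 1]) (simp_all add: abs_le_norm_bborel)

text \<open>
  Evaluation at a point is a bounded functional, so vector-valued integrals can be computed pointwise with the Lebesgue
  integral. Evaluations separate points, which also makes the integral unique.
\<close>

lemma has_gen_bochner_integral_apply:
  assumes "has_gen_bochner_integral M F y"
  shows "has_bochner_integral M (\<lambda>s. apply_bborel (F s) x) (apply_bborel y x)"
  using has_gen_bochner_integral_linear[OF bounded_linear_apply_bborel assms]
  by (rule has_gen_bochner_integral_imp_bochner)

lemma gen_bochner_integral_eq:
  fixes y :: "'b::topological_space bborel"
  assumes y: "has_gen_bochner_integral M F y"
  shows "gen_bochner_integral M F = y"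
proof -
  have "z = y" if "has_gen_bochner_integral M F z" for z
  proof (rule bborel_eqI)
    show "apply_bborel z x = apply_bborel y x" for x
      by (rule has_bochner_integral_eq[OF has_gen_bochner_integral_apply[OF that, of x]
            has_gen_bochner_integral_apply[OF y, of x]])
  qed
  then have "(THE z. has_gen_bochner_integral M F z) = y"
    by (rule the_equality[where P = "has_gen_bochner_integral M F", OF y])
  moreover have "\<exists>z. has_gen_bochner_integral M F z"
    using y by (rule exI)
  ultimately show ?thesis
    unfolding gen_bochner_integral_def by (simp only: if_True)
qed

text \<open>
  Only the pointwise integrals enter the hypothesis, so the estimate also applies after a change of variables that has been
  carried out pointwise.
\<close>

lemma norm_bborel_le_nn_integral:
  fixes y :: "'b::topological_space bborel"
  assumes y: "\<And>x. has_bochner_integral M (\<lambda>s. apply_bborel (F s) x) (apply_bborel y x)"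
  shows "ennreal (norm y) \<le> (\<integral>\<^sup>+s. norm (F s) \<partial>M)"
proof (cases "(\<integral>\<^sup>+s. norm (F s) \<partial>M) = \<infinity>")
  case False
  have "\<bar>apply_bborel y x\<bar> \<le> enn2real (\<integral>\<^sup>+s. norm (F s) \<partial>M)" for x
  proof -
    have "integral\<^sup>L M (\<lambda>s. apply_bborel (F s) x) = apply_bborel y x"
         "integrable M (\<lambda>s. apply_bborel (F s) x)"
      using y[of x] by (simp_all add: has_bochner_integral_iff)
    then have "ennreal (norm (apply_bborel y x)) \<le> (\<integral>\<^sup>+s. norm (apply_bborel (F s) x) \<partial>M)"
      using integral_norm_bound_ennreal by metis
    also have "\<dots> \<le> (\<integral>\<^sup>+s. norm (F s) \<partial>M)"
      by (intro nn_integral_mono ennreal_leI) (simp add: abs_le_norm_bborel)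
    also have "\<dots> = ennreal (enn2real (\<integral>\<^sup>+s. norm (F s) \<partial>M))"
      using False by (simp add: top.not_eq_extremum)
    finally show ?thesis by simp
  qed
  then have "norm y \<le> enn2real (\<integral>\<^sup>+s. norm (F s) \<partial>M)"
    by (rule norm_bborel_le)
  then have "ennreal (norm y) \<le> ennreal (enn2real (\<integral>\<^sup>+s. norm (F s) \<partial>M))"
    by (rule ennreal_leI)
  with False show ?thesis by (simp add: top.not_eq_extremum)
qed simp

lemma has_gen_bochner_integral_gen_bochner_integral:
  fixes F :: "'a \<Rightarrow> 'b::topological_space bborel"
  assumes "strongly_measurable_in W M F" "subspace W" "closed W" "(\<integral>\<^sup>+x. norm (F x) \<partial>M) < \<infinity>"
  shows "has_gen_bochner_integral M F (gen_bochner_integral M F)" "gen_bochner_integral M F \<in> W"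
proof -
  obtain y where "y \<in> W" "has_gen_bochner_integral M F y"
    using has_gen_bochner_integral_exists[OF assms] .
  then show "has_gen_bochner_integral M F (gen_bochner_integral M F)" "gen_bochner_integral M F \<in> W"
    by (simp_all add: gen_bochner_integral_eq)
qed

text \<open>
  The time argument \<open>a x\<close> is rounded up to the next multiple of \<open>1 / Suc i\<close>, which is a simple function that stays inside
  the half-open interval on which the family is continuous; rounding down could reach the singular time zero.
\<close>

lemma strongly_measurable_in_family:
  fixes T :: "real \<Rightarrow> 'c::real_normed_vector \<Rightarrow> 'b::real_normed_vector"
  assumes A: "A \<in> sets M" and a: "a \<in> borel_measurable M" and a01: "\<And>x. x \<in> A \<Longrightarrow> a x \<in> {0<..1}"
    and g: "strongly_measurable_in V M g" and gV: "\<And>x. x \<in> A \<Longrightarrow> g x \<in> V"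
    and T: "continuous_on ({0<..1} \<times> V) (\<lambda>(u, v). T u v)"
    and TW: "\<And>u v. u \<in> {0<..1} \<Longrightarrow> v \<in> V \<Longrightarrow> T u v \<in> W" and W0: "0 \<in> W"
  shows "strongly_measurable_in W M (\<lambda>x. if x \<in> A then T (a x) (g x) else 0)"
proof -
  from g obtain s where s: "\<And>i. simple_function M (s i)"
    and sV: "\<And>i x. x \<in> space M \<Longrightarrow> s i x \<in> V"
    and lim: "\<And>x. x \<in> space M \<Longrightarrow> (\<lambda>i::nat. s i x) \<longlonglongrightarrow> g x"
    unfolding strongly_measurable_in_def by blast
  note [measurable] = A a
  define b where "b i x = (if x \<in> A then real_of_int \<lceil>real (Suc i) * a x\<rceil> / real (Suc i) else 1)" for i x
  have b_ge: "b i x \<ge> a x" "b i x \<le> a x + 1 / real (Suc i)" if "x \<in> A" for i x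
  proof -
    define n where "n = real (Suc i)"
    have n: "n > 0" by (simp add: n_def)
    have "n * a x \<le> real_of_int \<lceil>n * a x\<rceil>" "real_of_int \<lceil>n * a x\<rceil> \<le> n * a x + 1"
      by linarith+
    then have "a x \<le> real_of_int \<lceil>n * a x\<rceil> / n" "real_of_int \<lceil>n * a x\<rceil> / n \<le> a x + 1 / n"
      using n by (simp_all add: field_simps)
    then show "b i x \<ge> a x" "b i x \<le> a x + 1 / real (Suc i)"
      unfolding b_def n_def using that by simp_all
  qed
  have ceil: "\<lceil>real (Suc i) * a x\<rceil> \<in> {0..int (Suc i)}" if "x \<in> A" for i x
  proof -
    have "0 \<le> real (Suc i) * a x" "real (Suc i) * a x \<le> real (Suc i)"
      using a01[OF that] by (simp_all add: mult_left_le)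
    then have "0 \<le> \<lceil>real (Suc i) * a x\<rceil>" "\<lceil>real (Suc i) * a x\<rceil> \<le> int (Suc i)"
      unfolding ceiling_le_iff of_int_of_nat_eq by linarith+
    then show ?thesis
      unfolding atLeastAtMost_iff by (rule conjI)
  qed
  have b01: "b i x \<in> {0<..1}" for i x
  proof (cases "x \<in> A")
    case True
    have "real_of_int \<lceil>real (Suc i) * a x\<rceil> \<le> real (Suc i)"
      using ceil[OF True, of i] unfolding atLeastAtMost_iff by linarith
    then show ?thesis
      using b_ge(1)[OF True, of i] a01[OF True] True by (simp add: b_def)
  qed (simp add: b_def)
  have b: "simple_function M (b i)" for i
  proof (rule simple_function_borel_measurable)
    show "b i \<in> borel_measurable M"
      unfolding b_def by measurable
    have "b i ` space M \<subseteq> insert 1 ((\<lambda>k. real_of_int k / real (Suc i)) ` {0..int (Suc i)})"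
      using ceil by (auto simp: b_def)
    then show "finite (b i ` space M)"
      by (rule finite_subset) auto
  qed
  have blim: "(\<lambda>i. b i x) \<longlonglongrightarrow> a x" if "x \<in> A" for x
  proof (rule tendsto_sandwich[OF _ _ tendsto_const])
    show "(\<lambda>i. a x + 1 / real (Suc i)) \<longlonglongrightarrow> a x"
      using tendsto_add[OF tendsto_const[of "a x"] LIMSEQ_inverse_real_of_nat]
      unfolding inverse_eq_divide add_0_right .
  qed (use b_ge[OF that] in auto)
  show ?thesis
    unfolding strongly_measurable_in_def
  proof (intro exI conjI allI ballI)
    fix i
    show "simple_function M (\<lambda>x. if x \<in> A then T (b i x) (s i x) else 0)"
    proof (rule simple_function_If)
      show "simple_function M (\<lambda>x. T (b i x) (s i x))"
        using b s by (rule simple_function_compose2)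
      show "{x \<in> space M. x \<in> A} \<in> sets M" by measurable
    qed simp
    show "(if x \<in> A then T (b i x) (s i x) else 0) \<in> W" if "x \<in> space M" for x
      using W0 b01 TW sV[OF that] by auto
  next
    fix x assume x: "x \<in> space M"
    show "(\<lambda>i. if x \<in> A then T (b i x) (s i x) else 0) \<longlonglongrightarrow> (if x \<in> A then T (a x) (g x) else 0)"
    proof (cases "x \<in> A")
      case True
      have "(\<lambda>i. (\<lambda>(u, v). T u v) (b i x, s i x)) \<longlonglongrightarrow> (\<lambda>(u, v). T u v) (a x, g x)"
        by (rule continuous_on_tendsto_compose[OF T])
          (use True x a01 b01 sV gV lim blim in \<open>auto intro!: tendsto_Pair\<close>)
      with True show ?thesis by simp
    qed simp
  qed
qed

lemma strongly_measurable_in_continuous: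
  fixes F :: "real \<Rightarrow> 'b::real_normed_vector"
  assumes F: "continuous_on {0<..1} F" and FW: "\<And>u. u \<in> {0<..1} \<Longrightarrow> F u \<in> W" and W0: "0 \<in> W"
    and A: "A \<in> sets M" and a: "a \<in> borel_measurable M" and a01: "\<And>x. x \<in> A \<Longrightarrow> a x \<in> {0<..1}"
  shows "strongly_measurable_in W M (\<lambda>x. if x \<in> A then F (a x) else 0)"
  by (rule strongly_measurable_in_family[OF A a a01, where V = UNIV and g = "\<lambda>_. 0::real" and T = "\<lambda>u _. F u"])
    (use FW W0 in \<open>auto intro!: strongly_measurable_in_const simp: case_prod_unfold intro: continuous_on_compose2[OF F continuous_on_fst[OF continuous_on_id]]\<close>)


lemma subspace_C0: "subspace (C0 :: 'a::euclidean_space bborel set)"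
  unfolding subspace_def C0_def
  by (auto intro!: continuous_intros tendsto_add_zero tendsto_mult_right_zero)

lemma closed_C0: "closed (C0 :: 'a::euclidean_space bborel set)"
  unfolding closed_sequential_limits
proof (intro allI impI, elim conjE)
  fix X :: "nat \<Rightarrow> 'a bborel" and f
  assume X: "\<forall>n. X n \<in> C0" and lim: "X \<longlonglongrightarrow> f"
  have close: "\<exists>N. \<forall>n\<ge>N. \<forall>x. \<bar>X n x - f x\<bar> < e" if e: "e > 0" for e
  proof -
    obtain N where "\<forall>n\<ge>N. norm (X n - f) < e"
      using metric_LIMSEQ_D[OF lim e] unfolding dist_norm by blast
    then show ?thesis
      using abs_le_norm_bborel[of "X _ - f"] by (metis le_less_trans minus_bborel.rep_eq)
  qed
  have "continuous_on UNIV (apply_bborel f)"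
  proof (rule uniform_limit_theorem[where F = sequentially and f = "\<lambda>n. apply_bborel (X n)"])
    show "\<forall>\<^sub>F n in sequentially. continuous_on UNIV (apply_bborel (X n))"
      using X by (simp add: C0_def)
    show "uniform_limit UNIV (\<lambda>n. apply_bborel (X n)) (apply_bborel f) sequentially"
      using close by (auto intro!: uniform_limitI simp: eventually_sequentially dist_real_def)
  qed simp
  moreover have "(apply_bborel f \<longlongrightarrow> 0) at_infinity"
  proof (rule tendstoI)
    fix e :: real assume "e > 0"
    then obtain N where N: "\<And>x. \<bar>X N x - f x\<bar> < e / 2"
      using close[of "e / 2"] by auto
    have "(apply_bborel (X N) \<longlongrightarrow> 0) at_infinity"
      using X by (simp add: C0_def)
    then have "\<forall>\<^sub>F x in at_infinity. dist (X N x) 0 < e / 2"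
      using \<open>e > 0\<close> by (intro tendstoD) auto
    then show "\<forall>\<^sub>F x in at_infinity. dist (f x) 0 < e"
    proof eventually_elim
      case (elim x)
      with N[of x] show ?case
        unfolding dist_real_def by linarith
    qed
  qed
  ultimately show "f \<in> C0" by (simp add: C0_def)
qed

section \<open>Convolution of weakly singular kernels\<close>

lemma nn_integral_powr:
  fixes \<eta> t :: real
  assumes "0 < \<eta>" "0 \<le> t"
  shows "(\<integral>\<^sup>+s. ennreal (indicator {0<..<t} s * s powr (\<eta> - 1)) \<partial>lborel) = ennreal (t powr \<eta> / \<eta>)"
proof (rule nn_integral_has_integral_lborel)
  have "((\<lambda>s. if s \<in> {0..t} then s powr (\<eta> - 1) else 0) has_integral (t powr \<eta> / \<eta>)) UNIV"
    unfolding has_integral_restrict_UNIV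
    using has_integral_powr_from_0[of "\<eta> - 1" t] assms by simp
  then show "((\<lambda>s. indicator {0<..<t} s * s powr (\<eta> - 1)) has_integral (t powr \<eta> / \<eta>)) UNIV"
    by (rule has_integral_spike[of "{t}", rotated 2]) (auto simp: indicator_def)
qed auto

text \<open>
  One of \<open>s\<close> and \<open>t - s\<close> is at least \<open>t / 2\<close>, so one of the two singular factors is bounded; in either case the
  exponential weight can be attached to the other factor.
\<close>

lemma powr_product_le:
  fixes \<eta> \<kappa> s t :: real
  assumes \<eta>: "\<eta> < 1" and \<kappa>: "0 \<le> \<kappa>" and s: "0 < s" "s < t"
  shows "exp (- \<kappa> * (t - s)) * (t - s) powr (\<eta> - 1) * s powr (\<eta> - 1) \<le>
    (t / 2) powr (\<eta> - 1) * (exp (- \<kappa> * (t - s)) * (t - s) powr (\<eta> - 1) + exp (- \<kappa> * s) * s powr (\<eta> - 1))"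
proof (cases "s \<le> t / 2")
  case True
  then have "(t - s) powr (\<eta> - 1) \<le> (t / 2) powr (\<eta> - 1)"
    using s \<eta> by (intro powr_mono2') auto
  moreover have "exp (- \<kappa> * (t - s)) \<le> exp (- \<kappa> * s)"
    using True \<kappa> by (simp add: mult_left_mono)
  ultimately have "exp (- \<kappa> * (t - s)) * (t - s) powr (\<eta> - 1) * s powr (\<eta> - 1) \<le>
      exp (- \<kappa> * s) * (t / 2) powr (\<eta> - 1) * s powr (\<eta> - 1)"
    by (intro mult_mono) auto
  also have "\<dots> \<le> (t / 2) powr (\<eta> - 1) * (exp (- \<kappa> * (t - s)) * (t - s) powr (\<eta> - 1) + exp (- \<kappa> * s) * s powr (\<eta> - 1))"
    by (simp add: algebra_simps)
  finally show ?thesis .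
next
  case False
  then have "s powr (\<eta> - 1) \<le> (t / 2) powr (\<eta> - 1)"
    using s \<eta> by (intro powr_mono2') auto
  then have "exp (- \<kappa> * (t - s)) * (t - s) powr (\<eta> - 1) * s powr (\<eta> - 1) \<le>
      exp (- \<kappa> * (t - s)) * (t - s) powr (\<eta> - 1) * (t / 2) powr (\<eta> - 1)"
    by (intro mult_left_mono) auto
  also have "\<dots> \<le> (t / 2) powr (\<eta> - 1) * (exp (- \<kappa> * (t - s)) * (t - s) powr (\<eta> - 1) + exp (- \<kappa> * s) * s powr (\<eta> - 1))"
    by (simp add: algebra_simps)
  finally show ?thesis .
qed

lemma exp_weight_tendsto_0:
  fixes \<eta> :: real
  assumes "0 < \<eta>"
  shows "(\<lambda>n. \<integral>\<^sup>+u. ennreal (indicator {0<..<1} u * (exp (- real n * u) * u powr (\<eta> - 1))) \<partial>lborel)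
    \<longlonglongrightarrow> 0"
proof -
  have "(\<lambda>n. \<integral>\<^sup>+u. ennreal (indicator {0<..<1} u * (exp (- real n * u) * u powr (\<eta> - 1))) \<partial>lborel)
    \<longlonglongrightarrow> (\<integral>\<^sup>+u. 0 \<partial>(lborel::real measure))"
  proof (rule nn_integral_dominated_convergence[where
        w = "\<lambda>u. ennreal (indicator {0<..<1} u * u powr (\<eta> - 1))"])
    show "AE u in lborel. ennreal (indicator {0<..<1} u * (exp (- real n * u) * u powr (\<eta> - 1)))
        \<le> ennreal (indicator {0<..<1} u * u powr (\<eta> - 1))" for n
    proof (intro AE_I2 ennreal_leI)
      fix u :: real
      show "indicator {0<..<1} u * (exp (- real n * u) * u powr (\<eta> - 1)) \<le> indicator {0<..<1} u * u powr (\<eta> - 1)"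
        by (cases "0 < u") (auto simp: indicator_def intro!: mult_left_le_one_le)
    qed
    show "(\<integral>\<^sup>+u. ennreal (indicator {0<..<1} u * u powr (\<eta> - 1)) \<partial>lborel) < \<infinity>"
      using nn_integral_powr[OF assms, of 1] by simp
    show "AE u in lborel. (\<lambda>n. ennreal (indicator {0<..<1} u * (exp (- real n * u) * u powr (\<eta> - 1)))) \<longlonglongrightarrow> 0"
    proof (rule AE_I2)
      fix u :: real
      show "(\<lambda>n. ennreal (indicator {0<..<1} u * (exp (- real n * u) * u powr (\<eta> - 1)))) \<longlonglongrightarrow> 0"
      proof (cases "0 < u \<and> u < 1")
        case True
        then have "exp (- u) < 1" by simp
        then have "(\<lambda>n. exp (- u) ^ n) \<longlonglongrightarrow> 0"
          by (intro LIMSEQ_power_zero) simp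
        then have "(\<lambda>n. exp (- real n * u)) \<longlonglongrightarrow> 0"
          by (simp add: exp_of_nat_mult[symmetric])
        then have "(\<lambda>n. indicator {0<..<1} u * (exp (- real n * u) * u powr (\<eta> - 1))) \<longlonglongrightarrow>
            indicator {0<..<1} u * (0 * u powr (\<eta> - 1))"
          by (intro tendsto_intros)
        then show ?thesis
          using tendsto_ennrealI by fastforce
      qed (auto simp: indicator_def)
    qed
  qed auto
  then show ?thesis by simp
qed

text \<open>
  Convolution with \<open>C * u powr (\<eta> - 1)\<close> halves the weight \<open>exp (\<kappa> * t) * t powr (\<eta> - 1)\<close> for large \<open>\<kappa>\<close>: by
  \<open>powr_product_le\<close> the ratio is bounded by a multiple of the integral of \<open>exp (- \<kappa> * u) * u powr (\<eta> - 1)\<close> over the unit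
  interval, which tends to zero by dominated convergence. Iterating this estimate replaces the usual Beta and Gamma function
  bounds for the terms of the perturbation series.
\<close>

lemma singular_convolution_contraction:
  fixes \<eta> C :: real
  assumes \<eta>: "0 < \<eta>" "\<eta> < 1" and C: "0 \<le> C"
  obtains \<kappa> where "0 \<le> \<kappa>"
    "\<And>t. t \<in> {0<..1} \<Longrightarrow>
      (\<integral>\<^sup>+s. ennreal (indicator {0<..<t} s * (C * (t - s) powr (\<eta> - 1) * (exp (\<kappa> * s) * s powr (\<eta> - 1)))) \<partial>lborel)
      \<le> ennreal (1 / 2 * (exp (\<kappa> * t) * t powr (\<eta> - 1)))"
proof -
  define h where "h \<kappa> u = indicator {0<..<1} u * (exp (- \<kappa> * u) * u powr (\<eta> - 1))" for \<kappa> u :: real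
  define c where "c = C * (1 / 2) powr (\<eta> - 1)"
  have c: "c \<ge> 0" using C by (simp add: c_def)
  have h_nonneg: "0 \<le> h \<kappa> u" for \<kappa> u by (simp add: h_def)
  have [measurable]: "h \<kappa> \<in> borel_measurable borel" for \<kappa>
    unfolding h_def by measurable
  have "(\<lambda>n. \<integral>\<^sup>+u. ennreal (h (real n) u) \<partial>lborel) \<longlonglongrightarrow> 0"
    using exp_weight_tendsto_0[OF \<eta>(1)] by (simp add: h_def)
  then have "(\<lambda>n. ennreal (2 * c) * (\<integral>\<^sup>+u. ennreal (h (real n) u) \<partial>lborel)) \<longlonglongrightarrow> ennreal (2 * c) * 0"
    by (intro ennreal_tendsto_cmult) auto
  then have "\<forall>\<^sub>F n in sequentially. ennreal (2 * c) * (\<integral>\<^sup>+u. ennreal (h (real n) u) \<partial>lborel) < ennreal (1 / 2)"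
    by (rule order_tendstoD(2)) (simp del: ennreal_half)
  then obtain n where n: "ennreal (2 * c) * (\<integral>\<^sup>+u. ennreal (h (real n) u) \<partial>lborel) < ennreal (1 / 2)"
    by (auto simp: eventually_sequentially)
  define \<kappa> where "\<kappa> = real n"
  have \<kappa>: "\<kappa> \<ge> 0" by (simp add: \<kappa>_def)
  show thesis
  proof (rule that[OF \<kappa>])
    fix t :: real assume t: "t \<in> {0<..1}"
    define a where "a = c * exp (\<kappa> * t) * t powr (\<eta> - 1)"
    have a: "a \<ge> 0" using c by (simp add: a_def)
    have "indicator {0<..<t} s * (C * (t - s) powr (\<eta> - 1) * (exp (\<kappa> * s) * s powr (\<eta> - 1)))
        \<le> a * (h \<kappa> (t - s) + h \<kappa> s)" for s
    proof (cases "0 < s \<and> s < t")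
      case True
      have "C * (t - s) powr (\<eta> - 1) * (exp (\<kappa> * s) * s powr (\<eta> - 1)) =
         C * exp (\<kappa> * t) * (exp (- \<kappa> * (t - s)) * (t - s) powr (\<eta> - 1) * s powr (\<eta> - 1))"
        by (simp add: exp_add[symmetric] algebra_simps flip: exp_diff)
      also have "\<dots> \<le> C * exp (\<kappa> * t) * ((t / 2) powr (\<eta> - 1) *
          (exp (- \<kappa> * (t - s)) * (t - s) powr (\<eta> - 1) + exp (- \<kappa> * s) * s powr (\<eta> - 1)))"
        using True C \<kappa> \<eta> by (intro mult_left_mono powr_product_le) auto
      also have "\<dots> = a * (h \<kappa> (t - s) + h \<kappa> s)"
        using True t powr_mult[of "1/2" t "\<eta> - 1"] by (simp add: a_def c_def h_def)
      finally show ?thesis using True by simp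
    qed (use a h_nonneg in \<open>auto simp: indicator_def\<close>)
    then have "(\<integral>\<^sup>+s. ennreal (indicator {0<..<t} s * (C * (t - s) powr (\<eta> - 1) * (exp (\<kappa> * s) * s powr (\<eta> - 1)))) \<partial>lborel)
      \<le> (\<integral>\<^sup>+s. ennreal a * (ennreal (h \<kappa> (t - s)) + ennreal (h \<kappa> s)) \<partial>lborel)"
      using a h_nonneg
      by (intro nn_integral_mono) (simp add: ennreal_leI flip: ennreal_plus ennreal_mult)
    also have "\<dots> = ennreal a * ((\<integral>\<^sup>+s. ennreal (h \<kappa> (t - s)) \<partial>lborel) + (\<integral>\<^sup>+s. ennreal (h \<kappa> s) \<partial>lborel))"
      by (subst nn_integral_cmult, measurable, subst nn_integral_add, measurable)
    also have "(\<integral>\<^sup>+s. ennreal (h \<kappa> (t - s)) \<partial>lborel) = (\<integral>\<^sup>+s. ennreal (h \<kappa> s) \<partial>lborel)"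
      using nn_integral_real_affine[of "\<lambda>s. ennreal (h \<kappa> s)" "-1" t] by simp
    also have "ennreal a * ((\<integral>\<^sup>+s. ennreal (h \<kappa> s) \<partial>lborel) + (\<integral>\<^sup>+s. ennreal (h \<kappa> s) \<partial>lborel)) =
        ennreal (exp (\<kappa> * t) * t powr (\<eta> - 1)) * (ennreal (2 * c) * (\<integral>\<^sup>+u. ennreal (h \<kappa> u) \<partial>lborel))"
      using c by (simp add: a_def ennreal_mult mult_2[symmetric] ac_simps)
    also have "\<dots> \<le> ennreal (exp (\<kappa> * t) * t powr (\<eta> - 1)) * ennreal (1 / 2)"
      using n by (intro mult_left_mono) (auto simp: \<kappa>_def)
    also have "\<dots> = ennreal (1 / 2 * (exp (\<kappa> * t) * t powr (\<eta> - 1)))"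
      by (simp add: mult.commute del: ennreal_half flip: ennreal_mult)
    finally show "(\<integral>\<^sup>+s. ennreal (indicator {0<..<t} s * (C * (t - s) powr (\<eta> - 1) * (exp (\<kappa> * s) * s powr (\<eta> - 1)))) \<partial>lborel)
      \<le> ennreal (1 / 2 * (exp (\<kappa> * t) * t powr (\<eta> - 1)))" .
  qed
qed

text \<open>
  The unweighted form of \<open>singular_convolution_contraction\<close>, obtained from \<open>1 \<le> exp (\<kappa> * s) \<le> exp \<kappa>\<close>.
\<close>

lemma singular_convolution_bound:
  fixes \<eta> :: real
  assumes \<eta>: "0 < \<eta>" "\<eta> < 1"
  obtains B where "0 \<le> B"
    "\<And>t. t \<in> {0<..1} \<Longrightarrow>
      (\<integral>\<^sup>+s. ennreal (indicator {0<..<t} s * ((t - s) powr (\<eta> - 1) * s powr (\<eta> - 1))) \<partial>lborel)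
      \<le> ennreal (B * t powr (\<eta> - 1))"
proof -
  obtain \<kappa> where \<kappa>: "0 \<le> \<kappa>"
    "\<And>t. t \<in> {0<..1} \<Longrightarrow>
      (\<integral>\<^sup>+s. ennreal (indicator {0<..<t} s * (1 * (t - s) powr (\<eta> - 1) * (exp (\<kappa> * s) * s powr (\<eta> - 1)))) \<partial>lborel)
      \<le> ennreal (1 / 2 * (exp (\<kappa> * t) * t powr (\<eta> - 1)))"
    using singular_convolution_contraction[OF \<eta>, of 1] by auto
  show thesis
  proof (rule that[of "exp \<kappa> / 2"])
    fix t :: real assume t: "t \<in> {0<..1}"
    have "(\<integral>\<^sup>+s. ennreal (indicator {0<..<t} s * ((t - s) powr (\<eta> - 1) * s powr (\<eta> - 1))) \<partial>lborel) \<le>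
      (\<integral>\<^sup>+s. ennreal (indicator {0<..<t} s * (1 * (t - s) powr (\<eta> - 1) * (exp (\<kappa> * s) * s powr (\<eta> - 1)))) \<partial>lborel)"
    proof (intro nn_integral_mono ennreal_leI)
      fix s :: real
      have "s powr (\<eta> - 1) \<le> exp (\<kappa> * s) * s powr (\<eta> - 1)" if "s > 0"
        using that \<kappa>(1) by (simp add: mult_le_cancel_right1)
      then show "indicator {0<..<t} s * ((t - s) powr (\<eta> - 1) * s powr (\<eta> - 1)) \<le>
          indicator {0<..<t} s * (1 * (t - s) powr (\<eta> - 1) * (exp (\<kappa> * s) * s powr (\<eta> - 1)))"
        by (auto simp: indicator_def intro!: mult_left_mono)
    qed
    also have "\<dots> \<le> ennreal (1 / 2 * (exp (\<kappa> * t) * t powr (\<eta> - 1)))"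
      using t by (rule \<kappa>(2))
    also have "\<dots> \<le> ennreal (exp \<kappa> / 2 * t powr (\<eta> - 1))"
      using t \<kappa>(1) by (intro ennreal_leI) (simp add: mult_left_le)
    finally show "(\<integral>\<^sup>+s. ennreal (indicator {0<..<t} s * ((t - s) powr (\<eta> - 1) * s powr (\<eta> - 1))) \<partial>lborel)
      \<le> ennreal (exp \<kappa> / 2 * t powr (\<eta> - 1))" .
  qed simp
qed

section \<open>Time convolution with a weakly singular operator family\<close>

text \<open>
  The integral terms of $P_t$, $P_{t,\varepsilon}$, of the evolution equation and of the recursion for the perturbation
  series all have this shape.
\<close>

definition conv :: "(real \<Rightarrow> 'b \<Rightarrow> 'b) \<Rightarrow> (real \<Rightarrow> 'b) \<Rightarrow> real \<Rightarrow> real \<Rightarrow> 'b::real_normed_vector" where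
  "conv T G t \<epsilon> = set_gen_bochner_integral lborel {0<..<t} (\<lambda>s. T (t - s + \<epsilon>) (G s))"

lemma gen_bochner_integral_zero: "gen_bochner_integral M (\<lambda>_. 0 :: 'a::euclidean_space bborel) = 0"
proof -
  have "has_gen_bochner_integral M (\<lambda>_. 0) (gen_bochner_integral M (\<lambda>_. 0 :: 'a bborel))"
    by (rule has_gen_bochner_integral_gen_bochner_integral(1)[OF _ subspace_C0 closed_C0])
      (auto intro: strongly_measurable_in_const subspace_0[OF subspace_C0])
  from norm_bborel_le_nn_integral[OF has_gen_bochner_integral_apply[OF this]] show ?thesis
    by simp
qed

lemma conv_0_left: "conv T G 0 \<epsilon> = (0 :: 'a::euclidean_space bborel)"
  by (simp add: conv_def set_gen_bochner_integral_def gen_bochner_integral_zero)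

text \<open>
  A locally uniform operator bound turns strong continuity into joint continuity, by splitting \<open>T u v - T u' v'\<close> into
  \<open>T u (v - v')\<close> and \<open>T u v' - T u' v'\<close>.
\<close>

lemma strongly_continuous_imp_joint_continuous:
  fixes T :: "'c::metric_space \<Rightarrow> 'b::real_normed_vector \<Rightarrow> 'b"
  assumes linear: "\<And>u. u \<in> U \<Longrightarrow> linear (T u)"
    and bound: "\<And>u v. u \<in> U \<Longrightarrow> norm (T u v) \<le> c u * norm v"
    and c: "continuous_on U c"
    and T: "\<And>v. v \<in> V \<Longrightarrow> continuous_on U (\<lambda>u. T u v)"
  shows "continuous_on (U \<times> V) (\<lambda>(u, v). T u v)"
  unfolding continuous_on_def
proof (rule ballI)
  fix p assume p: "p \<in> U \<times> V"
  obtain u v where uv: "p = (u, v)" "u \<in> U" "v \<in> V" using p by auto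
  let ?F = "at p within U \<times> V"
  have fst: "(fst \<longlongrightarrow> u) ?F" and snd: "(snd \<longlongrightarrow> v) ?F"
    using tendsto_fst[OF tendsto_ident_at, of p] tendsto_snd[OF tendsto_ident_at, of p] uv by auto
  have ev: "\<forall>\<^sub>F q in ?F. fst q \<in> U"
    unfolding eventually_at_filter by (rule always_eventually) auto
  have "continuous_on (U \<times> V) (\<lambda>q. T (fst q) v)" "continuous_on (U \<times> V) (\<lambda>q. c (fst q))"
    by (rule continuous_on_compose2[OF T[OF uv(3)] continuous_on_fst[OF continuous_on_id]]
          continuous_on_compose2[OF c continuous_on_fst[OF continuous_on_id]]; auto)+
  then have Tv: "((\<lambda>q. T (fst q) v) \<longlongrightarrow> T u v) ?F" and cu: "((\<lambda>q. c (fst q)) \<longlongrightarrow> c u) ?F"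
    using p uv unfolding continuous_on_def by auto
  have "((\<lambda>q. c (fst q) * norm (snd q - v) + norm (T (fst q) v - T u v)) \<longlongrightarrow>
      c u * norm (v - v) + norm (T u v - T u v)) ?F"
    by (intro tendsto_intros cu snd Tv)
  then have lim: "((\<lambda>q. c (fst q) * norm (snd q - v) + norm (T (fst q) v - T u v)) \<longlongrightarrow> 0) ?F"
    by simp
  have "((\<lambda>q. T (fst q) (snd q) - T u v) \<longlongrightarrow> 0) ?F"
    using lim
  proof (rule Lim_null_comparison[rotated])
    show "\<forall>\<^sub>F q in ?F. norm (T (fst q) (snd q) - T u v) \<le>
        c (fst q) * norm (snd q - v) + norm (T (fst q) v - T u v)"
      using ev
    proof eventually_elim
      case (elim q)
      have "T (fst q) (snd q) - T u v = T (fst q) (snd q - v) + (T (fst q) v - T u v)"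
        using linear_diff[OF linear[OF elim]] by simp
      then have "norm (T (fst q) (snd q) - T u v) \<le> norm (T (fst q) (snd q - v)) + norm (T (fst q) v - T u v)"
        by (simp only: norm_triangle_ineq)
      then show ?case
        using bound[OF elim, of "snd q - v"] by linarith
    qed
  qed
  then show "((\<lambda>(u, v). T u v) \<longlongrightarrow> (case p of (u, v) \<Rightarrow> T u v)) ?F"
    using uv by (subst LIM_zero_iff[symmetric]) (simp add: case_prod_unfold)
qed

text \<open>
  Both given families fit this pattern with a common \<open>\<eta>\<close>, which has to be positive for the bound to be integrable at zero.
  A bounded family satisfies the bound as well, because \<open>u powr (\<eta> - 1) \<ge> 1\<close> on the unit interval; so one theory of
  convolutions serves for both.
\<close>

locale singular_family =
  fixes \<eta> C :: real and T :: "real \<Rightarrow> 'a::euclidean_space bborel \<Rightarrow> 'a bborel"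
  assumes \<eta>: "0 < \<eta>" "\<eta> < 1"
    and C_nonneg: "0 \<le> C"
    and linear: "u \<in> {0<..1} \<Longrightarrow> linear (T u)"
    and C0: "u \<in> {0<..1} \<Longrightarrow> f \<in> C0 \<Longrightarrow> T u f \<in> C0"
    and bound: "u \<in> {0<..1} \<Longrightarrow> norm (T u f) \<le> C * u powr (\<eta> - 1) * norm f"
    and continuous: "continuous_on {0<..1} (\<lambda>u. T u f)"
begin

lemma bounded_linear: "u \<in> {0<..1} \<Longrightarrow> bounded_linear (T u)"
  using linear bound
  by (intro bounded_linear.intro bounded_linear_axioms.intro)
     (auto intro!: exI[of _ "C * u powr (\<eta> - 1)"] simp: mult.commute)

lemma joint_continuous: "continuous_on ({0<..1} \<times> UNIV) (\<lambda>(u, v). T u v)"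
  by (rule strongly_continuous_imp_joint_continuous[where c = "\<lambda>u. C * u powr (\<eta> - 1)"])
    (use linear bound continuous in \<open>auto intro!: continuous_intros\<close>)

lemma joint_tendsto:
  assumes "(u \<longlongrightarrow> u0) F" "(v \<longlongrightarrow> v0) F" "u0 \<in> {0<..1}" "\<forall>\<^sub>F n in F. u n \<in> {0<..1}"
  shows "((\<lambda>n. T (u n) (v n)) \<longlongrightarrow> T u0 v0) F"
  using continuous_on_tendsto_compose[OF joint_continuous, of "\<lambda>n. (u n, v n)" "(u0, v0)" F]
    assms by (auto intro: tendsto_Pair)

end

locale singular_density =
  fixes \<eta> K :: real and G :: "real \<Rightarrow> 'a::euclidean_space bborel"
  assumes K_nonneg: "0 \<le> K"
    and G_C0: "s \<in> {0<..1} \<Longrightarrow> G s \<in> C0"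
    and G_bound: "s \<in> {0<..1} \<Longrightarrow> norm (G s) \<le> K * s powr (\<eta> - 1)"
    and G_continuous: "continuous_on {0<..1} G"

locale singular_convolution = singular_family \<eta> C T + singular_density \<eta> K G
  for \<eta> C K :: real and T :: "real \<Rightarrow> 'a::euclidean_space bborel \<Rightarrow> 'a bborel"
    and G :: "real \<Rightarrow> 'a bborel"
begin

lemma integrand_bound:
  assumes "0 < s" "s < t" "0 \<le> \<epsilon>" "t + \<epsilon> \<le> 1"
  shows "norm (T (t - s + \<epsilon>) (G s)) \<le> C * K * ((t - s) powr (\<eta> - 1) * s powr (\<eta> - 1))"
proof -
  have "norm (T (t - s + \<epsilon>) (G s)) \<le> C * (t - s + \<epsilon>) powr (\<eta> - 1) * norm (G s)"
    using assms by (intro bound) auto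
  also have "\<dots> \<le> C * (t - s) powr (\<eta> - 1) * (K * s powr (\<eta> - 1))"
    using assms C_nonneg \<eta> by (intro mult_mono G_bound mult_nonneg_nonneg powr_mono2') auto
  finally show ?thesis by (simp add: ac_simps)
qed

lemma strongly_measurable_integrand:
  assumes A: "A \<in> sets M" and a: "a \<in> borel_measurable M" "\<And>x. x \<in> A \<Longrightarrow> a x \<in> {0<..1}"
    and b: "b \<in> borel_measurable M" "\<And>x. x \<in> A \<Longrightarrow> b x \<in> {0<..1}"
  shows "strongly_measurable_in C0 M (\<lambda>x. if x \<in> A then T (a x) (G (b x)) else 0)"
proof -
  have C00: "0 \<in> (C0 :: 'a bborel set)"
    using subspace_C0 by (rule subspace_0)
  have "strongly_measurable_in C0 M (\<lambda>x. if x \<in> A then G (b x) else 0)"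
    by (rule strongly_measurable_in_continuous[OF G_continuous G_C0 C00 A b])
  from strongly_measurable_in_family[OF A a this, where T = T and W = C0]
  have "strongly_measurable_in C0 M (\<lambda>x. if x \<in> A then T (a x) (if x \<in> A then G (b x) else 0) else 0)"
    using b G_C0 C0 C00 continuous_on_subset[OF joint_continuous, of "{0<..1} \<times> C0"] by auto
  then show ?thesis
    by (rule strongly_measurable_in_cong) auto
qed

lemma
  assumes t: "0 < t" "0 \<le> \<epsilon>" "t + \<epsilon> \<le> 1"
  shows conv_has_integral: "has_gen_bochner_integral lborel
      (\<lambda>s. indicator {0<..<t} s *\<^sub>R T (t - s + \<epsilon>) (G s)) (conv T G t \<epsilon>)"
    and conv_C0: "conv T G t \<epsilon> \<in> C0"
    and conv_norm_nn: "ennreal (norm (conv T G t \<epsilon>)) \<le>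
      (\<integral>\<^sup>+s. ennreal (indicator {0<..<t} s * norm (T (t - s + \<epsilon>) (G s))) \<partial>lborel)"
proof -
  define F where "F s = indicator {0<..<t} s *\<^sub>R T (t - s + \<epsilon>) (G s)" for s
  have "strongly_measurable_in C0 lborel (\<lambda>s. if s \<in> {0<..<t} then T (t - s + \<epsilon>) (G s) else 0)"
    using t by (intro strongly_measurable_integrand) auto
  then have sm: "strongly_measurable_in C0 lborel F"
    by (rule strongly_measurable_in_cong) (simp add: F_def)
  obtain B where B: "\<And>t. t \<in> {0<..1} \<Longrightarrow>
      (\<integral>\<^sup>+s. ennreal (indicator {0<..<t} s * ((t - s) powr (\<eta> - 1) * s powr (\<eta> - 1))) \<partial>lborel)
      \<le> ennreal (B * t powr (\<eta> - 1))"
    using singular_convolution_bound[OF \<eta>] by blast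
  have "(\<integral>\<^sup>+s. norm (F s) \<partial>lborel) \<le>
      (\<integral>\<^sup>+s. ennreal (C * K) * ennreal (indicator {0<..<t} s * ((t - s) powr (\<eta> - 1) * s powr (\<eta> - 1))) \<partial>lborel)"
    using integrand_bound[OF _ _ t(2,3)] C_nonneg K_nonneg
    by (intro nn_integral_mono) (auto simp: F_def indicator_def simp flip: ennreal_mult intro!: ennreal_leI)
  also have "\<dots> = ennreal (C * K) * (\<integral>\<^sup>+s. ennreal (indicator {0<..<t} s * ((t - s) powr (\<eta> - 1) * s powr (\<eta> - 1))) \<partial>lborel)"
    by (rule nn_integral_cmult) measurable
  also have "\<dots> \<le> ennreal (C * K) * ennreal (B * t powr (\<eta> - 1))"
    using t by (intro mult_left_mono B) auto
  also have "\<dots> < \<infinity>" by (simp add: ennreal_mult_less_top)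
  finally have fin: "(\<integral>\<^sup>+s. norm (F s) \<partial>lborel) < \<infinity>" .
  have conv: "conv T G t \<epsilon> = gen_bochner_integral lborel F"
    unfolding conv_def set_gen_bochner_integral_def F_def ..
  from has_gen_bochner_integral_gen_bochner_integral[OF sm subspace_C0 closed_C0 fin]
  show *: "has_gen_bochner_integral lborel
      (\<lambda>s. indicator {0<..<t} s *\<^sub>R T (t - s + \<epsilon>) (G s)) (conv T G t \<epsilon>)"
    and "conv T G t \<epsilon> \<in> C0"
    unfolding conv unfolding F_def by this+
  show "ennreal (norm (conv T G t \<epsilon>)) \<le>
      (\<integral>\<^sup>+s. ennreal (indicator {0<..<t} s * norm (T (t - s + \<epsilon>) (G s))) \<partial>lborel)"
    using norm_bborel_le_nn_integral[OF has_gen_bochner_integral_apply[OF *]] by simp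
qed

lemma conv_apply:
  assumes t: "0 < t" "0 \<le> \<epsilon>" "t + \<epsilon> \<le> 1"
  shows "has_bochner_integral lborel
      (\<lambda>s. indicator {0<..<t} s * apply_bborel (T (t - s + \<epsilon>) (G s)) x) (apply_bborel (conv T G t \<epsilon>) x)"
  using has_gen_bochner_integral_apply[OF conv_has_integral[OF t], of x] by simp

lemma conv_norm_le:
  assumes B: "\<And>t. t \<in> {0<..1} \<Longrightarrow>
      (\<integral>\<^sup>+s. ennreal (indicator {0<..<t} s * ((t - s) powr (\<eta> - 1) * s powr (\<eta> - 1))) \<partial>lborel)
      \<le> ennreal (B * t powr (\<eta> - 1))" "0 \<le> B"
    and t: "0 < t" "0 \<le> \<epsilon>" "t + \<epsilon> \<le> 1"
  shows "norm (conv T G t \<epsilon>) \<le> C * K * (B * t powr (\<eta> - 1))"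
proof -
  have "ennreal (norm (conv T G t \<epsilon>)) \<le>
      (\<integral>\<^sup>+s. ennreal (C * K) * ennreal (indicator {0<..<t} s * ((t - s) powr (\<eta> - 1) * s powr (\<eta> - 1))) \<partial>lborel)"
    using integrand_bound[OF _ _ t(2,3)] C_nonneg K_nonneg
    by (intro order_trans[OF conv_norm_nn[OF t]] nn_integral_mono)
       (auto simp: indicator_def simp flip: ennreal_mult intro!: ennreal_leI)
  also have "\<dots> = ennreal (C * K) * (\<integral>\<^sup>+s. ennreal (indicator {0<..<t} s * ((t - s) powr (\<eta> - 1) * s powr (\<eta> - 1))) \<partial>lborel)"
    by (rule nn_integral_cmult) measurable
  also have "\<dots> \<le> ennreal (C * K) * ennreal (B * t powr (\<eta> - 1))"
    using t by (intro mult_left_mono B) auto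
  also have "\<dots> = ennreal (C * K * (B * t powr (\<eta> - 1)))"
    using C_nonneg K_nonneg B by (simp add: ennreal_mult)
  finally show ?thesis
    using C_nonneg K_nonneg B by (simp add: mult_nonneg_nonneg)
qed

text \<open>
  A bounded family leaves a single singularity at \<open>s = 0\<close>, and the integral is small for small \<open>t\<close>. This is what gives
  continuity of $P_{t,\varepsilon}f$ at \<open>t = 0\<close>.
\<close>

lemma conv_norm_le_of_bounded:
  assumes C1: "\<And>u f. u \<in> {0<..1} \<Longrightarrow> norm (T u f) \<le> C1 * norm f" "0 \<le> C1"
    and t: "0 < t" "0 \<le> \<epsilon>" "t + \<epsilon> \<le> 1"
  shows "norm (conv T G t \<epsilon>) \<le> C1 * K * (t powr \<eta> / \<eta>)"
proof -
  have "norm (T (t - s + \<epsilon>) (G s)) \<le> C1 * K * s powr (\<eta> - 1)" if "0 < s" "s < t" for s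
  proof -
    have "norm (T (t - s + \<epsilon>) (G s)) \<le> C1 * norm (G s)"
      using that t by (intro C1) auto
    also have "\<dots> \<le> C1 * (K * s powr (\<eta> - 1))"
      using that t C1(2) by (intro mult_left_mono G_bound) auto
    finally show ?thesis by (simp add: ac_simps)
  qed
  then have "ennreal (norm (conv T G t \<epsilon>)) \<le>
      (\<integral>\<^sup>+s. ennreal (C1 * K) * ennreal (indicator {0<..<t} s * s powr (\<eta> - 1)) \<partial>lborel)"
    using C1 K_nonneg
    by (intro order_trans[OF conv_norm_nn[OF t]] nn_integral_mono)
       (auto simp: indicator_def simp flip: ennreal_mult intro!: ennreal_leI)
  also have "\<dots> = ennreal (C1 * K) * ennreal (t powr \<eta> / \<eta>)"
    using t \<eta> by (subst nn_integral_cmult, measurable) (subst nn_integral_powr, auto)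
  also have "\<dots> = ennreal (C1 * K * (t powr \<eta> / \<eta>))"
    using C1 K_nonneg \<eta> by (intro ennreal_mult[symmetric]) auto
  finally show ?thesis
    using C1 K_nonneg \<eta> by (simp add: mult_nonneg_nonneg)
qed

text \<open>
  The integrand of \<open>conv T G t \<epsilon>\<close> after the substitution \<open>s = t * v\<close>. It moves the singularity at \<open>s = t\<close> to the
  fixed place \<open>v = 1\<close>, so that one integrable function dominates the integrands for all \<open>t\<close> bounded away from zero.
\<close>

definition scaled_integrand :: "real \<Rightarrow> real \<Rightarrow> real \<Rightarrow> 'a bborel" where
  "scaled_integrand t \<epsilon> v = (if v \<in> {0<..<1} then t *\<^sub>R T (t - t * v + \<epsilon>) (G (t * v)) else 0)"

lemma scaled_integrand_in_range:
  assumes "0 < t" "0 \<le> \<epsilon>" "t + \<epsilon> \<le> 1" "v \<in> {0<..<(1::real)}"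
  shows "t - t * v + \<epsilon> \<in> {0<..1}" "t * v \<in> {0<..1}" "0 < t * v" "t * v < t"
proof -
  show *: "0 < t * v" "t * v < t"
    using assms mult_strict_left_mono[of v "1::real" t] by auto
  with assms show "t - t * v + \<epsilon> \<in> {0<..1}" "t * v \<in> {0<..1}" by auto
qed

lemma scaled_integrand_bound:
  assumes t: "0 < t" "0 \<le> \<epsilon>" "t + \<epsilon> \<le> 1" and \<tau>: "0 < \<tau>" "\<tau> \<le> t"
  shows "norm (scaled_integrand t \<epsilon> v) \<le>
    indicator {0<..<1} v * (C * K * (\<tau> powr (\<eta> - 1) * \<tau> powr (\<eta> - 1)) * ((1 - v) powr (\<eta> - 1) * v powr (\<eta> - 1)))"
proof (cases "v \<in> {0<..<1}")
  case True
  note r = scaled_integrand_in_range[OF t True]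
  have "norm (scaled_integrand t \<epsilon> v) = t * norm (T (t - t * v + \<epsilon>) (G (t * v)))"
    using True t by (simp add: scaled_integrand_def)
  also have "\<dots> \<le> 1 * (C * K * ((t - t * v) powr (\<eta> - 1) * (t * v) powr (\<eta> - 1)))"
    using t r by (intro mult_mono integrand_bound) auto
  also have "\<dots> = C * K * (t powr (\<eta> - 1) * t powr (\<eta> - 1) * ((1 - v) powr (\<eta> - 1) * v powr (\<eta> - 1)))"
    using t True powr_mult[of t "1 - v" "\<eta> - 1"] powr_mult[of t v "\<eta> - 1"]
    by (simp add: algebra_simps)
  also have "\<dots> \<le> C * K * (\<tau> powr (\<eta> - 1) * \<tau> powr (\<eta> - 1) * ((1 - v) powr (\<eta> - 1) * v powr (\<eta> - 1)))"
    using C_nonneg K_nonneg \<tau> \<eta> by (intro mult_left_mono mult_right_mono mult_mono powr_mono2') auto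
  finally show ?thesis using True by (simp add: ac_simps)
next
  case False
  then show ?thesis by (simp only: scaled_integrand_def if_False) (simp add: indicator_def C_nonneg K_nonneg)
qed

lemma strongly_measurable_scaled_integrand:
  assumes t: "0 < t" "0 \<le> \<epsilon>" "t + \<epsilon> \<le> 1"
  shows "strongly_measurable_in C0 lborel (scaled_integrand t \<epsilon>)"
proof -
  have "strongly_measurable_in C0 lborel (\<lambda>v. if v \<in> {0<..<1} then T (t - t * v + \<epsilon>) (G (t * v)) else 0)"
    using scaled_integrand_in_range[OF t] by (intro strongly_measurable_integrand) auto
  then obtain s where s: "\<And>i. simple_function lborel (s i)" "\<And>i x. s i x \<in> C0"
    "\<And>v. (\<lambda>i::nat. s i v) \<longlonglongrightarrow> (if v \<in> {0<..<1} then T (t - t * v + \<epsilon>) (G (t * v)) else 0)"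
    unfolding strongly_measurable_in_def by auto
  show ?thesis
    unfolding strongly_measurable_in_def
  proof (intro exI[of _ "\<lambda>i v. t *\<^sub>R s i v"] conjI allI ballI)
    show "simple_function lborel (\<lambda>v. t *\<^sub>R s i v)" for i
      using s(1) by (rule simple_function_compose1)
    show "t *\<^sub>R s i v \<in> C0" for i v
      using s(2) subspace_C0 by (intro subspace_scale)
    show "(\<lambda>i. t *\<^sub>R s i v) \<longlonglongrightarrow> scaled_integrand t \<epsilon> v" for v
      using tendsto_scaleR[OF tendsto_const s(3), of t v] by (auto simp: scaled_integrand_def split: if_splits)
  qed
qed

lemma conv_scaled:
  assumes t: "0 < t" "0 \<le> \<epsilon>" "t + \<epsilon> \<le> 1"
  shows "has_bochner_integral lborel (\<lambda>v. apply_bborel (scaled_integrand t \<epsilon> v) x) (apply_bborel (conv T G t \<epsilon>) x)"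
proof -
  have "has_bochner_integral lborel
      (\<lambda>v. indicator {0<..<t} (0 + t * v) * apply_bborel (T (t - (0 + t * v) + \<epsilon>) (G (0 + t * v))) x)
      (apply_bborel (conv T G t \<epsilon>) x /\<^sub>R \<bar>t\<bar>)"
    using lborel_has_bochner_integral_real_affine_iff[of t
        "\<lambda>s. indicator {0<..<t} s * apply_bborel (T (t - s + \<epsilon>) (G s)) x" _ 0] conv_apply[OF t, of x] t
    by simp
  from has_bochner_integral_mult_right[OF this, of t]
  have "has_bochner_integral lborel
      (\<lambda>v. t * (indicator {0<..<t} (0 + t * v) * apply_bborel (T (t - (0 + t * v) + \<epsilon>) (G (0 + t * v))) x))
      (t * (apply_bborel (conv T G t \<epsilon>) x /\<^sub>R \<bar>t\<bar>))" .
  moreover have "t * (apply_bborel (conv T G t \<epsilon>) x /\<^sub>R \<bar>t\<bar>) = apply_bborel (conv T G t \<epsilon>) x"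
    using t by (simp add: field_simps)
  moreover have "(\<lambda>v. t * (indicator {0<..<t} (0 + t * v) * apply_bborel (T (t - (0 + t * v) + \<epsilon>) (G (0 + t * v))) x)) =
      (\<lambda>v. apply_bborel (scaled_integrand t \<epsilon> v) x)"
    using t by (auto simp: scaled_integrand_def indicator_def fun_eq_iff zero_less_mult_iff)
  ultimately show ?thesis by (simp only:)
qed

text \<open>
  Dominated convergence for the scaled integrands, using the bound of \<open>scaled_integrand_bound\<close> at half the limit time.
\<close>

lemma conv_continuous:
  "continuous_on {(t, \<epsilon>). 0 < t \<and> 0 \<le> \<epsilon> \<and> t + \<epsilon> \<le> 1} (\<lambda>(t, \<epsilon>). conv T G t \<epsilon>)"
  unfolding continuous_on_sequentially
proof (intro allI ballI impI, elim conjE)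
  fix X :: "nat \<Rightarrow> real \<times> real" and p
  assume p: "p \<in> {(t, \<epsilon>). 0 < t \<and> 0 \<le> \<epsilon> \<and> t + \<epsilon> \<le> 1}"
    and X: "\<forall>n. X n \<in> {(t, \<epsilon>). 0 < t \<and> 0 \<le> \<epsilon> \<and> t + \<epsilon> \<le> 1}" and lim: "X \<longlonglongrightarrow> p"
  obtain t \<epsilon> where p_eq: "p = (t, \<epsilon>)" by fastforce
  have t: "0 < t" "0 \<le> \<epsilon>" "t + \<epsilon> \<le> 1" using p by (auto simp: p_eq)
  define \<tau> where "\<tau> = t / 2"
  have \<tau>: "0 < \<tau>" "\<tau> \<le> t" using t by (auto simp: \<tau>_def)
  have flim: "(\<lambda>n. fst (X n)) \<longlonglongrightarrow> t" and slim: "(\<lambda>n. snd (X n)) \<longlonglongrightarrow> \<epsilon>"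
    using tendsto_fst[OF lim] tendsto_snd[OF lim] by (simp_all add: p_eq)
  have "\<forall>\<^sub>F n in sequentially. \<tau> < fst (X n)"
    using t by (intro order_tendstoD(1)[OF flim]) (simp add: \<tau>_def)
  then obtain N where N: "\<And>n. n \<ge> N \<Longrightarrow> \<tau> < fst (X n)"
    by (auto simp: eventually_sequentially)
  \<comment> \<open>Dropping finitely many members of the sequence leaves only times beyond \<open>\<tau>\<close>, to which the common bound applies.\<close>
  define a where "a n = fst (X (n + N))" for n
  define e where "e n = snd (X (n + N))" for n
  have a_lim: "a \<longlonglongrightarrow> t" and e_lim: "e \<longlonglongrightarrow> \<epsilon>"
    using LIMSEQ_ignore_initial_segment[OF flim, of N] LIMSEQ_ignore_initial_segment[OF slim, of N]
    by (simp_all add: a_def[abs_def] e_def[abs_def])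
  have ae: "0 < a n" "0 \<le> e n" "a n + e n \<le> 1" "\<tau> \<le> a n" for n
    using X[rule_format, of "n + N"] N[of "n + N"] by (auto simp: a_def e_def case_prod_unfold)
  define c where "c = C * K * (\<tau> powr (\<eta> - 1) * \<tau> powr (\<eta> - 1))"
  have c: "c \<ge> 0" using C_nonneg K_nonneg by (simp add: c_def)
  define w where "w v = indicator {0<..<1} v * ((1 - v) powr (\<eta> - 1) * v powr (\<eta> - 1))" for v :: real
  have w_nonneg: "w v \<ge> 0" for v by (simp add: w_def)
  have [measurable]: "w \<in> borel_measurable borel" unfolding w_def by measurable
  obtain B where "\<And>t. t \<in> {0<..1} \<Longrightarrow>
      (\<integral>\<^sup>+s. ennreal (indicator {0<..<t} s * ((t - s) powr (\<eta> - 1) * s powr (\<eta> - 1))) \<partial>lborel)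
      \<le> ennreal (B * t powr (\<eta> - 1))"
    using singular_convolution_bound[OF \<eta>] by blast
  from this[of 1] have "(\<integral>\<^sup>+v. ennreal (w v) \<partial>lborel) \<le> ennreal B"
    by (simp add: w_def)
  then have w_fin: "(\<integral>\<^sup>+v. ennreal (w v) \<partial>lborel) < \<infinity>"
    by (rule le_less_trans) simp
  define d where "d n v = scaled_integrand (a n) (e n) v - scaled_integrand t \<epsilon> v" for n v
  have [measurable]: "d n \<in> borel_measurable borel" for n
  proof -
    have "d n \<in> borel_measurable lborel"
      unfolding d_def
      by (rule strongly_measurable_in_imp_borel[OF strongly_measurable_in_diff[OF subspace_C0]])
        (intro strongly_measurable_scaled_integrand t ae)+
    then show ?thesis by simp
  qed
  have dw: "norm (d n v) \<le> 2 * c * w v" for n v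
  proof -
    have "norm (d n v) \<le> norm (scaled_integrand (a n) (e n) v) + norm (scaled_integrand t \<epsilon> v)"
      unfolding d_def by (rule norm_triangle_ineq4)
    also have "\<dots> \<le> 2 * c * w v"
      using scaled_integrand_bound[OF ae(1-3) \<tau>(1) ae(4), of n v] scaled_integrand_bound[OF t \<tau>, of v]
      by (simp add: c_def w_def algebra_simps)
    finally show ?thesis .
  qed
  have d_lim: "(\<lambda>n. d n v) \<longlonglongrightarrow> 0" for v
  proof (cases "v \<in> {0<..<1}")
    case True
    note r = scaled_integrand_in_range[OF ae(1-3) True] scaled_integrand_in_range[OF t True]
    have "(\<lambda>n. G (a n * v)) \<longlonglongrightarrow> G (t * v)"
      by (rule continuous_on_tendsto_compose[OF G_continuous])
        (use r in \<open>auto intro!: tendsto_intros a_lim\<close>)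
    then have "(\<lambda>n. T (a n - a n * v + e n) (G (a n * v))) \<longlonglongrightarrow> T (t - t * v + \<epsilon>) (G (t * v))"
      by (intro joint_tendsto tendsto_intros a_lim e_lim) (use r in auto)
    then have "(\<lambda>n. a n *\<^sub>R T (a n - a n * v + e n) (G (a n * v)) - t *\<^sub>R T (t - t * v + \<epsilon>) (G (t * v))) \<longlonglongrightarrow>
        t *\<^sub>R T (t - t * v + \<epsilon>) (G (t * v)) - t *\<^sub>R T (t - t * v + \<epsilon>) (G (t * v))"
      by (intro tendsto_intros a_lim)
    then show ?thesis
      using True by (simp add: d_def scaled_integrand_def)
  next
    case False
    then have "d n v = 0" for n by (simp only: d_def scaled_integrand_def if_False diff_self)
    then show ?thesis by simp
  qed
  have "(\<lambda>n. \<integral>\<^sup>+v. ennreal (norm (d n v)) \<partial>lborel) \<longlonglongrightarrow> (\<integral>\<^sup>+v. 0 \<partial>(lborel::real measure))"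
  proof (rule nn_integral_dominated_convergence[where w = "\<lambda>v. ennreal (2 * c) * ennreal (w v)"])
    show "AE v in lborel. ennreal (norm (d n v)) \<le> ennreal (2 * c) * ennreal (w v)" for n
      using dw c w_nonneg by (intro AE_I2) (simp flip: ennreal_mult add: ennreal_leI)
    show "(\<integral>\<^sup>+v. ennreal (2 * c) * ennreal (w v) \<partial>lborel) < \<infinity>"
      using w_fin by (subst nn_integral_cmult) (auto simp: ennreal_mult_less_top)
    show "AE v in lborel. (\<lambda>n. ennreal (norm (d n v))) \<longlonglongrightarrow> 0"
      using tendsto_ennrealI[OF tendsto_norm_zero[OF d_lim]] by simp
  qed measurable
  then have int: "(\<lambda>n. \<integral>\<^sup>+v. ennreal (norm (d n v)) \<partial>lborel) \<longlonglongrightarrow> 0" by simp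
  have le: "ennreal (norm (conv T G (a n) (e n) - conv T G t \<epsilon>)) \<le> (\<integral>\<^sup>+v. ennreal (norm (d n v)) \<partial>lborel)" for n
  proof (rule norm_bborel_le_nn_integral)
    fix x
    show "has_bochner_integral lborel (\<lambda>v. apply_bborel (d n v) x)
       (apply_bborel (conv T G (a n) (e n) - conv T G t \<epsilon>) x)"
      using has_bochner_integral_diff[OF conv_scaled[OF ae(1-3)] conv_scaled[OF t]]
      by (simp add: d_def)
  qed
  have "(\<lambda>n. ennreal (norm (conv T G (a n) (e n) - conv T G t \<epsilon>))) \<longlonglongrightarrow> ennreal 0"
    using tendsto_sandwich[OF _ _ tendsto_const[of 0] int, of "\<lambda>n. ennreal (norm (conv T G (a n) (e n) - conv T G t \<epsilon>))"] le
    by simp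
  then have "(\<lambda>n. norm (conv T G (a n) (e n) - conv T G t \<epsilon>)) \<longlonglongrightarrow> 0"
    by (subst (asm) tendsto_ennreal_iff) auto
  then have "(\<lambda>n. conv T G (a n) (e n)) \<longlonglongrightarrow> conv T G t \<epsilon>"
    by (simp add: tendsto_norm_zero_iff LIM_zero_iff)
  then have "(\<lambda>n. conv T G (fst (X (n + N))) (snd (X (n + N)))) \<longlonglongrightarrow> conv T G t \<epsilon>"
    by (simp add: a_def e_def)
  then have "(\<lambda>n. conv T G (fst (X n)) (snd (X n))) \<longlonglongrightarrow> conv T G t \<epsilon>"
    by (rule LIMSEQ_offset)
  then show "((\<lambda>(t, \<epsilon>). conv T G t \<epsilon>) \<circ> X) \<longlonglongrightarrow> (case p of (t, \<epsilon>) \<Rightarrow> conv T G t \<epsilon>)"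
    by (simp add: p_eq comp_def case_prod_unfold)
qed

lemma conv_continuous_up_to_0:
  assumes C1: "\<And>u f. u \<in> {0<..1} \<Longrightarrow> norm (T u f) \<le> C1 * norm f" "0 \<le> C1"
  shows "continuous_on {(t, \<epsilon>). 0 \<le> t \<and> 0 \<le> \<epsilon> \<and> t + \<epsilon> \<le> 1} (\<lambda>(t, \<epsilon>). conv T G t \<epsilon>)"
    (is "continuous_on ?S _")
  unfolding continuous_on_def
proof (rule ballI)
  fix p assume p: "p \<in> ?S"
  obtain t \<epsilon> where p_eq: "p = (t, \<epsilon>)" by fastforce
  let ?F = "at p within ?S"
  show "((\<lambda>(t, \<epsilon>). conv T G t \<epsilon>) \<longlongrightarrow> (case p of (t, \<epsilon>) \<Rightarrow> conv T G t \<epsilon>)) ?F"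
  proof (cases "0 < t")
    case True
    have "?F = at p within {(t, \<epsilon>). 0 < t \<and> 0 \<le> \<epsilon> \<and> t + \<epsilon> \<le> 1}"
    proof (rule at_within_nhd)
      show "p \<in> {0<..} \<times> UNIV" using True p_eq by simp
      show "open ({(0::real)<..} \<times> (UNIV :: real set))" by (intro open_Times) auto
    qed auto
    moreover have "p \<in> {(t, \<epsilon>). 0 < t \<and> 0 \<le> \<epsilon> \<and> t + \<epsilon> \<le> 1}"
      using p p_eq True by auto
    ultimately show ?thesis
      using conv_continuous[unfolded continuous_on_def, rule_format, of p] by (simp only:)
  next
    case False
    then have t: "t = 0" using p p_eq by auto
    have fst: "(fst \<longlongrightarrow> 0) ?F"
      using tendsto_fst[OF tendsto_ident_at, of p] p_eq t by auto
    have pow: "((\<lambda>q. fst q powr \<eta>) \<longlongrightarrow> 0 powr \<eta>) ?F"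
      by (rule tendsto_powr'[OF fst tendsto_const])
        (use \<eta> in \<open>auto simp: eventually_at_filter intro!: always_eventually\<close>)
    have "((\<lambda>q. C1 * K * (fst q powr \<eta> / \<eta>)) \<longlongrightarrow> C1 * K * (0 powr \<eta> / \<eta>)) ?F"
      by (rule tendsto_mult[OF tendsto_const tendsto_divide[OF pow tendsto_const]]) (use \<eta> in simp)
    then have "((\<lambda>q. C1 * K * (fst q powr \<eta> / \<eta>)) \<longlongrightarrow> 0) ?F"
      using \<eta> by simp
    then have "((\<lambda>q. conv T G (fst q) (snd q)) \<longlongrightarrow> 0) ?F"
    proof (rule Lim_null_comparison[rotated])
      have "norm (conv T G (fst q) (snd q)) \<le> C1 * K * (fst q powr \<eta> / \<eta>)" if "q \<in> ?S" for q
      proof (cases "fst q = 0")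
        case True
        then show ?thesis using C1 K_nonneg \<eta> by (simp add: conv_0_left)
      next
        case False
        then show ?thesis
          using that by (intro conv_norm_le_of_bounded[OF C1]) auto
      qed
      then show "\<forall>\<^sub>F q in ?F. norm (conv T G (fst q) (snd q)) \<le> C1 * K * (fst q powr \<eta> / \<eta>)"
        unfolding eventually_at_filter by (intro always_eventually allI impI)
    qed
    then show ?thesis
      by (simp add: p_eq t conv_0_left case_prod_unfold)
  qed
qed

end

section \<open>The terms of the perturbation series\<close>

abbreviation node_measure :: "nat \<Rightarrow> (nat \<Rightarrow> real) measure" where
  "node_measure n \<equiv> \<Pi>\<^sub>M i\<in>{1..n}. lborel"

lemma nodes_simps:
  "nodes n t s 0 = 0" "nodes n t s (Suc n) = t" "i \<in> {1..n} \<Longrightarrow> nodes n t s i = s i"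
  by (auto simp: nodes_def)

lemma measurable_nodes:
  assumes "i \<le> Suc n"
  shows "(\<lambda>s. nodes n t s i) \<in> borel_measurable (node_measure n)"
proof -
  consider "i = 0" | "i = Suc n" | "i \<in> {1..n}" using assms by force
  then show ?thesis
  proof cases
    case 3
    then have "(\<lambda>s. s i) \<in> measurable (node_measure n) lborel"
      by (rule measurable_component_singleton)
    with 3 show ?thesis by (simp add: nodes_simps)
  qed (simp_all add: nodes_simps)
qed

lemma sets_open_simplex: "open_simplex n t \<in> sets (node_measure n)"
proof -
  have "{s \<in> space (node_measure n). \<forall>i\<in>{..n}. nodes n t s i < nodes n t s (Suc i)} \<in> sets (node_measure n)"
  proof (rule sets.sets_Collect_finite_All)
    fix i assume "i \<in> {..n}"
    then have "i \<le> Suc n" "Suc i \<le> Suc n" by simp_all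
    then show "{s \<in> space (node_measure n). nodes n t s i < nodes n t s (Suc i)} \<in> sets (node_measure n)"
      using borel_measurable_less[OF measurable_nodes measurable_nodes] by blast
  qed simp
  then show ?thesis
    unfolding open_simplex_def Ball_def atMost_iff .
qed

lemma nodes_increment:
  assumes s: "s \<in> open_simplex n t" and t: "t \<le> 1" and i: "i \<le> n"
  shows "nodes n t s (Suc i) - nodes n t s i \<in> {0<..1}"
proof -
  have step: "nodes n t s j < nodes n t s (Suc j)" if "j \<le> n" for j
    using s that by (auto simp: open_simplex_def)
  have "0 \<le> nodes n t s j" if "j \<le> Suc n" for j
    using that
  proof (induction j)
    case (Suc j)
    then show ?case using step[of j] by simp
  qed (simp add: nodes_simps)
  moreover have "nodes n t s j \<le> t" if "j \<le> Suc n" for j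
    using that
  proof (induction j rule: inc_induct)
    case (step j)
    then show ?case using \<open>\<And>j. j \<le> n \<Longrightarrow> nodes n t s j < nodes n t s (Suc j)\<close>[of j] by simp
  qed (simp add: nodes_simps)
  ultimately show ?thesis
    using step[OF i] t i by (smt (verit) Suc_le_mono greaterThanAtMost_iff le_Suc_eq)
qed

lemma open_simplex_imp_pos:
  assumes "s \<in> open_simplex n t"
  shows "0 < t"
proof -
  have "0 \<le> nodes n t s j \<and> 0 < nodes n t s (Suc j)" if "j \<le> n" for j
    using that
  proof (induction j)
    case 0
    have "nodes n t s 0 < nodes n t s (Suc 0)" using assms by (simp add: open_simplex_def)
    then show ?case by (simp add: nodes_simps)
  next
    case (Suc j)
    then have "nodes n t s (Suc j) < nodes n t s (Suc (Suc j))" using assms by (simp add: open_simplex_def)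
    with Suc show ?case by simp
  qed
  from this[of n] show ?thesis by (simp add: nodes_simps)
qed

lemma nodes_update:
  assumes "i \<le> Suc n"
  shows "nodes (Suc n) t (s(Suc n := y)) i = nodes n y s i"
  using assms by (auto simp: nodes_def)

text \<open>
  The last node of a simplex of dimension \<open>Suc n\<close> is the right end point of a simplex of dimension \<open>n\<close>; integrating over the
  last node last therefore turns the simplex integral into a recursion.
\<close>

lemma open_simplex_update_iff:
  assumes "s \<in> space (node_measure n)"
  shows "s(Suc n := y) \<in> open_simplex (Suc n) t \<longleftrightarrow> y < t \<and> s \<in> open_simplex n y"
proof -
  have "s(Suc n := y) \<in> space (node_measure (Suc n))"
    using assms by (auto simp: space_PiM PiE_iff extensional_def)
  moreover have "(\<forall>i\<le>Suc n. nodes (Suc n) t (s(Suc n := y)) i < nodes (Suc n) t (s(Suc n := y)) (Suc i)) \<longleftrightarrow>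
      y < t \<and> (\<forall>i\<le>n. nodes n y s i < nodes n y s (Suc i))"
  proof -
    have split: "(\<forall>i\<le>Suc n. P i) \<longleftrightarrow> P (Suc n) \<and> (\<forall>i\<le>n. P i)" for P
      by (auto simp: le_Suc_eq)
    have "nodes (Suc n) t (s(Suc n := y)) (Suc n) = y" "nodes (Suc n) t (s(Suc n := y)) (Suc (Suc n)) = t"
      by (simp_all add: nodes_def)
    moreover have "(\<forall>i\<le>n. nodes (Suc n) t (s(Suc n := y)) i < nodes (Suc n) t (s(Suc n := y)) (Suc i)) \<longleftrightarrow>
        (\<forall>i\<le>n. nodes n y s i < nodes n y s (Suc i))"
      by (intro all_cong) (simp only: nodes_update le_SucI Suc_le_mono)
    ultimately show ?thesis
      unfolding split by simp
  qed
  ultimately show ?thesis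
    using assms by (simp add: open_simplex_def)
qed

lemma iter_Q_cong:
  "(\<And>i. i \<le> m \<Longrightarrow> \<sigma> i = \<sigma>' i) \<Longrightarrow> iter_Q T \<sigma> m f = iter_Q T \<sigma>' m f"
  by (induction m) auto

lemma iter_Q_update:
  "iter_Q T (nodes (Suc n) t (s(Suc n := y))) (Suc (Suc n)) f = T (t - y) (iter_Q T (nodes n y s) (Suc n) f)"
proof -
  have "iter_Q T (nodes (Suc n) t (s(Suc n := y))) (Suc n) f = iter_Q T (nodes n y s) (Suc n) f"
    by (rule iter_Q_cong) (rule nodes_update)
  then show ?thesis
    by (subst iter_Q.simps) (simp only: nodes_update nodes_simps)
qed

lemma node_measure_0: "node_measure 0 = count_space {\<lambda>_. undefined}"
  by (simp add: PiM_empty)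

lemma open_simplex_0: "0 < t \<Longrightarrow> (\<lambda>_. undefined) \<in> open_simplex 0 t"
  by (simp add: open_simplex_def nodes_simps PiM_empty)

context singular_family
begin

lemma iter_Q_C0:
  assumes "s \<in> open_simplex n t" "t \<le> 1" "f \<in> C0" "m \<le> Suc n"
  shows "iter_Q T (nodes n t s) m f \<in> C0"
  using assms(4)
proof (induction m)
  case (Suc m)
  then show ?case
    using nodes_increment[OF assms(1,2), of m] by (simp add: C0)
qed (use assms in simp)

text \<open>
  Each application of the family at the increment of two nodes preserves strong measurability, by
  \<open>strongly_measurable_in_family\<close>.
\<close>

lemma strongly_measurable_iter_Q:
  assumes f: "f \<in> C0" and t: "t \<le> 1" and m: "m \<le> Suc n"
  shows "strongly_measurable_in C0 (node_measure n)
    (\<lambda>s. if s \<in> open_simplex n t then iter_Q T (nodes n t s) m f else 0)"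
  using m
proof (induction m)
  have C00: "0 \<in> (C0 :: 'a bborel set)"
    using subspace_C0 by (rule subspace_0)
  {
    case 0
    show ?case
      unfolding strongly_measurable_in_def
    proof (intro exI conjI allI ballI)
      show "simple_function (node_measure n) (\<lambda>s. if s \<in> open_simplex n t then f else 0)"
      proof (rule simple_function_If)
        note [measurable] = sets_open_simplex
        show "{s \<in> space (node_measure n). s \<in> open_simplex n t} \<in> sets (node_measure n)"
          by measurable
      qed simp_all
    qed (use f C00 in auto)
  next
    case (Suc m)
    then have IH: "strongly_measurable_in C0 (node_measure n)
        (\<lambda>s. if s \<in> open_simplex n t then iter_Q T (nodes n t s) m f else 0)" by simp
    have a: "(\<lambda>s. nodes n t s (Suc m) - nodes n t s m) \<in> borel_measurable (node_measure n)"
      using Suc.prems by (intro borel_measurable_diff measurable_nodes) auto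
    have a01: "nodes n t s (Suc m) - nodes n t s m \<in> {0<..1}" if "s \<in> open_simplex n t" for s
      using nodes_increment[OF that t] Suc.prems by simp
    have "strongly_measurable_in C0 (node_measure n) (\<lambda>s. if s \<in> open_simplex n t
        then T (nodes n t s (Suc m) - nodes n t s m) (if s \<in> open_simplex n t then iter_Q T (nodes n t s) m f else 0)
        else 0)"
    proof (rule strongly_measurable_in_family[OF sets_open_simplex a a01 IH])
      show "continuous_on ({0<..1} \<times> C0) (\<lambda>(u, v). T u v)"
        using joint_continuous by (rule continuous_on_subset) auto
      show "(if s \<in> open_simplex n t then iter_Q T (nodes n t s) m f else 0) \<in> C0"
        if "s \<in> open_simplex n t" for s
        using iter_Q_C0[OF that t f, of m] Suc.prems that by simp
    qed (use C0 C00 in auto)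
    then show ?case
      by (rule strongly_measurable_in_cong) simp
  }
qed

definition simplex_integrand :: "nat \<Rightarrow> real \<Rightarrow> 'a bborel \<Rightarrow> (nat \<Rightarrow> real) \<Rightarrow> 'a bborel" where
  "simplex_integrand n t f s = indicator (open_simplex n t) s *\<^sub>R iter_Q T (nodes n t s) (Suc n) f"

lemma strongly_measurable_simplex_integrand:
  assumes "f \<in> C0" "t \<le> 1"
  shows "strongly_measurable_in C0 (node_measure n) (simplex_integrand n t f)"
  using strongly_measurable_iter_Q[OF assms, of "Suc n" n]
  by (rule strongly_measurable_in_cong) (simp_all add: simplex_integrand_def)

lemma simplex_integrand_update:
  assumes s: "s \<in> space (node_measure n)" and t: "t \<le> 1"
  shows "simplex_integrand (Suc n) t f (s(Suc n := y)) =
    (if y \<in> {0<..<t} then T (t - y) (simplex_integrand n y f s) else 0)"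
proof (cases "y \<in> {0<..<t}")
  case True
  then have "linear (T (t - y))" using t by (intro linear) auto
  then have "T (t - y) 0 = 0" by (rule linear_0)
  then show ?thesis
    using True unfolding simplex_integrand_def iter_Q_update
    by (simp add: open_simplex_update_iff[OF s] indicator_def del: iter_Q.simps)
next
  case False
  then have "s(Suc n := y) \<notin> open_simplex (Suc n) t"
    using open_simplex_imp_pos[of s n y] by (auto simp: open_simplex_update_iff[OF s])
  with False show ?thesis
    by (auto simp: simplex_integrand_def)
qed

text \<open>
  Induction on the number of nodes, with Tonelli's theorem splitting off the last one: the contraction
  estimate gives the additional factor \<open>1 / 2\<close>. This also shows that the simplex integrals converge absolutely.
\<close>

lemma nn_integral_simplex_integrand:
  assumes \<kappa>: "0 \<le> \<kappa>" and contr: "\<And>t. t \<in> {0<..1} \<Longrightarrow>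
      (\<integral>\<^sup>+s. ennreal (indicator {0<..<t} s * (C * (t - s) powr (\<eta> - 1) * (exp (\<kappa> * s) * s powr (\<eta> - 1)))) \<partial>lborel)
      \<le> ennreal (1 / 2 * (exp (\<kappa> * t) * t powr (\<eta> - 1)))"
    and f: "f \<in> C0" and t: "t \<in> {0<..1}"
  shows "(\<integral>\<^sup>+s. norm (simplex_integrand n t f s) \<partial>node_measure n) \<le>
    ennreal (C * norm f * (1 / 2) ^ n * (exp (\<kappa> * t) * t powr (\<eta> - 1)))"
  using t
proof (induction n arbitrary: t)
  case 0
  have "norm (simplex_integrand 0 t f (\<lambda>_. undefined)) = norm (T t f)"
    using 0 by (simp add: simplex_integrand_def open_simplex_0 nodes_simps nodes_def)
  also have "\<dots> \<le> C * t powr (\<eta> - 1) * norm f"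
    using 0 by (rule bound)
  also have "\<dots> \<le> C * norm f * (1 / 2) ^ 0 * (exp (\<kappa> * t) * t powr (\<eta> - 1))"
    using 0 \<kappa> C_nonneg mult_left_mono[of 1 "exp (\<kappa> * t)" "C * norm f * t powr (\<eta> - 1)"]
    by (simp add: ac_simps)
  finally show ?case
    unfolding node_measure_0 by (simp add: nn_integral_count_space_finite ennreal_leI)
next
  case (Suc n)
  interpret product_sigma_finite "\<lambda>_::nat. lborel :: real measure" by standard
  have ins: "{1..Suc n} = insert (Suc n) {1..n}" by auto
  have [measurable]: "simplex_integrand k t f \<in> borel_measurable (node_measure k)" if "t \<le> 1" for t k
    using strongly_measurable_simplex_integrand[OF f that] by (rule strongly_measurable_in_imp_borel)
  define c where "c = C * norm f * (1 / 2) ^ n"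
  have c: "c \<ge> 0" using C_nonneg by (simp add: c_def)
  have "(\<integral>\<^sup>+s. norm (simplex_integrand (Suc n) t f s) \<partial>node_measure (Suc n)) =
      (\<integral>\<^sup>+y. (\<integral>\<^sup>+s. norm (simplex_integrand (Suc n) t f (s(Suc n := y))) \<partial>node_measure n) \<partial>lborel)"
    unfolding ins
  proof (rule product_nn_integral_insert_rev)
    have "(\<lambda>s. ennreal (norm (simplex_integrand (Suc n) t f s))) \<in> borel_measurable (node_measure (Suc n))"
      using strongly_measurable_in_imp_borel[OF strongly_measurable_simplex_integrand[OF f, of t "Suc n"]]
        Suc.prems by simp
    then show "(\<lambda>s. ennreal (norm (simplex_integrand (Suc n) t f s)))
        \<in> borel_measurable (Pi\<^sub>M (insert (Suc n) {1..n}) (\<lambda>_. lborel))"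
      unfolding ins .
  qed auto
  also have "\<dots> \<le> (\<integral>\<^sup>+y. ennreal c *
      ennreal (indicator {0<..<t} y * (C * (t - y) powr (\<eta> - 1) * (exp (\<kappa> * y) * y powr (\<eta> - 1)))) \<partial>lborel)"
  proof (rule nn_integral_mono)
    fix y :: real
    show "(\<integral>\<^sup>+s. norm (simplex_integrand (Suc n) t f (s(Suc n := y))) \<partial>node_measure n) \<le> ennreal c *
      ennreal (indicator {0<..<t} y * (C * (t - y) powr (\<eta> - 1) * (exp (\<kappa> * y) * y powr (\<eta> - 1))))"
    proof (cases "y \<in> {0<..<t}")
      case True
      have [measurable]: "simplex_integrand n y f \<in> borel_measurable (node_measure n)"
        using True Suc.prems strongly_measurable_in_imp_borel[OF strongly_measurable_simplex_integrand[OF f]] by simp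
      have "(\<integral>\<^sup>+s. norm (simplex_integrand (Suc n) t f (s(Suc n := y))) \<partial>node_measure n) \<le>
          (\<integral>\<^sup>+s. ennreal (C * (t - y) powr (\<eta> - 1)) * norm (simplex_integrand n y f s) \<partial>node_measure n)"
      proof (rule nn_integral_mono)
        fix s assume "s \<in> space (node_measure n)"
        then have "simplex_integrand (Suc n) t f (s(Suc n := y)) = T (t - y) (simplex_integrand n y f s)"
          using True Suc.prems by (simp add: simplex_integrand_update)
        then show "ennreal (norm (simplex_integrand (Suc n) t f (s(Suc n := y)))) \<le>
            ennreal (C * (t - y) powr (\<eta> - 1)) * norm (simplex_integrand n y f s)"
          using bound[of "t - y" "simplex_integrand n y f s"] True Suc.prems C_nonneg
          by (simp flip: ennreal_mult add: ennreal_leI)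
      qed
      also have "\<dots> = ennreal (C * (t - y) powr (\<eta> - 1)) * (\<integral>\<^sup>+s. norm (simplex_integrand n y f s) \<partial>node_measure n)"
        by (rule nn_integral_cmult) measurable
      also have "\<dots> \<le> ennreal (C * (t - y) powr (\<eta> - 1)) * ennreal (c * (exp (\<kappa> * y) * y powr (\<eta> - 1)))"
        unfolding c_def using True Suc.prems by (intro mult_left_mono Suc.IH) auto
      also have "\<dots> = ennreal c *
          ennreal (indicator {0<..<t} y * (C * (t - y) powr (\<eta> - 1) * (exp (\<kappa> * y) * y powr (\<eta> - 1))))"
        using True c C_nonneg by (simp flip: ennreal_mult add: ac_simps)
      finally show ?thesis .
    next
      case False
      then have "simplex_integrand (Suc n) t f (s(Suc n := y)) = 0" if "s \<in> space (node_measure n)" for s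
        using that Suc.prems by (simp only: simplex_integrand_update greaterThanAtMost_iff if_False)
      then have "(\<integral>\<^sup>+s. norm (simplex_integrand (Suc n) t f (s(Suc n := y))) \<partial>node_measure n) = 0"
        by (simp add: nn_integral_0_iff_AE cong: nn_integral_cong_simp)
      then show ?thesis by simp
    qed
  qed
  also have "\<dots> = ennreal c * (\<integral>\<^sup>+y.
      ennreal (indicator {0<..<t} y * (C * (t - y) powr (\<eta> - 1) * (exp (\<kappa> * y) * y powr (\<eta> - 1)))) \<partial>lborel)"
    by (rule nn_integral_cmult) measurable
  also have "\<dots> \<le> ennreal c * ennreal (1 / 2 * (exp (\<kappa> * t) * t powr (\<eta> - 1)))"
    using Suc.prems by (intro mult_left_mono contr) auto
  also have "\<dots> = ennreal (C * norm f * (1 / 2) ^ Suc n * (exp (\<kappa> * t) * t powr (\<eta> - 1)))"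
    using c by (simp add: c_def flip: ennreal_mult)
  finally show ?case .
qed

lemma Q_term_eq: "Q_term T n t f = gen_bochner_integral (node_measure n) (simplex_integrand n t f)"
  unfolding Q_term_def set_gen_bochner_integral_def simplex_integrand_def ..

lemma Q_term_bound_exists:
  obtains K where "0 \<le> K"
    "\<And>n t f. f \<in> C0 \<Longrightarrow> t \<in> {0<..1} \<Longrightarrow>
      (\<integral>\<^sup>+s. norm (simplex_integrand n t f s) \<partial>node_measure n) \<le> ennreal (K * norm f * (1 / 2) ^ n * t powr (\<eta> - 1))"
proof -
  obtain \<kappa> where \<kappa>: "0 \<le> \<kappa>" "\<And>t. t \<in> {0<..1} \<Longrightarrow>
      (\<integral>\<^sup>+s. ennreal (indicator {0<..<t} s * (C * (t - s) powr (\<eta> - 1) * (exp (\<kappa> * s) * s powr (\<eta> - 1)))) \<partial>lborel)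
      \<le> ennreal (1 / 2 * (exp (\<kappa> * t) * t powr (\<eta> - 1)))"
    using singular_convolution_contraction[OF \<eta> C_nonneg] by blast
  show thesis
  proof (rule that[of "C * exp \<kappa>"])
    show "0 \<le> C * exp \<kappa>" using C_nonneg by simp
    fix n t and f :: "'a bborel"
    assume f: "f \<in> C0" and t: "t \<in> {0<..(1::real)}"
    have "\<kappa> * t \<le> \<kappa>" using t \<kappa>(1) by (simp add: mult_left_le)
    then have "C * norm f * (1 / 2) ^ n * (exp (\<kappa> * t) * t powr (\<eta> - 1)) \<le>
        C * norm f * (1 / 2) ^ n * (exp \<kappa> * t powr (\<eta> - 1))"
      using C_nonneg by (intro mult_left_mono mult_right_mono) auto
    also have "\<dots> = C * exp \<kappa> * norm f * (1 / 2) ^ n * t powr (\<eta> - 1)"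
      by (simp only: ac_simps)
    finally show "(\<integral>\<^sup>+s. norm (simplex_integrand n t f s) \<partial>node_measure n) \<le>
        ennreal (C * exp \<kappa> * norm f * (1 / 2) ^ n * t powr (\<eta> - 1))"
      using nn_integral_simplex_integrand[OF \<kappa> f t] ennreal_leI order_trans by blast
  qed
qed

lemma
  assumes f: "f \<in> C0" and t: "t \<in> {0<..1}"
  shows Q_term_has_integral: "has_gen_bochner_integral (node_measure n) (simplex_integrand n t f) (Q_term T n t f)"
    and Q_term_C0: "Q_term T n t f \<in> C0"
proof -
  obtain K where "(\<integral>\<^sup>+s. norm (simplex_integrand n t f s) \<partial>node_measure n) \<le>
      ennreal (K * norm f * (1 / 2) ^ n * t powr (\<eta> - 1))"
    using Q_term_bound_exists f t by metis
  also have "\<dots> < \<infinity>" by simp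
  finally have fin: "(\<integral>\<^sup>+s. norm (simplex_integrand n t f s) \<partial>node_measure n) < \<infinity>" .
  have "t \<le> 1" using t by simp
  from has_gen_bochner_integral_gen_bochner_integral[OF
      strongly_measurable_simplex_integrand[OF f this] subspace_C0 closed_C0 fin]
  show "has_gen_bochner_integral (node_measure n) (simplex_integrand n t f) (Q_term T n t f)"
    "Q_term T n t f \<in> C0"
    unfolding Q_term_eq by this+
qed

lemma Q_term_norm_exists:
  obtains K where "0 \<le> K"
    "\<And>n t f. f \<in> C0 \<Longrightarrow> t \<in> {0<..1} \<Longrightarrow>
      norm (Q_term T n t f) \<le> K * norm f * (1 / 2) ^ n * t powr (\<eta> - 1)"
proof -
  obtain K where K: "0 \<le> K"
    "\<And>n t f. f \<in> C0 \<Longrightarrow> t \<in> {0<..1} \<Longrightarrow>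
      (\<integral>\<^sup>+s. norm (simplex_integrand n t f s) \<partial>node_measure n) \<le> ennreal (K * norm f * (1 / 2) ^ n * t powr (\<eta> - 1))"
    using Q_term_bound_exists by metis
  show thesis
  proof (rule that[OF K(1)])
    fix n t and f :: "'a bborel"
    assume f: "f \<in> C0" and t: "t \<in> {0<..(1::real)}"
    have "ennreal (norm (Q_term T n t f)) \<le> ennreal (K * norm f * (1 / 2) ^ n * t powr (\<eta> - 1))"
      using norm_bborel_le_nn_integral[OF has_gen_bochner_integral_apply[OF Q_term_has_integral[OF f t]]] K(2)[OF f t]
      by (rule order_trans)
    then show "norm (Q_term T n t f) \<le> K * norm f * (1 / 2) ^ n * t powr (\<eta> - 1)"
      using K(1) by simp
  qed
qed

lemma Q_term_0:
  assumes f: "f \<in> C0" and t: "t \<in> {0<..1}"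
  shows "Q_term T 0 t f = T t f"
proof (rule bborel_eqI)
  fix x
  have "apply_bborel (Q_term T 0 t f) x =
      integral\<^sup>L (node_measure 0) (\<lambda>s. apply_bborel (simplex_integrand 0 t f s) x)"
    using has_gen_bochner_integral_apply[OF Q_term_has_integral[OF f t], of 0 x]
    by (simp add: has_bochner_integral_integral_eq)
  also have "\<dots> = apply_bborel (simplex_integrand 0 t f (\<lambda>_. undefined)) x"
    unfolding node_measure_0 by (simp add: lebesgue_integral_count_space_finite)
  also have "\<dots> = apply_bborel (T t f) x"
    using t by (simp add: simplex_integrand_def open_simplex_0 nodes_def)
  finally show "apply_bborel (Q_term T 0 t f) x = apply_bborel (T t f) x" .
qed

text \<open>
  Both sides are evaluated at a point, where Fubini's theorem is available, and the operator that is applied last is pulled out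
  of the inner simplex integral.
\<close>

lemma Q_term_Suc:
  assumes f: "f \<in> C0" and t: "t \<in> {0<..1}" and G: "singular_density \<eta> K (\<lambda>s. Q_term T n s f)"
  shows "Q_term T (Suc n) t f = conv T (\<lambda>s. Q_term T n s f) t 0"
proof (rule bborel_eqI)
  fix x
  interpret G: singular_convolution \<eta> C K T "\<lambda>s. Q_term T n s f"
    using singular_family_axioms G by (rule singular_convolution.intro)
  interpret product_sigma_finite "\<lambda>_::nat. lborel :: real measure" by standard
  have ins: "{1..Suc n} = {Suc n} \<union> {1..n}" by auto
  define H where "H s = apply_bborel (simplex_integrand (Suc n) t f s) x" for s
  define h where "h y = (\<integral>s. H (s(Suc n := y)) \<partial>node_measure n)" for y
  have h: "h y = indicator {0<..<t} y * apply_bborel (T (t - y + 0) (Q_term T n y f)) x" for y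
  proof (cases "y \<in> {0<..<t}")
    case True
    then have y: "y \<in> {0<..1}" "t - y \<in> {0<..1}" using t by auto
    have "h y = (\<integral>s. apply_bborel (T (t - y) (simplex_integrand n y f s)) x \<partial>node_measure n)"
      unfolding h_def H_def
    proof (rule Bochner_Integration.integral_cong[OF refl])
      fix s assume "s \<in> space (node_measure n)"
      then show "apply_bborel (simplex_integrand (Suc n) t f (s(Suc n := y))) x =
          apply_bborel (T (t - y) (simplex_integrand n y f s)) x"
        using True t by (simp add: simplex_integrand_update)
    qed
    also have "\<dots> = apply_bborel (T (t - y) (Q_term T n y f)) x"
      using has_gen_bochner_integral_apply[OF
          has_gen_bochner_integral_linear[OF bounded_linear[OF y(2)] Q_term_has_integral[OF f y(1), of n]], of x]
      by (rule has_bochner_integral_integral_eq)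
    finally show ?thesis using True by simp
  next
    case False
    have "h y = (\<integral>s. 0 \<partial>node_measure n)"
      unfolding h_def H_def
    proof (rule Bochner_Integration.integral_cong[OF refl])
      fix s assume "s \<in> space (node_measure n)"
      then show "apply_bborel (simplex_integrand (Suc n) t f (s(Suc n := y))) x = 0"
        using t by (simp only: simplex_integrand_update False if_False greaterThanAtMost_iff zero_bborel.rep_eq)
    qed
    with False show ?thesis by simp
  qed
  have t': "0 < t" "(0::real) \<le> 0" "t + 0 \<le> 1" using t by auto
  note conv = G.conv_apply[OF t', of x]
  then have conv_h: "has_bochner_integral lborel h (apply_bborel (conv T (\<lambda>s. Q_term T n s f) t 0) x)"
    by (simp only: h[abs_def])
  have HB: "has_bochner_integral (node_measure (Suc n)) H (apply_bborel (Q_term T (Suc n) t f) x)"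
    unfolding H_def by (rule has_gen_bochner_integral_apply[OF Q_term_has_integral[OF f t]])
  then have "apply_bborel (Q_term T (Suc n) t f) x = integral\<^sup>L (node_measure (Suc n)) H"
    by (simp add: has_bochner_integral_integral_eq)
  also have "\<dots> = (\<integral>z. (\<integral>s. H (merge {Suc n} {1..n} (z, s)) \<partial>node_measure n) \<partial>(\<Pi>\<^sub>M i\<in>{Suc n}. lborel))"
    unfolding ins
  proof (rule product_integral_fold)
    show "integrable (Pi\<^sub>M ({Suc n} \<union> {1..n}) (\<lambda>_. lborel)) H"
      using HB unfolding ins by (rule integrable.intros)
  qed auto
  also have "\<dots> = (\<integral>z. h (z (Suc n)) \<partial>(\<Pi>\<^sub>M i\<in>{Suc n}. lborel))"
    unfolding h_def
  proof (intro Bochner_Integration.integral_cong refl)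
    fix z s :: "nat \<Rightarrow> real" assume "s \<in> space (node_measure n)"
    then have "merge {Suc n} {1..n} (z, s) = s(Suc n := z (Suc n))"
      by (auto simp: merge_def fun_eq_iff space_PiM PiE_iff extensional_def)
    then show "H (merge {Suc n} {1..n} (z, s)) = H (s(Suc n := z (Suc n)))" by simp
  qed
  also have "\<dots> = integral\<^sup>L lborel h"
    by (rule product_integral_singleton) (use conv_h in \<open>auto simp: borel_measurable_has_bochner_integral\<close>)
  also have "\<dots> = apply_bborel (conv T (\<lambda>s. Q_term T n s f) t 0) x"
    using conv_h by (rule has_bochner_integral_integral_eq)
  finally show "apply_bborel (Q_term T (Suc n) t f) x = apply_bborel (conv T (\<lambda>s. Q_term T n s f) t 0) x" .
qed

text \<open>
  Continuity in time is inherited along the recursion \<open>Q_term_Suc\<close> from \<open>conv_continuous\<close>; the recursion itself needs the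
  previous term to be a density, so both are carried through one induction.
\<close>

lemma singular_density_Q_term:
  assumes f: "f \<in> C0" and K: "0 \<le> K" "\<And>n t. t \<in> {0<..1} \<Longrightarrow>
      norm (Q_term T n t f) \<le> K * (1 / 2) ^ n * t powr (\<eta> - 1)"
  shows "singular_density \<eta> (K * (1 / 2) ^ n) (\<lambda>s. Q_term T n s f)"
proof (induction n)
  case 0
  show ?case
  proof
    show "continuous_on {0<..1} (\<lambda>s. Q_term T 0 s f)"
      using continuous[of f] by (rule continuous_on_eq) (simp add: Q_term_0 f)
  qed (use K(1) K(2)[of _ 0] Q_term_C0[OF f] in auto)
next
  case (Suc n)
  interpret G: singular_convolution \<eta> C "K * (1 / 2) ^ n" T "\<lambda>s. Q_term T n s f"
    using singular_family_axioms Suc.IH by (rule singular_convolution.intro)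
  show ?case
  proof
    have "continuous_on {0<..1} (\<lambda>t. (\<lambda>(t, \<epsilon>). conv T (\<lambda>s. Q_term T n s f) t \<epsilon>) (t, 0))"
      by (rule continuous_on_compose2[OF G.conv_continuous]) (auto intro!: continuous_intros)
    then have "continuous_on {0<..1} (\<lambda>t. conv T (\<lambda>s. Q_term T n s f) t 0)" by simp
    then show "continuous_on {0<..1} (\<lambda>s. Q_term T (Suc n) s f)"
      by (rule continuous_on_eq) (rule Q_term_Suc[OF f _ Suc.IH, symmetric])
  qed (use K(1) K(2)[of _ "Suc n"] Q_term_C0[OF f] in auto)
qed

lemma singular_density_add:
  assumes "singular_density \<eta> K1 G1" "singular_density \<eta> K2 G2"
  shows "singular_density \<eta> (K1 + K2) (\<lambda>s. G1 s + G2 s)"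
proof -
  interpret G1: singular_density \<eta> K1 G1 by fact
  interpret G2: singular_density \<eta> K2 G2 by fact
  show ?thesis
  proof
    fix s :: real assume s: "s \<in> {0<..1}"
    show "G1 s + G2 s \<in> C0"
      using s by (intro subspace_add[OF subspace_C0] G1.G_C0 G2.G_C0)
    show "norm (G1 s + G2 s) \<le> (K1 + K2) * s powr (\<eta> - 1)"
      using norm_triangle_ineq[of "G1 s" "G2 s"] G1.G_bound[OF s] G2.G_bound[OF s]
      by (simp add: distrib_right)
  qed (use G1.K_nonneg G2.K_nonneg in \<open>auto intro!: continuous_intros G1.G_continuous G2.G_continuous\<close>)
qed

lemma conv_add:
  assumes G1: "singular_density \<eta> K1 G1" and G2: "singular_density \<eta> K2 G2"
    and t: "0 < t" "0 \<le> \<epsilon>" "t + \<epsilon> \<le> 1"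
  shows "conv T (\<lambda>s. G1 s + G2 s) t \<epsilon> = conv T G1 t \<epsilon> + conv T G2 t \<epsilon>"
proof -
  interpret G1: singular_convolution \<eta> C K1 T G1
    using singular_family_axioms G1 by (rule singular_convolution.intro)
  interpret G2: singular_convolution \<eta> C K2 T G2
    using singular_family_axioms G2 by (rule singular_convolution.intro)
  interpret G: singular_convolution \<eta> C "K1 + K2" T "\<lambda>s. G1 s + G2 s"
    using singular_family_axioms singular_density_add[OF G1 G2] by (rule singular_convolution.intro)
  show ?thesis
  proof (rule bborel_eqI)
    fix x
    have "indicator {0<..<t} s * apply_bborel (T (t - s + \<epsilon>) (G1 s + G2 s)) x =
       indicator {0<..<t} s * apply_bborel (T (t - s + \<epsilon>) (G1 s)) x +
       indicator {0<..<t} s * apply_bborel (T (t - s + \<epsilon>) (G2 s)) x" for s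
    proof (cases "s \<in> {0<..<t}")
      case True
      then have "t - s + \<epsilon> \<in> {0<..1}" using t by auto
      then show ?thesis
        using linear_add[OF linear] by (simp add: distrib_left)
    qed simp
    with G.conv_apply[OF t, of x] has_bochner_integral_add[OF G1.conv_apply[OF t, of x] G2.conv_apply[OF t, of x]]
    show "apply_bborel (conv T (\<lambda>s. G1 s + G2 s) t \<epsilon>) x = apply_bborel (conv T G1 t \<epsilon> + conv T G2 t \<epsilon>) x"
      by (simp add: has_bochner_integral_eq)
  qed
qed

end

section \<open>The Volterra equation\<close>

context singular_family
begin

lemma conv_zero:
  assumes t: "0 < t" "0 \<le> \<epsilon>" "t + \<epsilon> \<le> 1"
  shows "conv T (\<lambda>_. 0) t \<epsilon> = 0"
proof -
  interpret G: singular_convolution \<eta> C 0 T "\<lambda>_. 0"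
    by (intro singular_convolution.intro singular_family_axioms singular_density.intro)
       (auto intro: subspace_0[OF subspace_C0])
  obtain B where B: "0 \<le> B" "\<And>t. t \<in> {0<..1} \<Longrightarrow>
      (\<integral>\<^sup>+s. ennreal (indicator {0<..<t} s * ((t - s) powr (\<eta> - 1) * s powr (\<eta> - 1))) \<partial>lborel)
      \<le> ennreal (B * t powr (\<eta> - 1))"
    using singular_convolution_bound[OF \<eta>] by blast
  show ?thesis
    using G.conv_norm_le[OF B(2,1) t] by simp
qed

lemma Q_op_tail_exists:
  assumes f: "f \<in> C0"
  obtains K where "0 \<le> K"
    "\<And>n. singular_density \<eta> (K * (1 / 2) ^ n) (\<lambda>s. Q_term T n s f)"
    "\<And>N s. s \<in> {0<..1} \<Longrightarrow> norm (Q_op T s f - (\<Sum>n<N. Q_term T n s f)) \<le> 2 * K * (1 / 2) ^ N * s powr (\<eta> - 1)"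
proof -
  obtain K0 where K0: "0 \<le> K0" "\<And>n t f. f \<in> C0 \<Longrightarrow> t \<in> {0<..1} \<Longrightarrow>
      norm (Q_term T n t f) \<le> K0 * norm f * (1 / 2) ^ n * t powr (\<eta> - 1)"
    using Q_term_norm_exists by blast
  define K where "K = K0 * norm f"
  have K: "0 \<le> K" "\<And>n t. t \<in> {0<..1} \<Longrightarrow> norm (Q_term T n t f) \<le> K * (1 / 2) ^ n * t powr (\<eta> - 1)"
    using K0(1) K0(2)[OF f] by (simp_all add: K_def)
  show thesis
  proof (rule that[OF K(1) singular_density_Q_term[OF f K]])
    fix N and s :: real assume s: "s \<in> {0<..1}"
    define c where "c = K * s powr (\<eta> - 1)"
    have le: "norm (Q_term T n s f) \<le> c * (1 / 2) ^ n" for n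
      using K(2)[OF s, of n] by (simp add: c_def ac_simps)
    have summ: "summable (\<lambda>n. Q_term T n s f)"
      by (rule summable_comparison_test'[where g = "\<lambda>n. c * (1 / 2) ^ n" and N = 0])
        (use le in \<open>auto intro!: summable_mult summable_geometric\<close>)
    have "Q_op T s f = (\<Sum>n. Q_term T n s f)"
      unfolding Q_op_def suminf_split_head[OF summ] using Q_term_0[OF f s] by simp
    then have "Q_op T s f - (\<Sum>n<N. Q_term T n s f) = (\<Sum>n. Q_term T (n + N) s f)"
      using suminf_minus_initial_segment[OF summ, of N] by simp
    also have "norm \<dots> \<le> (\<Sum>n. c * (1 / 2) ^ N * (1 / 2) ^ n)"
    proof (rule norm_suminf_le)
      show "norm (Q_term T (n + N) s f) \<le> c * (1 / 2) ^ N * (1 / 2) ^ n" for n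
        using le[of "n + N"] by (simp add: power_add ac_simps)
      show "summable (\<lambda>n. c * (1 / 2) ^ N * (1 / 2) ^ n)"
        by (intro summable_mult summable_geometric) simp
    qed
    also have "\<dots> = c * (1 / 2) ^ N * (\<Sum>n. (1 / 2) ^ n)"
      by (rule suminf_mult) (intro summable_geometric, simp)
    also have "\<dots> = 2 * K * (1 / 2) ^ N * s powr (\<eta> - 1)"
      by (subst suminf_geometric) (simp_all add: c_def)
    finally show "norm (Q_op T s f - (\<Sum>n<N. Q_term T n s f)) \<le> 2 * K * (1 / 2) ^ N * s powr (\<eta> - 1)" .
  qed
qed

text \<open>
  The series converges uniformly after multiplication by \<open>s powr (1 - \<eta>)\<close>, which compensates the singularity at zero; this
  gives continuity of the sum on the whole half-open interval at once.
\<close>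

lemma singular_density_Q_op:
  assumes f: "f \<in> C0"
  obtains K where "singular_density \<eta> K (\<lambda>s. Q_op T s f)"
proof -
  obtain K where K: "0 \<le> K"
    "\<And>n. singular_density \<eta> (K * (1 / 2) ^ n) (\<lambda>s. Q_term T n s f)"
    and tail: "\<And>N s. s \<in> {0<..1} \<Longrightarrow>
      norm (Q_op T s f - (\<Sum>n<N. Q_term T n s f)) \<le> 2 * K * (1 / 2) ^ N * s powr (\<eta> - 1)"
    using Q_op_tail_exists[OF f] by blast
  define S where "S N s = (\<Sum>n<N. Q_term T n s f)" for N s
  have half: "(\<lambda>N. 2 * K * (1 / 2) ^ N) \<longlonglongrightarrow> 0"
    by (intro tendsto_mult_right_zero LIMSEQ_power_zero) simp
  have S_lim: "(\<lambda>N. S N s) \<longlonglongrightarrow> Q_op T s f" if s: "s \<in> {0<..1}" for s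
  proof -
    have "(\<lambda>N. 2 * K * (1 / 2) ^ N * s powr (\<eta> - 1)) \<longlonglongrightarrow> 0"
      using half by (rule tendsto_mult_left_zero)
    then have "(\<lambda>N. Q_op T s f - S N s) \<longlonglongrightarrow> 0"
      by (rule Lim_null_comparison[rotated]) (use tail[OF s] in \<open>simp add: S_def\<close>)
    then have "(\<lambda>N. Q_op T s f - (Q_op T s f - S N s)) \<longlonglongrightarrow> Q_op T s f - 0"
      by (intro tendsto_intros)
    then show ?thesis by simp
  qed
  have "singular_density \<eta> (2 * K) (\<lambda>s. Q_op T s f)"
  proof
    show "0 \<le> 2 * K" using K(1) by simp
    fix s :: real assume s: "s \<in> {0<..1}"
    show "norm (Q_op T s f) \<le> 2 * K * s powr (\<eta> - 1)"
      using tail[OF s, of 0] by simp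
    have "S N s \<in> C0" for N
      unfolding S_def using s Q_term_C0[OF f] by (intro subspace_sum[OF subspace_C0])
    then show "Q_op T s f \<in> C0"
      by (intro closed_sequentially[OF closed_C0 _ S_lim[OF s]]) simp
  next
    have "uniform_limit {0<..1} (\<lambda>N s. s powr (1 - \<eta>) *\<^sub>R S N s) (\<lambda>s. s powr (1 - \<eta>) *\<^sub>R Q_op T s f) sequentially"
    proof (rule uniform_limitI)
      fix e :: real assume "e > 0"
      with half have "\<forall>\<^sub>F N in sequentially. 2 * K * (1 / 2) ^ N < e"
        by (rule order_tendstoD(2))
      then show "\<forall>\<^sub>F N in sequentially. \<forall>s\<in>{0<..1}.
          dist (s powr (1 - \<eta>) *\<^sub>R S N s) (s powr (1 - \<eta>) *\<^sub>R Q_op T s f) < e"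
      proof eventually_elim
        case (elim N)
        show ?case
        proof
          fix s :: real assume s: "s \<in> {0<..1}"
          have "dist (s powr (1 - \<eta>) *\<^sub>R S N s) (s powr (1 - \<eta>) *\<^sub>R Q_op T s f) =
              s powr (1 - \<eta>) * norm (Q_op T s f - S N s)"
            by (simp add: dist_norm norm_minus_commute flip: scaleR_diff_right)
          also have "\<dots> \<le> s powr (1 - \<eta>) * (2 * K * (1 / 2) ^ N * s powr (\<eta> - 1))"
            using tail[OF s, of N] by (intro mult_left_mono) (auto simp: S_def)
          also have "\<dots> = 2 * K * (1 / 2) ^ N * (s powr (1 - \<eta>) * s powr (\<eta> - 1))"
            by (simp only: ac_simps)
          also have "s powr (1 - \<eta>) * s powr (\<eta> - 1) = 1"
            using s by (simp flip: powr_add)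
          finally show "dist (s powr (1 - \<eta>) *\<^sub>R S N s) (s powr (1 - \<eta>) *\<^sub>R Q_op T s f) < e"
            using elim by simp
        qed
      qed
    qed
    moreover have "continuous_on {0<..1} (\<lambda>s. s powr (1 - \<eta>) *\<^sub>R S N s)" for N
      unfolding S_def using singular_density.G_continuous[OF K(2)]
      by (auto intro!: continuous_intros)
    ultimately have "continuous_on {0<..1} (\<lambda>s. s powr (1 - \<eta>) *\<^sub>R Q_op T s f)"
      by (intro uniform_limit_theorem[where F = sequentially]) auto
    then have "continuous_on {0<..1} (\<lambda>s. s powr (\<eta> - 1) *\<^sub>R (s powr (1 - \<eta>) *\<^sub>R Q_op T s f))"
      by (rule continuous_on_scaleR[rotated]) (auto intro!: continuous_intros)
    then show "continuous_on {0<..1} (\<lambda>s. Q_op T s f)"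
      by (rule continuous_on_eq) (simp flip: powr_add)
  qed
  then show thesis by (rule that)
qed

text \<open>
  The convolution of a partial sum is the next partial sum without its first term, and the convolution of the remainder tends
  to zero because its bound is geometrically small.
\<close>

theorem Q_op_volterra:
  assumes f: "f \<in> C0" and t: "t \<in> {0<..1}"
  shows "Q_op T t f = T t f + conv T (\<lambda>s. Q_op T s f) t 0"
proof -
  obtain K where K: "0 \<le> K"
    "\<And>n. singular_density \<eta> (K * (1 / 2) ^ n) (\<lambda>s. Q_term T n s f)"
    and tail: "\<And>N s. s \<in> {0<..1} \<Longrightarrow>
      norm (Q_op T s f - (\<Sum>n<N. Q_term T n s f)) \<le> 2 * K * (1 / 2) ^ N * s powr (\<eta> - 1)"
    using Q_op_tail_exists[OF f] by blast
  obtain KQ where Q: "singular_density \<eta> KQ (\<lambda>s. Q_op T s f)"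
    using singular_density_Q_op[OF f] .
  obtain B where B: "0 \<le> B" "\<And>t. t \<in> {0<..1} \<Longrightarrow>
      (\<integral>\<^sup>+s. ennreal (indicator {0<..<t} s * ((t - s) powr (\<eta> - 1) * s powr (\<eta> - 1))) \<partial>lborel)
      \<le> ennreal (B * t powr (\<eta> - 1))"
    using singular_convolution_bound[OF \<eta>] by blast
  define S where "S N s = (\<Sum>n<N. Q_term T n s f)" for N s
  have t': "0 < t" "(0::real) \<le> 0" "t + 0 \<le> 1" using t by auto
  have S: "(\<exists>K. singular_density \<eta> K (S N)) \<and> conv T (S N) t 0 = S (Suc N) t - T t f" for N
  proof (induction N)
    case 0
    have "singular_density \<eta> 0 (\<lambda>_. 0 :: 'a bborel)"
      by (intro singular_density.intro) (auto intro: subspace_0[OF subspace_C0])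
    then show ?case
      using conv_zero[OF t'] by (auto simp: S_def[abs_def] Q_term_0[OF f t])
  next
    case (Suc N)
    then obtain KS where KS: "singular_density \<eta> KS (S N)" by blast
    have S_step: "S (Suc m) s = S m s + Q_term T m s f" for m s
      by (simp add: S_def)
    have S_Suc: "S (Suc N) = (\<lambda>s. S N s + Q_term T N s f)"
      by (simp add: S_def fun_eq_iff)
    have "singular_density \<eta> (KS + K * (1 / 2) ^ N) (S (Suc N))"
      unfolding S_Suc by (rule singular_density_add[OF KS K(2)])
    moreover have "conv T (S (Suc N)) t 0 = S (Suc (Suc N)) t - T t f"
      unfolding S_Suc conv_add[OF KS K(2) t'] Q_term_Suc[OF f t K(2), symmetric]
      using Suc by (simp add: S_step)
    ultimately show ?case by blast
  qed
  define R where "R N s = Q_op T s f - S N s" for N s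
  have R: "singular_density \<eta> (2 * K * (1 / 2) ^ N) (R N)" for N
  proof -
    obtain KS where "singular_density \<eta> KS (S N)" using S by blast
    then interpret S: singular_density \<eta> KS "S N" .
    interpret Q: singular_density \<eta> KQ "\<lambda>s. Q_op T s f" by (rule Q)
    show ?thesis
    proof
      show "continuous_on {0<..1} (R N)"
        unfolding R_def by (intro continuous_intros S.G_continuous Q.G_continuous)
    qed (use K(1) tail Q.G_C0 S.G_C0 in \<open>auto simp: R_def S_def intro!: subspace_diff[OF subspace_C0]\<close>)
  qed
  have le: "norm (conv T (\<lambda>s. Q_op T s f) t 0 - (S (Suc N) t - T t f)) \<le> C * (2 * K * (1 / 2) ^ N) * (B * t powr (\<eta> - 1))" for N
  proof -
    obtain KS where KS: "singular_density \<eta> KS (S N)" using S by blast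
    interpret R: singular_convolution \<eta> C "2 * K * (1 / 2) ^ N" T "R N"
      using singular_family_axioms R by (rule singular_convolution.intro)
    have "conv T (\<lambda>s. R N s + S N s) t 0 = conv T (R N) t 0 + conv T (S N) t 0"
      by (rule conv_add[OF R KS t'])
    then have "conv T (\<lambda>s. Q_op T s f) t 0 - (S (Suc N) t - T t f) = conv T (R N) t 0"
      using S by (simp add: R_def)
    then show ?thesis
      using R.conv_norm_le[OF B(2,1) t'] by simp
  qed
  have "(\<lambda>N. C * (2 * K * (1 / 2) ^ N) * (B * t powr (\<eta> - 1))) \<longlonglongrightarrow> 0"
    by (intro tendsto_mult_left_zero tendsto_mult_right_zero LIMSEQ_power_zero) simp
  then have 1: "(\<lambda>N. conv T (\<lambda>s. Q_op T s f) t 0 - (S (Suc N) t - T t f)) \<longlonglongrightarrow> 0"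
    by (rule Lim_null_comparison[rotated], intro always_eventually allI le)
  have "(\<lambda>N. 2 * K * (1 / 2) ^ Suc N * t powr (\<eta> - 1)) \<longlonglongrightarrow> 0"
    by (intro tendsto_mult_left_zero tendsto_mult_right_zero LIMSEQ_Suc LIMSEQ_power_zero) simp
  then have "(\<lambda>N. Q_op T t f - S (Suc N) t) \<longlonglongrightarrow> 0"
    by (rule Lim_null_comparison[rotated]) (use tail[OF t, of "Suc _"] in \<open>simp add: S_def\<close>)
  from tendsto_diff[OF 1 this]
  have "(\<lambda>N. conv T (\<lambda>s. Q_op T s f) t 0 + T t f - Q_op T t f) \<longlonglongrightarrow> 0"
    by (simp add: algebra_simps)
  then show ?thesis
    by (simp add: LIMSEQ_const_iff algebra_simps)
qed

end

section \<open>A maximum principle for approximate solutions\<close>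

lemma C0_attains_sup:
  assumes g: "g \<in> (C0 :: 'a::euclidean_space bborel set)" and pos: "0 < apply_bborel g x0"
  obtains x1 where "\<And>x. apply_bborel g x \<le> apply_bborel g x1"
proof -
  have "\<forall>\<^sub>F x in at_infinity. dist (apply_bborel g x) 0 < apply_bborel g x0"
    using g pos by (intro tendstoD) (auto simp: C0_def)
  then obtain b where b: "\<And>x. b \<le> norm x \<Longrightarrow> \<bar>apply_bborel g x\<bar> < apply_bborel g x0"
    by (auto simp: eventually_at_infinity)
  have x0: "x0 \<in> cball 0 b"
    using b[of x0] pos by (cases "b \<le> norm x0") auto
  have "continuous_on (cball 0 b) (apply_bborel g)"
    using g by (auto simp: C0_def intro: continuous_on_subset)
  then obtain x1 where x1: "\<And>x. x \<in> cball 0 b \<Longrightarrow> apply_bborel g x \<le> apply_bborel g x1"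
    using continuous_attains_sup[OF compact_cball, of 0 b "apply_bborel g"] x0 by blast
  show thesis
  proof (rule that)
    show "apply_bborel g x \<le> apply_bborel g x1" for x
      using b[of x] x1[of x] x1[OF x0] by (cases "b \<le> norm x") auto
  qed
qed

lemma apply_bborel_le_add_norm: "apply_bborel f x \<le> apply_bborel g x + norm (f - g)"
  using abs_le_norm_bborel[of "f - g" x] by simp

text \<open>
  Suppose the bound fails and maximise \<open>w t x - \<theta> * t\<close> over space and time. The supremum over \<open>x\<close> depends continuously
  on \<open>t\<close>, since \<open>w\<close> is norm continuous, so a maximal time \<open>t1\<close> exists; the supremum at \<open>t1\<close> exceeds \<open>K \<ge> 0\<close>, hence
  \<open>t1 > \<tau>\<close> and the supremum is attained. There the time derivative is at least \<open>\<theta>\<close> (moving to the left cannot increase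
  the function), while \<open>L\<close> gives a non-positive value.
\<close>

lemma maximum_principle_bound:
  fixes w :: "real \<Rightarrow> 'a::euclidean_space bborel"
  assumes L: "positive_maximum_principle D L"
    and w_continuous: "continuous_on {0..T} w"
    and w_C0: "\<And>t. t \<in> {0..T} \<Longrightarrow> w t \<in> C0"
    and \<tau>: "0 \<le> \<tau>" and early: "\<And>t x. t \<in> {0..\<tau>} \<Longrightarrow> apply_bborel (w t) x \<le> K" and K: "0 \<le> K"
    and late: "\<And>t x. t \<in> {\<tau><..T} \<Longrightarrow> apply_bborel (w t) \<in> D \<and>
        (\<exists>dt. ((\<lambda>u. apply_bborel (w u) x) has_real_derivative dt) (at t within {0..T}) \<and>
          dt - L (apply_bborel (w t)) x < \<theta>)"
    and \<theta>: "0 < \<theta>" and t: "t \<in> {0..T}"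
  shows "apply_bborel (w t) x \<le> K + \<theta> * t"
proof (rule ccontr)
  assume contra: "\<not> apply_bborel (w t) x \<le> K + \<theta> * t"
  define M where "M t = (SUP x. apply_bborel (w t) x)" for t
  have bdd: "bdd_above (range (apply_bborel (w t)))" for t
    by (intro bdd_aboveI[of _ "norm (w t)"]) (auto intro: order_trans[OF abs_ge_self abs_le_norm_bborel])
  have le_M: "apply_bborel (w t) x \<le> M t" for t x
    unfolding M_def by (rule cSUP_upper[OF UNIV_I bdd])
  have M_le: "M t \<le> a" if "\<And>x. apply_bborel (w t) x \<le> a" for t a
    unfolding M_def using that by (intro cSUP_least) auto
  have M_diff: "M s \<le> M t + norm (w s - w t)" for s t
    by (rule M_le) (use apply_bborel_le_add_norm[of "w s" _ "w t"] le_M[of t] in \<open>smt (verit)\<close>)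
  have "continuous_on {0..T} M"
    unfolding continuous_on_iff
  proof (intro ballI allI impI)
    fix s e :: real assume s: "s \<in> {0..T}" and "0 < e"
    then obtain d where d: "d > 0" "\<forall>s'\<in>{0..T}. dist s' s < d \<longrightarrow> dist (w s') (w s) < e"
      using w_continuous unfolding continuous_on_iff by meson
    have "dist (M s') (M s) \<le> dist (w s') (w s)" for s'
      using M_diff[of s' s] M_diff[of s s'] by (simp add: dist_norm norm_minus_commute abs_le_iff)
    with d show "\<exists>d>0. \<forall>s'\<in>{0..T}. dist s' s < d \<longrightarrow> dist (M s') (M s) < e"
      by (meson le_less_trans)
  qed
  then have "continuous_on {0..T} (\<lambda>t. M t - \<theta> * t)"
    by (intro continuous_intros)
  then obtain t1 where t1: "t1 \<in> {0..T}" and max: "\<And>s. s \<in> {0..T} \<Longrightarrow> M s - \<theta> * s \<le> M t1 - \<theta> * t1"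
    using continuous_attains_sup[of "{0..T}" "\<lambda>t. M t - \<theta> * t"] t by force
  have "K < M t1 - \<theta> * t1"
    using max[OF t] le_M[of t x] contra by simp
  moreover have "0 \<le> \<theta> * t1" using \<theta> t1 by simp
  ultimately have MK: "K < M t1" by simp
  have t1_late: "t1 \<in> {\<tau><..T}"
    using t1 MK M_le[of t1 K] early[of t1] by (cases "t1 \<le> \<tau>") auto
  have "\<exists>x0. 0 < apply_bborel (w t1) x0"
    using MK K M_le[of t1 0] by (meson not_le order_trans)
  then obtain x0 where "0 < apply_bborel (w t1) x0" ..
  then obtain x1 where x1: "\<And>x. apply_bborel (w t1) x \<le> apply_bborel (w t1) x1"
    using C0_attains_sup[OF w_C0[OF t1]] by blast
  have M_x1: "M t1 = apply_bborel (w t1) x1"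
    using M_le[of t1, OF x1] le_M[of t1 x1] by simp
  obtain dt where D: "apply_bborel (w t1) \<in> D"
    and dt: "((\<lambda>u. apply_bborel (w u) x1) has_real_derivative dt) (at t1 within {0..T})"
    and less: "dt - L (apply_bborel (w t1)) x1 < \<theta>"
    using late[OF t1_late] by blast
  have "ereal (apply_bborel (w t1) x1) = (SUP x. ereal (apply_bborel (w t1) x))"
    by (intro antisym SUP_upper SUP_least) (use x1 in auto)
  then have "L (apply_bborel (w t1)) x1 \<le> 0"
    using L D MK K M_x1 unfolding positive_maximum_principle_def by auto
  with less have "dt - \<theta> < 0" by simp
  have "((\<lambda>u. apply_bborel (w u) x1 - \<theta> * u) has_real_derivative dt - \<theta>) (at t1 within {0..T})"
    by (auto intro!: derivative_eq_intros dt)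
  from has_real_derivative_neg_dec_left[OF this \<open>dt - \<theta> < 0\<close>]
  obtain d where d: "d > 0" "\<And>h. h > 0 \<Longrightarrow> t1 - h \<in> {0..T} \<Longrightarrow> h < d \<Longrightarrow>
      apply_bborel (w t1) x1 - \<theta> * t1 < apply_bborel (w (t1 - h)) x1 - \<theta> * (t1 - h)"
    by blast
  have t1_pos: "0 < t1" using t1_late \<tau> by simp
  define h where "h = min (d / 2) t1"
  have h: "h > 0" "t1 - h \<in> {0..T}" "h < d"
    using d(1) t1 t1_pos by (auto simp: h_def min_def)
  have "apply_bborel (w t1) x1 - \<theta> * t1 < M (t1 - h) - \<theta> * (t1 - h)"
    using d(2)[OF h] le_M[of "t1 - h" x1] by linarith
  also have "\<dots> \<le> M t1 - \<theta> * t1"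
    using h(2) by (rule max)
  finally show False by (simp add: M_x1)
qed


text \<open>
  For small \<open>\<epsilon>\<close> and \<open>t \<le> \<tau>\<close> uniform continuity keeps \<open>v \<epsilon> t\<close> within \<open>\<delta>\<close> of the initial value, and for
  \<open>t \<ge> \<tau>\<close> it keeps the residual below \<open>\<delta>\<close>. Thus \<open>maximum_principle_bound\<close> applies with the level \<open>c + \<delta>\<close> and the
  slope \<open>\<delta>\<close>. The residual may be discontinuous at \<open>t = 0\<close>, which is why the two ranges of \<open>t\<close> are treated separately.
\<close>

theorem approximate_maximum_principle:
  fixes v R :: "real \<Rightarrow> real \<Rightarrow> 'a::euclidean_space bborel"
  assumes L: "positive_maximum_principle D L" and E: "0 < E"
    and v_continuous: "continuous_on ({0..E} \<times> {0..T}) (\<lambda>(\<epsilon>, t). v \<epsilon> t)"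
    and v_C0: "\<And>\<epsilon> t. \<epsilon> \<in> {0<..E} \<Longrightarrow> t \<in> {0..T} \<Longrightarrow> v \<epsilon> t \<in> C0"
    and R_continuous: "continuous_on ({0..E} \<times> {0<..T}) (\<lambda>(\<epsilon>, t). R \<epsilon> t)"
    and R_0: "\<And>t. t \<in> {0<..T} \<Longrightarrow> R 0 t = 0"
    and pde: "\<And>\<epsilon> t x. \<epsilon> \<in> {0<..E} \<Longrightarrow> t \<in> {0<..T} \<Longrightarrow> apply_bborel (v \<epsilon> t) \<in> D \<and>
        (\<exists>dt. ((\<lambda>u. apply_bborel (v \<epsilon> u) x) has_real_derivative dt) (at t within {0..T}) \<and>
          dt - L (apply_bborel (v \<epsilon> t)) x = apply_bborel (R \<epsilon> t) x)"
    and c: "0 \<le> c" and init: "\<And>x. apply_bborel (v 0 0) x \<le> c"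
    and t: "t \<in> {0..T}"
  shows "apply_bborel (v 0 t) x \<le> c"
proof -
  have T: "0 \<le> T" using t by simp
  have "apply_bborel (v 0 t) x \<le> c + (2 + T) * \<delta>" if \<delta>: "0 < \<delta>" for \<delta>
  proof -
    have "uniformly_continuous_on ({0..E} \<times> {0..T}) (\<lambda>(\<epsilon>, t). v \<epsilon> t)"
      using v_continuous by (rule compact_uniformly_continuous) (intro compact_Times compact_Icc)
    then obtain \<rho> where \<rho>: "\<rho> > 0"
      and "\<forall>p\<in>{0..E} \<times> {0..T}. \<forall>q\<in>{0..E} \<times> {0..T}. dist q p < \<rho> \<longrightarrow>
        dist ((\<lambda>(\<epsilon>, t). v \<epsilon> t) q) ((\<lambda>(\<epsilon>, t). v \<epsilon> t) p) < \<delta>"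
      unfolding uniformly_continuous_on_def using \<delta> by metis
    then have v_close: "norm (v \<epsilon>' s' - v \<epsilon> s) < \<delta>"
      if "\<epsilon> \<in> {0..E}" "\<epsilon>' \<in> {0..E}" "s \<in> {0..T}" "s' \<in> {0..T}" "dist (\<epsilon>', s') (\<epsilon>, s) < \<rho>" for \<epsilon> \<epsilon>' s s'
      using that by (fastforce simp: dist_norm)
    define \<tau> where "\<tau> = \<rho> / 4"
    have \<tau>: "0 < \<tau>" using \<rho> by (simp add: \<tau>_def)
    have "uniformly_continuous_on ({0..E} \<times> {\<tau>..T}) (\<lambda>(\<epsilon>, t). R \<epsilon> t)"
      using \<tau> by (intro compact_uniformly_continuous continuous_on_subset[OF R_continuous] compact_Times compact_Icc) auto
    then obtain \<rho>' where \<rho>': "\<rho>' > 0"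
      and "\<forall>p\<in>{0..E} \<times> {\<tau>..T}. \<forall>q\<in>{0..E} \<times> {\<tau>..T}. dist q p < \<rho>' \<longrightarrow>
        dist ((\<lambda>(\<epsilon>, t). R \<epsilon> t) q) ((\<lambda>(\<epsilon>, t). R \<epsilon> t) p) < \<delta>"
      unfolding uniformly_continuous_on_def using \<delta> by metis
    then have R_close: "norm (R \<epsilon>' s' - R \<epsilon> s) < \<delta>"
      if "\<epsilon> \<in> {0..E}" "\<epsilon>' \<in> {0..E}" "s \<in> {\<tau>..T}" "s' \<in> {\<tau>..T}" "dist (\<epsilon>', s') (\<epsilon>, s) < \<rho>'" for \<epsilon> \<epsilon>' s s'
      using that by (fastforce simp: dist_norm)
    define \<epsilon> where "\<epsilon> = min E (min (\<rho> / 4) (\<rho>' / 2))"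
    have \<epsilon>: "0 < \<epsilon>" "\<epsilon> \<le> E" "\<epsilon> \<le> \<rho> / 4" "\<epsilon> < \<rho>'"
      using E \<rho> \<rho>' by (auto simp: \<epsilon>_def)
    have "apply_bborel (v \<epsilon> t) x \<le> (c + \<delta>) + \<delta> * t"
    proof (rule maximum_principle_bound[OF L, where T = T and \<tau> = "min \<tau> T"])
      have "continuous_on {0..T} (\<lambda>s. (\<lambda>(\<epsilon>, t). v \<epsilon> t) (\<epsilon>, s))"
        by (rule continuous_on_compose2[OF v_continuous]) (use \<epsilon> in \<open>auto intro!: continuous_intros\<close>)
      then show "continuous_on {0..T} (v \<epsilon>)" by simp
      show "v \<epsilon> s \<in> C0" if "s \<in> {0..T}" for s
        using v_C0[of \<epsilon> s] that \<epsilon> by simp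
      show "apply_bborel (v \<epsilon> s) x \<le> c + \<delta>" if s: "s \<in> {0..min \<tau> T}" for s x
      proof -
        have "dist (\<epsilon>, s) (0, 0) \<le> \<epsilon> + s"
          using \<epsilon> s sqrt_sum_squares_le_sum[of \<epsilon> s] by (simp add: dist_Pair_Pair)
        also have "\<dots> < \<rho>" using \<epsilon> s \<rho> by (simp add: \<tau>_def)
        finally have "norm (v \<epsilon> s - v 0 0) < \<delta>"
          using v_close[of 0 \<epsilon> 0 s] \<epsilon> s E T by auto
        then show ?thesis
          using apply_bborel_le_add_norm[of "v \<epsilon> s" x "v 0 0"] init[of x] by linarith
      qed
      fix s x assume "s \<in> {min \<tau> T<..T}"
      then have s: "s \<in> {0<..T}" "s \<in> {\<tau>..T}" using \<tau> T by auto
      obtain dt where "apply_bborel (v \<epsilon> s) \<in> D"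
        "((\<lambda>u. apply_bborel (v \<epsilon> u) x) has_real_derivative dt) (at s within {0..T})"
        "dt - L (apply_bborel (v \<epsilon> s)) x = apply_bborel (R \<epsilon> s) x"
        using pde[of \<epsilon> s x] \<epsilon> s by auto
      moreover have "norm (R \<epsilon> s - R 0 s) < \<delta>"
        using R_close[of 0 \<epsilon> s s] \<epsilon> s by (simp add: dist_Pair_Pair)
      then have "apply_bborel (R \<epsilon> s) x < \<delta>"
        using abs_le_norm_bborel[of "R \<epsilon> s" x] R_0[OF s(1)] by simp
      ultimately show "apply_bborel (v \<epsilon> s) \<in> D \<and>
          (\<exists>dt. ((\<lambda>u. apply_bborel (v \<epsilon> u) x) has_real_derivative dt) (at s within {0..T}) \<and>
            dt - L (apply_bborel (v \<epsilon> s)) x < \<delta>)"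
        by auto
    qed (use \<tau> T c \<delta> t in auto)
    moreover have "norm (v 0 t - v \<epsilon> t) < \<delta>"
      using v_close[of \<epsilon> 0 t t] \<epsilon> t \<rho> by (simp add: dist_Pair_Pair)
    moreover have "\<delta> * t \<le> \<delta> * T"
      using t \<delta> by simp
    ultimately show ?thesis
      using apply_bborel_le_add_norm[of "v 0 t" x "v \<epsilon> t"] by (simp add: algebra_simps)
  qed
  note bound = this
  show ?thesis
  proof (rule field_le_epsilon)
    fix e :: real assume "0 < e"
    then show "apply_bborel (v 0 t) x \<le> c + e"
      using bound[of "e / (2 + T)"] T by simp
  qed
qed

text \<open>
  What \<open>approximate_maximum_principle\<close> requires of \<open>v\<close> and its residual, with the residual hidden so that the property
  is visibly stable under differences.
\<close>

definition approximate_solution ::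
    "('a::euclidean_space \<Rightarrow> real) set \<Rightarrow> (('a \<Rightarrow> real) \<Rightarrow> ('a \<Rightarrow> real)) \<Rightarrow> real \<Rightarrow> real \<Rightarrow>
      (real \<Rightarrow> real \<Rightarrow> 'a bborel) \<Rightarrow> bool" where
  "approximate_solution D L E T v \<longleftrightarrow>
     continuous_on ({0..E} \<times> {0..T}) (\<lambda>(\<epsilon>, t). v \<epsilon> t) \<and>
     (\<forall>\<epsilon>\<in>{0<..E}. \<forall>t\<in>{0..T}. v \<epsilon> t \<in> C0) \<and>
     (\<exists>R. continuous_on ({0..E} \<times> {0<..T}) (\<lambda>(\<epsilon>, t). R \<epsilon> t :: 'a bborel) \<and>
       (\<forall>t\<in>{0<..T}. R 0 t = 0) \<and>
       (\<forall>\<epsilon>\<in>{0<..E}. \<forall>t\<in>{0<..T}. \<forall>x. apply_bborel (v \<epsilon> t) \<in> D \<and>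
         (\<exists>dt. ((\<lambda>u. apply_bborel (v \<epsilon> u) x) has_real_derivative dt) (at t within {0..T}) \<and>
           dt - L (apply_bborel (v \<epsilon> t)) x = apply_bborel (R \<epsilon> t) x)))"

lemma approximate_solution_residual:
  assumes "approximate_solution D L E T v"
  obtains R where "continuous_on ({0..E} \<times> {0<..T}) (\<lambda>(\<epsilon>, t). R \<epsilon> t)" "\<And>t. t \<in> {0<..T} \<Longrightarrow> R 0 t = 0"
    "\<And>\<epsilon> t x. \<epsilon> \<in> {0<..E} \<Longrightarrow> t \<in> {0<..T} \<Longrightarrow> apply_bborel (v \<epsilon> t) \<in> D \<and>
         (\<exists>dt. ((\<lambda>u. apply_bborel (v \<epsilon> u) x) has_real_derivative dt) (at t within {0..T}) \<and>
           dt - L (apply_bborel (v \<epsilon> t)) x = apply_bborel (R \<epsilon> t) x)"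
proof -
  from assms obtain R where R: "continuous_on ({0..E} \<times> {0<..T}) (\<lambda>(\<epsilon>, t). R \<epsilon> t)"
    and R_0: "\<forall>t\<in>{0<..T}. R 0 t = 0"
    and pde: "\<forall>\<epsilon>\<in>{0<..E}. \<forall>t\<in>{0<..T}. \<forall>x. apply_bborel (v \<epsilon> t) \<in> D \<and>
         (\<exists>dt. ((\<lambda>u. apply_bborel (v \<epsilon> u) x) has_real_derivative dt) (at t within {0..T}) \<and>
           dt - L (apply_bborel (v \<epsilon> t)) x = apply_bborel (R \<epsilon> t) x)"
    unfolding approximate_solution_def by (elim conjE exE) (rule that)
  show thesis
    by (rule that[of R, OF R R_0[rule_format] pde[rule_format]])
qed

lemma approximate_solution_le:
  assumes v: "approximate_solution D L E T v" and L: "positive_maximum_principle D L"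
    and E: "0 < E" and c: "0 \<le> c" and init: "\<And>x. apply_bborel (v 0 0) x \<le> c" and t: "t \<in> {0..T}"
  shows "apply_bborel (v 0 t) x \<le> c"
proof -
  obtain R where R: "continuous_on ({0..E} \<times> {0<..T}) (\<lambda>(\<epsilon>, t). R \<epsilon> t)" "\<And>t. t \<in> {0<..T} \<Longrightarrow> R 0 t = 0"
    "\<And>\<epsilon> t x. \<epsilon> \<in> {0<..E} \<Longrightarrow> t \<in> {0<..T} \<Longrightarrow> apply_bborel (v \<epsilon> t) \<in> D \<and>
         (\<exists>dt. ((\<lambda>u. apply_bborel (v \<epsilon> u) x) has_real_derivative dt) (at t within {0..T}) \<and>
           dt - L (apply_bborel (v \<epsilon> t)) x = apply_bborel (R \<epsilon> t) x)"
    using approximate_solution_residual[OF v] by blast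
  show ?thesis
    by (rule approximate_maximum_principle[OF L E _ _ R c init t])
      (use v in \<open>auto simp: approximate_solution_def\<close>)
qed

lemma linear_operator_on_diff:
  assumes L: "linear_operator_on D L" and f: "f \<in> D" and g: "g \<in> D"
  shows "(\<lambda>x. f x - g x) \<in> D" "L (\<lambda>x. f x - g x) = (\<lambda>x. L f x - L g x)"
proof -
  note L = L[unfolded linear_operator_on_def]
  note scale = bspec[OF conjunct2[OF conjunct2[OF L]] g, THEN spec[of _ "-1"]]
  note add = bspec[OF bspec[OF conjunct1[OF conjunct2[OF L]] f] conjunct1[OF scale]]
  show "(\<lambda>x. f x - g x) \<in> D" "L (\<lambda>x. f x - g x) = (\<lambda>x. L f x - L g x)"
    using scale add by simp_all
qed

lemma approximate_solution_diff:
  assumes L: "linear_operator_on D L"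
    and v: "approximate_solution D L E T v" and w: "approximate_solution D L E T w"
  shows "approximate_solution D L E T (\<lambda>\<epsilon> t. v \<epsilon> t - w \<epsilon> t)"
proof -
  obtain R where R: "continuous_on ({0..E} \<times> {0<..T}) (\<lambda>(\<epsilon>, t). R \<epsilon> t)" "\<And>t. t \<in> {0<..T} \<Longrightarrow> R 0 t = 0"
    "\<And>\<epsilon> t x. \<epsilon> \<in> {0<..E} \<Longrightarrow> t \<in> {0<..T} \<Longrightarrow> apply_bborel (v \<epsilon> t) \<in> D \<and>
         (\<exists>dt. ((\<lambda>u. apply_bborel (v \<epsilon> u) x) has_real_derivative dt) (at t within {0..T}) \<and>
           dt - L (apply_bborel (v \<epsilon> t)) x = apply_bborel (R \<epsilon> t) x)"
    using approximate_solution_residual[OF v] by blast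
  obtain S where S: "continuous_on ({0..E} \<times> {0<..T}) (\<lambda>(\<epsilon>, t). S \<epsilon> t)" "\<And>t. t \<in> {0<..T} \<Longrightarrow> S 0 t = 0"
    "\<And>\<epsilon> t x. \<epsilon> \<in> {0<..E} \<Longrightarrow> t \<in> {0<..T} \<Longrightarrow> apply_bborel (w \<epsilon> t) \<in> D \<and>
         (\<exists>dt. ((\<lambda>u. apply_bborel (w \<epsilon> u) x) has_real_derivative dt) (at t within {0..T}) \<and>
           dt - L (apply_bborel (w \<epsilon> t)) x = apply_bborel (S \<epsilon> t) x)"
    using approximate_solution_residual[OF w] by blast
  show ?thesis
    unfolding approximate_solution_def
  proof (intro conjI exI[of _ "\<lambda>\<epsilon> t. R \<epsilon> t - S \<epsilon> t"] ballI allI)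
    show "continuous_on ({0..E} \<times> {0..T}) (\<lambda>(\<epsilon>, t). v \<epsilon> t - w \<epsilon> t)"
      using v w continuous_on_diff unfolding approximate_solution_def case_prod_unfold by blast
    show "continuous_on ({0..E} \<times> {0<..T}) (\<lambda>(\<epsilon>, t). R \<epsilon> t - S \<epsilon> t)"
      using R(1) S(1) continuous_on_diff unfolding case_prod_unfold by blast
    show "v \<epsilon> t - w \<epsilon> t \<in> C0" if "\<epsilon> \<in> {0<..E}" "t \<in> {0..T}" for \<epsilon> t
      using v w that subspace_diff[OF subspace_C0] unfolding approximate_solution_def by blast
    show "R 0 t - S 0 t = 0" if "t \<in> {0<..T}" for t
      using R(2) S(2) that by simp
    fix \<epsilon> t x assume \<epsilon>: "\<epsilon> \<in> {0<..E}" and t: "t \<in> {0<..T}"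
    obtain a where v': "apply_bborel (v \<epsilon> t) \<in> D"
      "((\<lambda>u. apply_bborel (v \<epsilon> u) x) has_real_derivative a) (at t within {0..T})"
      "a - L (apply_bborel (v \<epsilon> t)) x = apply_bborel (R \<epsilon> t) x"
      using R(3)[OF \<epsilon> t] by blast
    obtain b where w': "apply_bborel (w \<epsilon> t) \<in> D"
      "((\<lambda>u. apply_bborel (w \<epsilon> u) x) has_real_derivative b) (at t within {0..T})"
      "b - L (apply_bborel (w \<epsilon> t)) x = apply_bborel (S \<epsilon> t) x"
      using S(3)[OF \<epsilon> t] by blast
    have eq: "apply_bborel (v \<epsilon> t - w \<epsilon> t) = (\<lambda>x. apply_bborel (v \<epsilon> t) x - apply_bborel (w \<epsilon> t) x)"
      by auto
    show "apply_bborel (v \<epsilon> t - w \<epsilon> t) \<in> D"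
      unfolding eq using L v'(1) w'(1) by (rule linear_operator_on_diff)
    show "\<exists>dt. ((\<lambda>u. apply_bborel (v \<epsilon> u - w \<epsilon> u) x) has_real_derivative dt) (at t within {0..T}) \<and>
        dt - L (apply_bborel (v \<epsilon> t - w \<epsilon> t)) x = apply_bborel (R \<epsilon> t - S \<epsilon> t) x"
      unfolding eq linear_operator_on_diff(2)[OF L v'(1) w'(1)]
      using DERIV_diff[OF v'(2) w'(2)] v'(3) w'(3) by (intro exI[of _ "a - b"]) simp
  qed
qed

lemma approximate_solution_zero:
  assumes L: "linear_operator_on D L"
  shows "approximate_solution D L E T (\<lambda>_ _. 0 :: 'a::euclidean_space bborel)"
proof -
  have zero: "apply_bborel 0 = (\<lambda>_. 0)" by auto
  note L = L[unfolded linear_operator_on_def]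
  note scale = bspec[OF conjunct2[OF conjunct2[OF L]] conjunct1[OF L], THEN spec[of _ 0]]
  show ?thesis
    unfolding approximate_solution_def zero
    using scale by (auto intro!: exI[of _ "\<lambda>_ _. 0"] subspace_0[OF subspace_C0] exI[of _ 0] simp: case_prod_unfold)
qed

section \<open>The regularised evolution operators\<close>

locale parametrix = P: singular_family \<eta> C P0 + Q: singular_family \<eta> C' Q0
  for \<eta> C C' :: real and P0 Q0 :: "real \<Rightarrow> 'a::euclidean_space bborel \<Rightarrow> 'a bborel" +
  fixes C1 :: real
  assumes C1: "0 \<le> C1" and P0_bound: "u \<in> {0<..1} \<Longrightarrow> norm (P0 u f) \<le> C1 * norm f"
    and P0_tendsto: "f \<in> C0 \<Longrightarrow> ((\<lambda>u. P0 u f) \<longlongrightarrow> f) (at_right 0)"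
begin

text \<open>
  The unperturbed family with the identity as its value at time zero, which makes it strongly continuous on \<open>C0\<close> over the
  closed interval.
\<close>

definition P0_ext :: "real \<Rightarrow> 'a bborel \<Rightarrow> 'a bborel" where
  "P0_ext u f = (if u = 0 then f else P0 u f)"

lemma P0_ext_C0: "u \<in> {0..1} \<Longrightarrow> f \<in> C0 \<Longrightarrow> P0_ext u f \<in> C0"
  by (simp add: P0_ext_def P.C0)

lemma P0_ext_continuous:
  assumes f: "f \<in> C0"
  shows "continuous_on {0..1} (\<lambda>u. P0_ext u f)"
  unfolding continuous_on_def
proof
  fix u :: real assume u: "u \<in> {0..1}"
  show "((\<lambda>u. P0_ext u f) \<longlongrightarrow> P0_ext u f) (at u within {0..1})"
  proof (cases "u = 0")
    case True
    have "((\<lambda>u. P0_ext u f) \<longlongrightarrow> f) (at_right 0)"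
      using P0_tendsto[OF f] by (rule Lim_transform_eventually)
        (auto simp: P0_ext_def eventually_at_filter)
    then show ?thesis
      using True by (simp add: at_within_Icc_at_right P0_ext_def)
  next
    case False
    have "continuous_on {0<..1} (\<lambda>u. P0_ext u f)"
      using P.continuous[of f] by (rule continuous_on_eq) (simp add: P0_ext_def)
    then have "((\<lambda>u. P0_ext u f) \<longlongrightarrow> P0_ext u f) (at u within {0<..1})"
      using u False unfolding continuous_on_def by simp
    moreover have "at u within {0..1} = at u within {0<..1}"
      by (rule at_within_nhd[of _ "{0<..}"]) (use u False in auto)
    ultimately show ?thesis by simp
  qed
qed

lemma P0_ext_joint_continuous: "continuous_on ({0..1} \<times> C0) (\<lambda>(u, f). P0_ext u f)"
proof (rule strongly_continuous_imp_joint_continuous[where c = "\<lambda>_. max 1 C1"])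
  fix u :: real assume u: "u \<in> {0..1}"
  show "linear (P0_ext u)"
    using P.linear[of u] u by (cases "u = 0") (auto simp: P0_ext_def[abs_def] linear_id[unfolded id_def])
  show "norm (P0_ext u f) \<le> max 1 C1 * norm f" for f
  proof (cases "u = 0")
    case True
    then show ?thesis using mult_right_mono[of 1 "max 1 C1" "norm f"] by (simp add: P0_ext_def)
  next
    case False
    then have "norm (P0_ext u f) \<le> C1 * norm f"
      using P0_bound[of u f] u by (simp add: P0_ext_def)
    also have "\<dots> \<le> max 1 C1 * norm f" by (intro mult_right_mono) auto
    finally show ?thesis .
  qed
qed (auto intro: P0_ext_continuous)

lemma conv_P0_Q:
  assumes f: "f \<in> C0"
  obtains K where "singular_convolution \<eta> C K P0 (\<lambda>s. Q_op Q0 s f)"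
    "singular_convolution \<eta> C' K Q0 (\<lambda>s. Q_op Q0 s f)"
proof -
  obtain K where "singular_density \<eta> K (\<lambda>s. Q_op Q0 s f)"
    using Q.singular_density_Q_op[OF f] .
  then show thesis
    by (intro that singular_convolution.intro P.singular_family_axioms Q.singular_family_axioms)
qed

text \<open>
  $P_{t,\varepsilon}f$, with the value \<open>f\<close> for \<open>t = \<epsilon> = 0\<close>, where the defining formula would involve the unspecified
  operator \<open>P0 0\<close>.
\<close>

definition P_reg :: "'a bborel \<Rightarrow> real \<Rightarrow> real \<Rightarrow> 'a bborel" where
  "P_reg f \<epsilon> t = P0_ext (t + \<epsilon>) f + conv P0 (\<lambda>s. Q_op Q0 s f) t \<epsilon>"

lemma P_reg_eq_P_eps: "t + \<epsilon> \<noteq> 0 \<Longrightarrow> P_reg f \<epsilon> t = P_eps P0 Q0 t \<epsilon> f"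
  by (simp add: P_reg_def P_eps_def P0_ext_def conv_def)

lemma P_reg_eq_P_op: "t \<noteq> 0 \<Longrightarrow> P_reg f 0 t = P_op P0 Q0 t f"
  by (simp add: P_reg_eq_P_eps P_eps_def P_op_def)

lemma P_reg_0_0: "P_reg f 0 0 = f"
  by (simp add: P_reg_def P0_ext_def conv_0_left)

lemma P_reg_C0:
  assumes f: "f \<in> C0" and t: "0 \<le> t" "0 \<le> \<epsilon>" "t + \<epsilon> \<le> 1"
  shows "P_reg f \<epsilon> t \<in> C0"
proof -
  obtain K where "singular_convolution \<eta> C K P0 (\<lambda>s. Q_op Q0 s f)"
    using conv_P0_Q[OF f] by metis
  then interpret PQ: singular_convolution \<eta> C K P0 "\<lambda>s. Q_op Q0 s f" .
  have "conv P0 (\<lambda>s. Q_op Q0 s f) t \<epsilon> \<in> C0"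
  proof (cases "t = 0")
    case True
    then show ?thesis by (simp add: conv_0_left subspace_0[OF subspace_C0])
  next
    case False
    with t show ?thesis by (intro PQ.conv_C0) auto
  qed
  then show ?thesis
    unfolding P_reg_def using f t by (intro subspace_add[OF subspace_C0] P0_ext_C0) auto
qed

lemma P_reg_continuous:
  assumes f: "f \<in> C0"
  shows "continuous_on {(\<epsilon>, t). 0 \<le> t \<and> 0 \<le> \<epsilon> \<and> t + \<epsilon> \<le> 1} (\<lambda>(\<epsilon>, t). P_reg f \<epsilon> t)"
proof -
  obtain K where "singular_convolution \<eta> C K P0 (\<lambda>s. Q_op Q0 s f)"
    using conv_P0_Q[OF f] by metis
  then interpret PQ: singular_convolution \<eta> C K P0 "\<lambda>s. Q_op Q0 s f" .
  let ?S = "{(\<epsilon>, t). 0 \<le> t \<and> 0 \<le> \<epsilon> \<and> t + \<epsilon> \<le> (1::real)}"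
  have "continuous_on ?S (\<lambda>p. P0_ext (snd p + fst p) f)"
    by (rule continuous_on_compose2[OF P0_ext_continuous[OF f]]) (auto intro!: continuous_intros)
  moreover have "continuous_on ?S (\<lambda>p. (\<lambda>(t, \<epsilon>). conv P0 (\<lambda>s. Q_op Q0 s f) t \<epsilon>) (snd p, fst p))"
    by (rule continuous_on_compose2[OF PQ.conv_continuous_up_to_0[OF P0_bound C1]]) (auto intro!: continuous_intros)
  ultimately show ?thesis
    unfolding P_reg_def case_prod_unfold by (auto intro: continuous_on_add)
qed

text \<open>
  The right-hand side of the evolution equation, extended continuously to \<open>\<epsilon> = 0\<close>.
\<close>

definition residual :: "'a bborel \<Rightarrow> real \<Rightarrow> real \<Rightarrow> 'a bborel" where
  "residual f \<epsilon> t = P0_ext \<epsilon> (Q_op Q0 t f) - Q0 (t + \<epsilon>) f - conv Q0 (\<lambda>s. Q_op Q0 s f) t \<epsilon>"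

lemma residual_0: "f \<in> C0 \<Longrightarrow> t \<in> {0<..1} \<Longrightarrow> residual f 0 t = 0"
  using Q.Q_op_volterra[of f t] by (simp add: residual_def P0_ext_def)

lemma residual_continuous:
  assumes f: "f \<in> C0"
  shows "continuous_on {(\<epsilon>, t). 0 < t \<and> 0 \<le> \<epsilon> \<and> t + \<epsilon> \<le> 1} (\<lambda>(\<epsilon>, t). residual f \<epsilon> t)"
proof -
  obtain K where "singular_convolution \<eta> C' K Q0 (\<lambda>s. Q_op Q0 s f)"
    using conv_P0_Q[OF f] by metis
  then interpret QQ: singular_convolution \<eta> C' K Q0 "\<lambda>s. Q_op Q0 s f" .
  let ?S = "{(\<epsilon>, t). 0 < t \<and> 0 \<le> \<epsilon> \<and> t + \<epsilon> \<le> (1::real)}"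
  have Q: "continuous_on ?S (\<lambda>p. Q_op Q0 (snd p) f)"
    by (rule continuous_on_compose2[OF QQ.G_continuous]) (auto intro!: continuous_intros)
  have "continuous_on ?S (\<lambda>p. (\<lambda>(u, f). P0_ext u f) (fst p, Q_op Q0 (snd p) f))"
    by (rule continuous_on_compose2[OF P0_ext_joint_continuous])
      (use QQ.G_C0 in \<open>auto intro!: continuous_on_Pair continuous_on_fst continuous_on_id Q\<close>)
  moreover have "continuous_on ?S (\<lambda>p. Q0 (snd p + fst p) f)"
    by (rule continuous_on_compose2[OF Q.continuous]) (auto intro!: continuous_intros)
  moreover have "continuous_on ?S (\<lambda>p. (\<lambda>(t, \<epsilon>). conv Q0 (\<lambda>s. Q_op Q0 s f) t \<epsilon>) (snd p, fst p))"
    by (rule continuous_on_compose2[OF QQ.conv_continuous]) (auto intro!: continuous_intros)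
  ultimately show ?thesis
    unfolding residual_def case_prod_unfold by (auto intro!: continuous_on_diff)
qed

end

locale parametrix_generator = parametrix \<eta> C C' P0 Q0 C1
  for \<eta> C C' :: real and P0 Q0 :: "real \<Rightarrow> 'a::euclidean_space bborel \<Rightarrow> 'a bborel" and C1 :: real +
  fixes D :: "('a \<Rightarrow> real) set" and L :: "('a \<Rightarrow> real) \<Rightarrow> ('a \<Rightarrow> real)"
  assumes L_linear: "linear_operator_on D L"
    and L_maximum: "positive_maximum_principle D L"
    and evolution: "0 < t \<Longrightarrow> 0 < \<epsilon> \<Longrightarrow> t + \<epsilon> \<le> 1 \<Longrightarrow> f \<in> C0 \<Longrightarrow>
      apply_bborel (P_eps P0 Q0 t \<epsilon> f) \<in> D \<and>
      (\<exists>dt. ((\<lambda>u. apply_bborel (P_eps P0 Q0 u \<epsilon> f) x) has_real_derivative dt) (at t within {0..1 - \<epsilon>}) \<and>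
        dt - L (apply_bborel (P_eps P0 Q0 t \<epsilon> f)) x =
          apply_bborel (P0 \<epsilon> (Q_op Q0 t f)) x - apply_bborel (Q0 (t + \<epsilon>) f) x
          - apply_bborel (conv Q0 (\<lambda>s. Q_op Q0 s f) t \<epsilon>) x)"
begin

text \<open>
  The shift \<open>s\<close> is what allows $P_{t+s,\varepsilon}f$ to be compared with $P_{t,\varepsilon}(P_sf)$.
\<close>

lemma approximate_solution_P_reg:
  assumes f: "f \<in> C0" and s: "0 \<le> s" "0 \<le> E" "s + T + E \<le> 1"
  shows "approximate_solution D L E T (\<lambda>\<epsilon> t. P_reg f \<epsilon> (s + t))"
  unfolding approximate_solution_def
proof (intro conjI exI[of _ "\<lambda>\<epsilon> t. residual f \<epsilon> (s + t)"] ballI allI)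
  have "continuous_on ({0..E} \<times> {0..T}) (\<lambda>p. (\<lambda>(\<epsilon>, t). P_reg f \<epsilon> t) (fst p, s + snd p))"
    by (rule continuous_on_compose2[OF P_reg_continuous[OF f]]) (use s in \<open>auto intro!: continuous_intros\<close>)
  then show "continuous_on ({0..E} \<times> {0..T}) (\<lambda>(\<epsilon>, t). P_reg f \<epsilon> (s + t))"
    by (simp add: case_prod_unfold)
  have "continuous_on ({0..E} \<times> {0<..T}) (\<lambda>p. (\<lambda>(\<epsilon>, t). residual f \<epsilon> t) (fst p, s + snd p))"
    by (rule continuous_on_compose2[OF residual_continuous[OF f]]) (use s in \<open>auto intro!: continuous_intros\<close>)
  then show "continuous_on ({0..E} \<times> {0<..T}) (\<lambda>(\<epsilon>, t). residual f \<epsilon> (s + t))"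
    by (simp add: case_prod_unfold)
  show "P_reg f \<epsilon> (s + t) \<in> C0" if "\<epsilon> \<in> {0<..E}" "t \<in> {0..T}" for \<epsilon> t
    using that s by (intro P_reg_C0 f) auto
  fix t assume t: "t \<in> {0<..T}"
  show "residual f 0 (s + t) = 0"
    using t s by (intro residual_0 f) auto
  fix \<epsilon> x assume \<epsilon>: "\<epsilon> \<in> {0<..E}"
  have st: "0 < s + t" "0 < \<epsilon>" "s + t + \<epsilon> \<le> 1" using s t \<epsilon> by auto
  obtain dt where D: "apply_bborel (P_eps P0 Q0 (s + t) \<epsilon> f) \<in> D"
    and dt: "((\<lambda>u. apply_bborel (P_eps P0 Q0 u \<epsilon> f) x) has_real_derivative dt) (at (s + t) within {0..1 - \<epsilon>})"
    and eq: "dt - L (apply_bborel (P_eps P0 Q0 (s + t) \<epsilon> f)) x =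
          apply_bborel (P0 \<epsilon> (Q_op Q0 (s + t) f)) x - apply_bborel (Q0 (s + t + \<epsilon>) f) x
          - apply_bborel (conv Q0 (\<lambda>s. Q_op Q0 s f) (s + t) \<epsilon>) x"
    using evolution[OF st f] by blast
  have reg: "P_reg f \<epsilon> u = P_eps P0 Q0 u \<epsilon> f" if "0 \<le> u" for u
    using that \<epsilon> by (intro P_reg_eq_P_eps) auto
  show "apply_bborel (P_reg f \<epsilon> (s + t)) \<in> D"
    using D st reg by simp
  have "((\<lambda>u. apply_bborel (P_reg f \<epsilon> u) x) has_real_derivative dt) (at (s + t) within {0..1 - \<epsilon>})"
    by (rule has_field_derivative_transform_within[OF dt, of 1]) (use st reg in auto)
  then have "((\<lambda>u. apply_bborel (P_reg f \<epsilon> u) x) has_real_derivative dt) (at (s + t) within (+) s ` {0..T})"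
    by (rule has_field_derivative_subset) (use s \<epsilon> in auto)
  then have "((\<lambda>u. apply_bborel (P_reg f \<epsilon> (s + u)) x) has_real_derivative dt) (at t within {0..T})"
    by (simp only: DERIV_at_within_shift)
  moreover have "dt - L (apply_bborel (P_reg f \<epsilon> (s + t))) x = apply_bborel (residual f \<epsilon> (s + t)) x"
    using eq st reg by (simp add: residual_def P0_ext_def)
  ultimately show "\<exists>dt. ((\<lambda>u. apply_bborel (P_reg f \<epsilon> (s + u)) x) has_real_derivative dt) (at t within {0..T}) \<and>
      dt - L (apply_bborel (P_reg f \<epsilon> (s + t))) x = apply_bborel (residual f \<epsilon> (s + t)) x"
    by blast
qed

text \<open>
  Approximate solutions up to time \<open>T\<close> need \<open>T + \<epsilon> \<le> 1\<close> with positive \<open>\<epsilon>\<close>, so the end point is only reached as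
  a limit of earlier times.
\<close>

lemma limit_le:
  fixes h :: "real \<Rightarrow> 'a bborel"
  assumes h: "continuous_on {0..b} h" and le: "\<And>t. t \<in> {0..<b} \<Longrightarrow> apply_bborel (h t) x \<le> c"
    and b: "0 < b" and t: "t \<in> {0..b}"
  shows "apply_bborel (h t) x \<le> c"
proof -
  have "continuous_on {0..b} (\<lambda>t. apply_bborel (h t) x)"
    using bounded_linear.continuous_on[OF bounded_linear_apply_bborel h] .
  then have "continuous_on (closure {0..<b}) (\<lambda>t. apply_bborel (h t) x)"
    using b by simp
  then show ?thesis
    by (rule continuous_le_on_closure) (use t b le in auto)
qed

lemma P_reg_0_continuous:
  assumes f: "f \<in> C0"
  shows "continuous_on {0..1} (P_reg f 0)"
proof -
  have "continuous_on {0..1} (\<lambda>t. (\<lambda>(\<epsilon>, t). P_reg f \<epsilon> t) (0, t))"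
    by (rule continuous_on_compose2[OF P_reg_continuous[OF f]]) (auto intro!: continuous_intros)
  then show ?thesis by simp
qed

theorem P_op_le:
  assumes f: "f \<in> C0" and c: "0 \<le> c" "\<And>x. apply_bborel f x \<le> c" and t: "t \<in> {0<..1}"
  shows "apply_bborel (P_op P0 Q0 t f) x \<le> c"
proof -
  have "apply_bborel (P_reg f 0 t) x \<le> c"
  proof (rule limit_le[OF P_reg_0_continuous[OF f]])
    fix t :: real assume t: "t \<in> {0..<1}"
    have "approximate_solution D L (1 - t) t (P_reg f)"
      using approximate_solution_P_reg[OF f, where s = 0 and T = t and E = "1 - t"] t by simp
    then show "apply_bborel (P_reg f 0 t) x \<le> c"
      by (rule approximate_solution_le[OF _ L_maximum]) (use t c P_reg_0_0 in auto)
  qed (use t in auto)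
  then show ?thesis
    using t by (simp add: P_reg_eq_P_op)
qed

theorem P_op_nonneg:
  assumes f: "f \<in> C0" and nonneg: "\<And>x. 0 \<le> apply_bborel f x" and t: "t \<in> {0<..1}"
  shows "0 \<le> apply_bborel (P_op P0 Q0 t f) x"
proof -
  have "apply_bborel (0 - P_reg f 0 t) x \<le> 0"
  proof (rule limit_le[where h = "\<lambda>t. 0 - P_reg f 0 t"])
    show "continuous_on {0..1} (\<lambda>t. 0 - P_reg f 0 t)"
      by (intro continuous_intros P_reg_0_continuous f)
    fix t :: real assume t: "t \<in> {0..<1}"
    have "approximate_solution D L (1 - t) t (P_reg f)"
      using approximate_solution_P_reg[OF f, where s = 0 and T = t and E = "1 - t"] t by simp
    then have "approximate_solution D L (1 - t) t (\<lambda>\<epsilon> t. 0 - P_reg f \<epsilon> t)"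
      by (rule approximate_solution_diff[OF L_linear approximate_solution_zero[OF L_linear]])
    then show "apply_bborel (0 - P_reg f 0 t) x \<le> 0"
      by (rule approximate_solution_le[OF _ L_maximum]) (use t nonneg P_reg_0_0 in auto)
  qed (use t in auto)
  then show ?thesis
    using t by (simp add: P_reg_eq_P_op)
qed

text \<open>
  As functions of \<open>t\<close>, both sides are limits of approximate solutions with the initial value $P_sf$; the maximum principle
  bounds each difference of them by zero.
\<close>

theorem P_op_semigroup:
  assumes f: "f \<in> C0" and ts: "0 < t" "0 < s" "t + s \<le> 1"
  shows "P_op P0 Q0 t (P_op P0 Q0 s f) = P_op P0 Q0 (t + s) f"
proof (rule bborel_eqI)
  fix x
  define g where "g = P_reg f 0 s"
  have g: "g \<in> C0" unfolding g_def using ts by (intro P_reg_C0 f) auto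
  have cg: "continuous_on {0..1 - s} (P_reg g 0)"
    by (rule continuous_on_subset[OF P_reg_0_continuous[OF g]]) (use ts in auto)
  have cf: "continuous_on {0..1 - s} (\<lambda>t. P_reg f 0 (s + t))"
    by (rule continuous_on_compose2[OF P_reg_0_continuous[OF f]]) (use ts in \<open>auto intro!: continuous_intros\<close>)
  have sol: "approximate_solution D L (1 - s - t) t (P_reg g)"
    "approximate_solution D L (1 - s - t) t (\<lambda>\<epsilon> t. P_reg f \<epsilon> (s + t))" if "t \<in> {0..<1 - s}" for t
    using approximate_solution_P_reg[OF g, where s = 0 and T = t and E = "1 - s - t"]
      approximate_solution_P_reg[OF f, where s = s and T = t and E = "1 - s - t"] ts that by simp_all
  have "apply_bborel (P_reg g 0 t - P_reg f 0 (s + t)) x \<le> 0"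
  proof (rule limit_le[where h = "\<lambda>t. P_reg g 0 t - P_reg f 0 (s + t)"])
    fix t assume t: "t \<in> {0..<1 - s}"
    show "apply_bborel (P_reg g 0 t - P_reg f 0 (s + t)) x \<le> 0"
      by (rule approximate_solution_le[OF approximate_solution_diff[OF L_linear sol(1)[OF t] sol(2)[OF t]] L_maximum])
        (use t in \<open>auto simp: P_reg_0_0 g_def\<close>)
  qed (use ts in \<open>auto intro!: continuous_on_diff cg cf\<close>)
  moreover have "apply_bborel (P_reg f 0 (s + t) - P_reg g 0 t) x \<le> 0"
  proof (rule limit_le[where h = "\<lambda>t. P_reg f 0 (s + t) - P_reg g 0 t"])
    fix t assume t: "t \<in> {0..<1 - s}"
    show "apply_bborel (P_reg f 0 (s + t) - P_reg g 0 t) x \<le> 0"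
      by (rule approximate_solution_le[OF approximate_solution_diff[OF L_linear sol(2)[OF t] sol(1)[OF t]] L_maximum])
        (use t in \<open>auto simp: P_reg_0_0 g_def\<close>)
  qed (use ts in \<open>auto intro!: continuous_on_diff cg cf\<close>)
  ultimately show "apply_bborel (P_op P0 Q0 t (P_op P0 Q0 s f)) x = apply_bborel (P_op P0 Q0 (t + s) f) x"
    using ts by (simp add: g_def P_reg_eq_P_op add.commute)
qed

end

section \<open>Positivity, semigroup law and sub-Markov property\<close>

lemma continuous_on_of_norm_tendsto:
  assumes "\<forall>t\<in>S. ((\<lambda>s. norm (T s - T t)) \<longlongrightarrow> 0) (at t within S)"
  shows "continuous_on S T"
  using assms unfolding continuous_on_def by (simp add: tendsto_norm_zero_iff LIM_zero_iff)

theorem proposition3p15: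
  fixes r :: "real \<Rightarrow> real"
    and P0 Q0 :: "real \<Rightarrow> (real ^ 'd) bborel \<Rightarrow> (real ^ 'd) bborel"
    and D :: "(real ^ 'd \<Rightarrow> real) set"
    and L :: "(real ^ 'd \<Rightarrow> real) \<Rightarrow> (real ^ 'd \<Rightarrow> real)"
  assumes R0: "\<forall>t\<in>{0<..1}. 0 \<le> r t" "mono_on {0<..1} r"
      "\<forall>t\<in>{0<..1}. \<forall>c\<in>{0<..1}. r (c * t) \<le> sqrt c * r t"
    and S1: "\<forall>t\<in>{0<..1}. linear (P0 t) \<and> linear (Q0 t)"
    and S2: "\<forall>t\<in>{0<..1}. P0 t ` C0 \<subseteq> C0 \<and> Q0 t ` C0 \<subseteq> C0"
    and H0: "\<forall>f\<in>C0. ((\<lambda>t. norm (P0 t f - f)) \<longlongrightarrow> 0) (at_right 0)"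
    and H1: "\<exists>C1>0. \<forall>t\<in>{0<..1}. \<forall>f. norm (P0 t f) \<le> C1 * norm f"
    and H2: "\<forall>t\<in>{0<..1}. \<forall>f. ((\<lambda>s. norm (P0 s f - P0 t f)) \<longlongrightarrow> 0) (at t within {0<..1})"
    and H3: "\<exists>C3>0. \<exists>\<epsilon>0>0. \<forall>t\<in>{0<..1}. \<forall>f.
      norm (Q0 t f) \<le> C3 * inverse t * r t powr \<epsilon>0 * norm f"
    and H4: "\<forall>t\<in>{0<..1}. \<forall>f. ((\<lambda>s. norm (Q0 s f - Q0 t f)) \<longlongrightarrow> 0) (at t within {0<..1})"
    and L0: "linear_operator_on D L"
    and L1: "positive_maximum_principle D L"
    and H5: "\<forall>t>0. \<forall>\<epsilon>>0. t + \<epsilon> \<le> 1 \<longrightarrow> (\<forall>x. \<forall>f\<in>C0.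
      apply_bborel (P_eps P0 Q0 t \<epsilon> f) \<in> D \<and>
      (\<exists>dt. ((\<lambda>u. apply_bborel (P_eps P0 Q0 u \<epsilon> f) x) has_real_derivative dt) (at t within {0..1 - \<epsilon>}) \<and>
        dt - L (apply_bborel (P_eps P0 Q0 t \<epsilon> f)) x =
          apply_bborel (P0 \<epsilon> (Q_op Q0 t f)) x - apply_bborel (Q0 (t + \<epsilon>) f) x
          - apply_bborel (set_gen_bochner_integral lborel {0<..<t}
              (\<lambda>s. Q0 (t - s + \<epsilon>) (Q_op Q0 s f))) x))"
  shows "(\<forall>t\<in>{0<..1}. \<forall>f\<in>C0. (\<forall>x. 0 \<le> apply_bborel f x) \<longrightarrow>
      (\<forall>x. 0 \<le> apply_bborel (P_op P0 Q0 t f) x)) \<and>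
    (\<forall>t>0. \<forall>s>0. t + s \<le> 1 \<longrightarrow> (\<forall>f\<in>C0.
      P_op P0 Q0 t (P_op P0 Q0 s f) = P_op P0 Q0 (t + s) f)) \<and>
    ((\<exists>c. c \<noteq> 0 \<and> (\<lambda>_. c) \<in> D) \<longrightarrow> (\<forall>t\<in>{0<..1}. \<forall>f\<in>C0.
      (\<forall>x. apply_bborel f x \<le> 1) \<longrightarrow> (\<forall>x. apply_bborel (P_op P0 Q0 t f) x \<le> 1)))"
proof -
  from H1 obtain C1 where C1: "C1 > 0" "\<And>t f. t \<in> {0<..1} \<Longrightarrow> norm (P0 t f) \<le> C1 * norm f"
    by blast
  from H3 obtain C3 \<epsilon>0 where C3: "C3 > 0" "\<epsilon>0 > 0" and
    Q0: "\<And>t f. t \<in> {0<..1} \<Longrightarrow> norm (Q0 t f) \<le> C3 * inverse t * r t powr \<epsilon>0 * norm f"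
    by blast
  \<comment> \<open>The scaling of \<open>r\<close> bounds \<open>r t powr \<epsilon>0\<close> by a multiple of \<open>t powr (\<epsilon>0 / 2)\<close>; the exponent is lowered to be less than one.\<close>
  define \<eta> where "\<eta> = min (\<epsilon>0 / 2) (1 / 2)"
  have \<eta>: "0 < \<eta>" "\<eta> < 1" "\<eta> \<le> \<epsilon>0 / 2" using C3 by (auto simp: \<eta>_def)
  define C' where "C' = C3 * r 1 powr \<epsilon>0"
  have P_bound: "norm (P0 t f) \<le> C1 * t powr (\<eta> - 1) * norm f" if t: "t \<in> {0<..1}" for t f
  proof -
    have "1 powr (\<eta> - 1) \<le> t powr (\<eta> - 1)" using t \<eta> by (intro powr_mono2') auto
    then have "C1 * norm f * 1 \<le> C1 * norm f * t powr (\<eta> - 1)"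
      using C1 by (intro mult_left_mono) auto
    with C1(2)[OF t, of f] show ?thesis by (simp add: ac_simps)
  qed
  have Q_bound: "norm (Q0 t f) \<le> C' * t powr (\<eta> - 1) * norm f" if t: "t \<in> {0<..1}" for t f
  proof -
    have "r (t * 1) \<le> sqrt t * r 1" using R0(3) t by fastforce
    then have "r t powr \<epsilon>0 \<le> (sqrt t * r 1) powr \<epsilon>0"
      using t C3 R0(1) by (intro powr_mono2) auto
    also have "\<dots> = t powr (\<epsilon>0 / 2) * r 1 powr \<epsilon>0"
      using t R0(1) by (simp add: powr_mult powr_half_sqrt[symmetric] powr_powr)
    also have "\<dots> \<le> t powr \<eta> * r 1 powr \<epsilon>0"
      using t \<eta> by (intro mult_right_mono powr_mono') auto
    finally have "C3 * inverse t * r t powr \<epsilon>0 * norm f \<le> C3 * inverse t * (t powr \<eta> * r 1 powr \<epsilon>0) * norm f"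
      using t C3 by (intro mult_left_mono mult_right_mono) auto
    also have "\<dots> = C' * t powr (\<eta> - 1) * norm f"
      using t by (simp add: C'_def powr_diff divide_inverse ac_simps)
    finally show ?thesis using Q0[OF t, of f] by simp
  qed
  have linear: "linear (P0 t)" "linear (Q0 t)" if "t \<in> {0<..1}" for t
    using S1 that by blast+
  have C0: "P0 t f \<in> C0" "Q0 t f \<in> C0" if "t \<in> {0<..1}" "f \<in> C0" for t f
    using S2 that by blast+
  have continuous: "continuous_on {0<..1} (\<lambda>t. P0 t f)" "continuous_on {0<..1} (\<lambda>t. Q0 t f)" for f
    using H2 H4 by (auto intro!: continuous_on_of_norm_tendsto)
  have "0 \<le> C1" "0 \<le> C'" using C1 C3 by (simp_all add: C'_def)
  note families = singular_family.intro[OF \<eta>(1,2) \<open>0 \<le> C1\<close> linear(1) C0(1) P_bound continuous(1)]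
    singular_family.intro[OF \<eta>(1,2) \<open>0 \<le> C'\<close> linear(2) C0(2) Q_bound continuous(2)]
  have "((\<lambda>u. P0 u f) \<longlongrightarrow> f) (at_right 0)" if "f \<in> C0" for f
    using H0 that by (simp add: tendsto_norm_zero_iff LIM_zero_iff)
  from families \<open>0 \<le> C1\<close> C1(2) this have "parametrix \<eta> C1 C' P0 Q0 C1"
    by (intro parametrix.intro parametrix_axioms.intro)
  moreover have "parametrix_generator_axioms P0 Q0 D L"
    by (rule parametrix_generator_axioms.intro[OF L0 L1], unfold conv_def) (rule H5[rule_format])
  ultimately interpret parametrix_generator \<eta> C1 C' P0 Q0 C1 D L
    by (rule parametrix_generator.intro)
  show ?thesis
    using P_op_nonneg P_op_semigroup P_op_le[of _ 1] by auto
qed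

end
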